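(* Let $\lambda=\lambda_1\epsilon_1+\dots+\lambda_n\epsilon_n\in P$ (some $\lambda_i$ may be zero). Every $\mathbb Z_2$-graded $\mathrm{Cliff}_q(\lambda_N)$-module is completely reducible. Furthermore, the superalgebra $\mathrm{Cliff}_q(\lambda)$ has, up to isomorphism: (1) two simple modules $E^q(\lambda)$ and $\Pi(E^q(\lambda))$, of dimension $2^{k-1}|2^{k-1}$, if $|\lambda|=2k$ and $\overline{\Delta(\lambda)}=\bar1$; (2) one simple module $E^q(\lambda)\cong\Pi(E^q(\lambda))$, of dimension $2^k|2^k$, if $|\lambda|=2k$ and $\overline{\Delta(\lambda)}\neq\bar1$ (in particular, if $\lambda_1>\dots>\lambda_{2k}>0$); (3) one simple module $E^q(\lambda)\cong\Pi(E^q(\lambda))$, of dimension $2^k|2^k$, if $|\lambda|=2k+1$.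
   Context: Let $\mathbb F=\mathbb C(q)$ and $P=\bigoplus_{i=1}^n\mathbb Z\epsilon_i$. For $\lambda=\sum\lambda_i\epsilon_i\in P$ put $\Lambda_i=\frac{q^{2\lambda_i}-q^{-2\lambda_i}}{q^2-q^{-2}}\in\mathbb F$. $\mathrm{Cliff}_q(\lambda)$ is the associative $\mathbb F$-superalgebra with $1$ generated by odd elements $t_{\bar1},\dots,t_{\bar n}$ with relations $t_{\bar i}t_{\bar j}+t_{\bar j}t_{\bar i}=2\delta_{ij}\Lambda_i$. Let $N_\lambda=\{i\mid\lambda_i\ne0\}=\{i_1<\dots<i_{|\lambda|}\}$, so that $|\lambda|=\#N_\lambda$ is the number of nonzero $\lambda_i$, and let $\lambda_N=(\lambda_{i_1},\dots,\lambda_{i_{|\lambda|}})$; $\mathrm{Cliff}_q(\lambda_N)$ is the analogous Clifford superalgebra generated only by the $t_{\bar i}$ with $i\in N_\lambda$. Put $\Delta(\lambda)=\prod_{i\in N_\lambda}\Lambda_i$, and let $\overline{\Delta(\lambda)}$ be its class in $\mathbb F^\times/(\mathbb F^\times)^2$. Simple modules over the superalgebra $\mathrm{Cliff}_q(\lambda)$ are $\mathbb Z_2$-graded simple modules (no proper nonzero graded submodules), isomorphisms are parity preserving, $\Pi$ is the parity change functor, and dimension $a|b$ means even part of dimension $a$ and odd part of dimension $b$ over $\mathbb F$.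
   Formalization: For |λ|=0 (k=0) the dimension 2^{k-1}|2^{k-1} is undefined and the condition λ_1>…>λ_{2k}>0 is empty while Δ(λ)=1; so the dimension in (1) and the "in particular" in (2) are stated for k≥1 only, the classification in (1) for all k. *)

theory Defs
  imports
    "HOL-Algebra.Algebra"
    "HOL-Library.Z2"
    "HOL-Library.Poly_Mapping"
    "HOL-Computational_Algebra.Polynomial"
    "HOL-Computational_Algebra.Fraction_Field"
begin

section \<open>Superalgebras and their graded modules\<close>

text \<open>
  One record serves both for superalgebras and for graded modules; as usual for
  \<^type>\<open>module_ext\<close> records, the multiplicative fields are ignored in the case of modules.
  Parities are elements of the field \<^typ>\<open>bit\<close> with two elements.
\<close>

record ('r, 'm) graded = "('r, 'm) module" +
  homog :: "bit \<Rightarrow> 'm set"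

locale superalgebra = ring A for A :: "('k::field, 'a) graded" (structure) +
  assumes scale_closed: "x \<in> carrier A \<Longrightarrow> c \<odot> x \<in> carrier A"
    and scale_l_distr: "x \<in> carrier A \<Longrightarrow> (c + d) \<odot> x = c \<odot> x \<oplus> d \<odot> x"
    and scale_r_distr:
      "x \<in> carrier A \<Longrightarrow> y \<in> carrier A \<Longrightarrow> c \<odot> (x \<oplus> y) = c \<odot> x \<oplus> c \<odot> y"
    and scale_assoc: "x \<in> carrier A \<Longrightarrow> (c * d) \<odot> x = c \<odot> (d \<odot> x)"
    and scale_one: "x \<in> carrier A \<Longrightarrow> 1 \<odot> x = x"
    and scale_mult_left:
      "x \<in> carrier A \<Longrightarrow> y \<in> carrier A \<Longrightarrow> c \<odot> (x \<otimes> y) = (c \<odot> x) \<otimes> y"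
    and scale_mult_right:
      "x \<in> carrier A \<Longrightarrow> y \<in> carrier A \<Longrightarrow> c \<odot> (x \<otimes> y) = x \<otimes> (c \<odot> y)"
    and homog_subgroup: "additive_subgroup (homog A i) A"
    and homog_scale: "x \<in> homog A i \<Longrightarrow> c \<odot> x \<in> homog A i"
    and homog_sum: "carrier A = homog A 0 <+> homog A 1"
    and homog_inter: "homog A 0 \<inter> homog A 1 = {\<zero>}"
    and homog_one: "\<one> \<in> homog A 0"
    and homog_mult: "x \<in> homog A i \<Longrightarrow> y \<in> homog A j \<Longrightarrow> x \<otimes> y \<in> homog A (i + j)"

text \<open>
  Left modules.  The locale \<^locale>\<open>module\<close> of the library is not applicable, as it requires a
  commutative ring of scalars.
\<close>

locale supermodule = A?: superalgebra A + M?: abelian_group M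
  for A :: "('k::field, 'a) graded" (structure) and M :: "('a, 'm) graded" (structure) +
  assumes smult_closed:
      "\<lbrakk>a \<in> carrier A; v \<in> carrier M\<rbrakk> \<Longrightarrow> a \<odot>\<^bsub>M\<^esub> v \<in> carrier M"
    and smult_l_distr:
      "\<lbrakk>a \<in> carrier A; b \<in> carrier A; v \<in> carrier M\<rbrakk> \<Longrightarrow>
       (a \<oplus>\<^bsub>A\<^esub> b) \<odot>\<^bsub>M\<^esub> v = a \<odot>\<^bsub>M\<^esub> v \<oplus>\<^bsub>M\<^esub> b \<odot>\<^bsub>M\<^esub> v"
    and smult_r_distr:
      "\<lbrakk>a \<in> carrier A; v \<in> carrier M; w \<in> carrier M\<rbrakk> \<Longrightarrow>
       a \<odot>\<^bsub>M\<^esub> (v \<oplus>\<^bsub>M\<^esub> w) = a \<odot>\<^bsub>M\<^esub> v \<oplus>\<^bsub>M\<^esub> a \<odot>\<^bsub>M\<^esub> w"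
    and smult_assoc:
      "\<lbrakk>a \<in> carrier A; b \<in> carrier A; v \<in> carrier M\<rbrakk> \<Longrightarrow>
       (a \<otimes>\<^bsub>A\<^esub> b) \<odot>\<^bsub>M\<^esub> v = a \<odot>\<^bsub>M\<^esub> (b \<odot>\<^bsub>M\<^esub> v)"
    and smult_one: "v \<in> carrier M \<Longrightarrow> \<one>\<^bsub>A\<^esub> \<odot>\<^bsub>M\<^esub> v = v"
    and mod_homog_subgroup: "additive_subgroup (homog M i) M"
    and mod_homog_sum: "carrier M = homog M 0 <+>\<^bsub>M\<^esub> homog M 1"
    and mod_homog_inter: "homog M 0 \<inter> homog M 1 = {\<zero>\<^bsub>M\<^esub>}"
    and homog_smult:
      "\<lbrakk>a \<in> homog A i; v \<in> homog M j\<rbrakk> \<Longrightarrow> a \<odot>\<^bsub>M\<^esub> v \<in> homog M (i + j)"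

definition graded_submodule :: "('k, 'a) graded \<Rightarrow> ('a, 'm) graded \<Rightarrow> 'm set \<Rightarrow> bool" where
  "graded_submodule A M W \<longleftrightarrow>
     additive_subgroup W M \<and>
     (\<forall>a\<in>carrier A. \<forall>w\<in>W. a \<odot>\<^bsub>M\<^esub> w \<in> W) \<and>
     W = (W \<inter> homog M 0) <+>\<^bsub>M\<^esub> (W \<inter> homog M 1)"

definition submodule_on :: "('a, 'm) graded \<Rightarrow> 'm set \<Rightarrow> ('a, 'm) graded" where
  "submodule_on M W = M\<lparr>carrier := W, homog := \<lambda>i. homog M i \<inter> W\<rparr>"

definition simple_supermodule :: "('k::field, 'a) graded \<Rightarrow> ('a, 'm) graded \<Rightarrow> bool" where
  "simple_supermodule A M \<longleftrightarrow>
     supermodule A M \<and> carrier M \<noteq> {\<zero>\<^bsub>M\<^esub>} \<and>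
     (\<forall>W. graded_submodule A M W \<longrightarrow> W = {\<zero>\<^bsub>M\<^esub>} \<or> W = carrier M)"

text \<open>
  Complete reducibility: the module is the internal direct sum of a (possibly infinite) set of
  simple graded submodules, that is, each element is in a unique way a finite sum of elements
  of these submodules.
\<close>

definition completely_reducible :: "('k::field, 'a) graded \<Rightarrow> ('a, 'm) graded \<Rightarrow> bool" where
  "completely_reducible A M \<longleftrightarrow>
     (\<exists>\<S>. (\<forall>S\<in>\<S>. graded_submodule A M S \<and> simple_supermodule A (submodule_on M S)) \<and>
          (\<forall>v\<in>carrier M. \<exists>!f. f \<in> (\<Pi>\<^sub>E S\<in>\<S>. S) \<and> finite {S\<in>\<S>. f S \<noteq> \<zero>\<^bsub>M\<^esub>} \<and>
             v = (\<Oplus>\<^bsub>M\<^esub>S\<in>{S\<in>\<S>. f S \<noteq> \<zero>\<^bsub>M\<^esub>}. f S)))"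

definition supermodule_iso ::
    "('k, 'a) graded \<Rightarrow> ('a, 'm) graded \<Rightarrow> ('a, 'n) graded \<Rightarrow> bool" where
  "supermodule_iso A M N \<longleftrightarrow>
     (\<exists>f. bij_betw f (carrier M) (carrier N) \<and>
          (\<forall>v\<in>carrier M. \<forall>w\<in>carrier M. f (v \<oplus>\<^bsub>M\<^esub> w) = f v \<oplus>\<^bsub>N\<^esub> f w) \<and>
          (\<forall>a\<in>carrier A. \<forall>v\<in>carrier M. f (a \<odot>\<^bsub>M\<^esub> v) = a \<odot>\<^bsub>N\<^esub> f v) \<and>
          (\<forall>i. f ` homog M i = homog N i))"

text \<open>
  The parity change functor on objects, without a sign in the action.  The variant in which an
  odd element \<open>a\<close> acts as \<open>- a\<close> is isomorphic to this one, via \<open>v \<mapsto> (-1)\<^bsup>i\<^esup> v\<close>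
  for \<open>v\<close> homogeneous of parity \<open>i\<close>.
\<close>

definition parity_change :: "('a, 'm) graded \<Rightarrow> ('a, 'm) graded" where
  "parity_change M = M\<lparr>homog := \<lambda>i. homog M (i + 1)\<rparr>"

text \<open>
  \<open>has_dim A M W d\<close>: the subspace \<open>W\<close> of \<open>M\<close> has a basis of \<open>d\<close> elements over the ground field,
  which acts on \<open>M\<close> through its image in \<open>A\<close>.
\<close>

definition has_dim :: "('k, 'a) graded \<Rightarrow> ('a, 'm) graded \<Rightarrow> 'm set \<Rightarrow> nat \<Rightarrow> bool" where
  "has_dim A M W d \<longleftrightarrow>
     (\<exists>b \<in> {..<d} \<rightarrow> W. \<forall>v\<in>W. \<exists>!c. c \<in> {..<d} \<rightarrow>\<^sub>E (UNIV :: 'k set) \<and>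
        v = (\<Oplus>\<^bsub>M\<^esub>i\<in>{..<d}. (c i \<odot>\<^bsub>A\<^esub> \<one>\<^bsub>A\<^esub>) \<odot>\<^bsub>M\<^esub> b i))"

definition has_superdim :: "('k, 'a) graded \<Rightarrow> ('a, 'm) graded \<Rightarrow> nat \<Rightarrow> nat \<Rightarrow> bool" where
  "has_superdim A M a b \<longleftrightarrow> has_dim A M (homog M 0) a \<and> has_dim A M (homog M 1) b"


section \<open>Clifford superalgebras by generators and relations\<close>

text \<open>
  The free algebra on a set \<open>N\<close> of generators is the monoid algebra of the free monoid of words
  in \<open>N\<close>.  Words are wrapped in a datatype since the product on \<^type>\<open>poly_mapping\<close> needs an
  additively written monoid.
\<close>

datatype 'a free_mon = Word (letters: "'a list")

instantiation free_mon :: (type) monoid_add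
begin

definition zero_free_mon :: "'a free_mon" where
  "0 = Word []"

definition plus_free_mon :: "'a free_mon \<Rightarrow> 'a free_mon \<Rightarrow> 'a free_mon" where
  "u + v = Word (letters u @ letters v)"

instance
  by standard (simp_all add: zero_free_mon_def plus_free_mon_def)

end

type_synonym 'k free_elt = "nat free_mon \<Rightarrow>\<^sub>0 'k"

definition free_algebra :: "nat set \<Rightarrow> 'k::field free_elt ring" where
  "free_algebra N =
     \<lparr>carrier = {f. \<forall>w\<in>Poly_Mapping.keys f. set (letters w) \<subseteq> N}, monoid.mult = (*), one = 1,
      ring.zero = 0, add = (+)\<rparr>"

definition free_const :: "'k::field \<Rightarrow> 'k free_elt" where
  "free_const c = Poly_Mapping.single 0 c"

definition free_gen :: "nat \<Rightarrow> 'k::field free_elt" where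
  "free_gen i = Poly_Mapping.single (Word [i]) 1"

definition cliff_rels :: "nat set \<Rightarrow> (nat \<Rightarrow> 'k::field) \<Rightarrow> 'k free_elt set" where
  "cliff_rels N d =
     {free_gen i * free_gen j + free_gen j * free_gen i - free_const (if i = j then 2 * d i else 0)
      | i j. i \<in> N \<and> j \<in> N}"

definition cliff_ideal :: "nat set \<Rightarrow> (nat \<Rightarrow> 'k::field) \<Rightarrow> 'k free_elt set" where
  "cliff_ideal N d = genideal (free_algebra N) (cliff_rels N d)"

definition free_homog :: "nat set \<Rightarrow> bit \<Rightarrow> 'k::field free_elt set" where
  "free_homog N i =
     {f \<in> carrier (free_algebra N). \<forall>w\<in>Poly_Mapping.keys f. of_nat (length (letters w)) = i}"

definition clifford :: "nat set \<Rightarrow> (nat \<Rightarrow> 'k::field) \<Rightarrow> ('k, 'k free_elt set) graded" where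
  "clifford N d =
     (let F = free_algebra N; I = cliff_ideal N d; Q = F Quot I in
      \<lparr>carrier = carrier Q, monoid.mult = monoid.mult Q, one = monoid.one Q,
       ring.zero = ring.zero Q, add = ring.add Q,
       Module.module.smult = (\<lambda>c x. (I +>\<^bsub>F\<^esub> free_const c) \<otimes>\<^bsub>Q\<^esub> x),
       homog = (\<lambda>i. (\<lambda>f. I +>\<^bsub>F\<^esub> f) ` free_homog N i)\<rparr>)"


subsection \<open>Clifford superalgebras are superalgebras\<close>

lemma free_algebra_simps [simp]:
  "monoid.mult (free_algebra N) = (*)" "monoid.one (free_algebra N) = 1"
  "ring.zero (free_algebra N) = 0" "ring.add (free_algebra N) = (+)"
  by (simp_all add: free_algebra_def)

lemma free_algebra_carrier:
  "f \<in> carrier (free_algebra N) \<longleftrightarrow> (\<forall>w\<in>Poly_Mapping.keys f. set (letters w) \<subseteq> N)"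
  by (simp add: free_algebra_def)

lemma ring_free_algebra: "ring (free_algebra N)"
proof -
  have addc: "f + g \<in> carrier (free_algebra N)"
    if "f \<in> carrier (free_algebra N)" "g \<in> carrier (free_algebra N)" for f g :: "'a free_elt"
    using that keys_add[of f g] unfolding free_algebra_carrier by blast
  have multc: "f * g \<in> carrier (free_algebra N)"
    if "f \<in> carrier (free_algebra N)" "g \<in> carrier (free_algebra N)" for f g :: "'a free_elt"
    using that keys_mult[of f g] unfolding free_algebra_carrier
    by (fastforce simp: plus_free_mon_def)
  show ?thesis
  proof (rule ringI)
    show "abelian_group (free_algebra N :: 'a free_elt ring)"
    proof (rule abelian_groupI)
      fix f assume "f \<in> carrier (free_algebra N :: 'a free_elt ring)"
      then show "\<exists>g\<in>carrier (free_algebra N). g \<oplus>\<^bsub>free_algebra N\<^esub> f = \<zero>\<^bsub>free_algebra N\<^esub>"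
        by (intro bexI[of _ "- f"]) (auto simp: free_algebra_carrier)
    next
      show "\<zero>\<^bsub>free_algebra N\<^esub> \<in> carrier (free_algebra N :: 'a free_elt ring)"
        by (simp add: free_algebra_carrier)
    qed (simp_all add: addc algebra_simps)
    have "\<one>\<^bsub>free_algebra N\<^esub> \<in> carrier (free_algebra N :: 'a free_elt ring)"
      by (simp add: free_algebra_carrier zero_free_mon_def)
    then show "Group.monoid (free_algebra N :: 'a free_elt ring)"
      by (intro monoidI) (simp_all add: multc mult.assoc)
  qed (simp_all add: algebra_simps)
qed

lift_definition free_proj :: "bit \<Rightarrow> 'k::zero free_elt \<Rightarrow> 'k free_elt" is
  "\<lambda>i f w. if of_nat (length (letters w)) = i then f w else 0"
  by (rule finite_subset[rotated]) auto

lemma free_proj_add: "free_proj i (f + g) = free_proj i f + free_proj i (g :: 'k::field free_elt)"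
  by transfer auto

lemma free_proj_uminus: "free_proj i (- f) = - free_proj i (f :: 'k::field free_elt)"
  by transfer auto

lemma free_proj_diff: "free_proj i (f - g) = free_proj i f - free_proj i (g :: 'k::field free_elt)"
  by transfer auto

lemma free_proj_zero: "free_proj i 0 = 0"
  by transfer auto

lemma free_proj_single:
  "free_proj i (Poly_Mapping.single w c) =
     (if of_nat (length (letters w)) = i then Poly_Mapping.single w c else 0)"
  by transfer (auto simp: when_def)

lemma keys_free_proj:
  "Poly_Mapping.keys (free_proj i f) = {w \<in> Poly_Mapping.keys f. of_nat (length (letters w)) = i}"
  by transfer auto

lemma free_proj_sum: "free_proj 0 f + free_proj 1 f = (f :: 'k::field free_elt)"
  by transfer (auto simp: fun_eq_iff)

lemma free_proj_homog: "f \<in> carrier (free_algebra N) \<Longrightarrow> free_proj i f \<in> free_homog N i"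
  by (auto simp: free_homog_def free_algebra_carrier keys_free_proj)

lemma free_proj_id:
  assumes "f \<in> free_homog N i"
  shows "free_proj j f = (if i = j then f else 0)"
proof (rule poly_mapping_eqI)
  fix w
  have "Poly_Mapping.lookup f w = 0 \<or> of_nat (length (letters w)) = i"
    using assms by (auto simp: free_homog_def in_keys_iff)
  moreover have "Poly_Mapping.lookup (free_proj j f) w =
      (if of_nat (length (letters w)) = j then Poly_Mapping.lookup f w else 0)"
    by (simp add: free_proj.rep_eq)
  ultimately show "Poly_Mapping.lookup (free_proj j f) w =
      Poly_Mapping.lookup (if i = j then f else 0) w"
    by (auto split: if_splits)
qed

lemma free_homog_mult:
  assumes f: "f \<in> free_homog N i" and g: "g \<in> free_homog N j"
  shows "f * g \<in> free_homog N (i + j)"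
proof -
  have "f * g \<in> carrier (free_algebra N)"
    using ring.ring_simprules(5)[OF ring_free_algebra, of f N g] f g by (simp add: free_homog_def)
  moreover have "of_nat (length (letters w)) = i + j" if w: "w \<in> Poly_Mapping.keys (f * g)" for w
  proof -
    obtain u v where "w = u + v" "u \<in> Poly_Mapping.keys f" "v \<in> Poly_Mapping.keys g"
      using w keys_mult[of f g] by blast
    with f g show ?thesis by (simp add: free_homog_def plus_free_mon_def)
  qed
  ultimately show ?thesis by (simp add: free_homog_def)
qed

lemma free_homog_subgroup: "additive_subgroup (free_homog N i) (free_algebra N)"
proof -
  interpret F: ring "free_algebra N :: 'a free_elt ring" by (rule ring_free_algebra)
  have inv: "\<ominus>\<^bsub>free_algebra N\<^esub> f = - f" if "f \<in> carrier (free_algebra N)" for f :: "'a free_elt"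
    using that by (intro F.minus_equality) (auto simp: free_algebra_carrier)
  have inv': "inv\<^bsub>add_monoid (free_algebra N)\<^esub> f = - f" if "f \<in> carrier (free_algebra N)" for f :: "'a free_elt"
    using inv[OF that] by (simp add: a_inv_def)
  show ?thesis
  proof
    show "free_homog N i \<subseteq> carrier (add_monoid (free_algebra N))" by (auto simp: free_homog_def)
    fix f g :: "'a free_elt" assume fg: "f \<in> free_homog N i" "g \<in> free_homog N i"
    then show "f \<otimes>\<^bsub>add_monoid (free_algebra N)\<^esub> g \<in> free_homog N i"
      using keys_add[of f g] by (simp add: free_homog_def free_algebra_carrier) blast
    show "inv\<^bsub>add_monoid (free_algebra N)\<^esub> f \<in> free_homog N i"
      using fg inv'[of f] by (auto simp: free_homog_def free_algebra_carrier)
  qed (auto simp: free_homog_def free_algebra_carrier)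
qed

lemma free_proj_mult:
  fixes f g :: "'k::field free_elt"
  shows "free_proj i (f * g) = free_proj i f * free_proj 0 g + free_proj (i + 1) f * free_proj 1 g"
proof -
  have hp: "free_proj j h \<in> free_homog UNIV j" for j and h :: "'k free_elt"
    by (rule free_proj_homog) (simp add: free_algebra_carrier)
  have p: "free_proj i (free_proj j f * free_proj k g) = (if j + k = i then free_proj j f * free_proj k g else 0)" for j k
    using free_proj_id[OF free_homog_mult[OF hp hp]] .
  have "free_proj i (f * g) = free_proj i ((free_proj 0 f + free_proj 1 f) * (free_proj 0 g + free_proj 1 g))"
    by (simp only: free_proj_sum)
  also have "\<dots> = free_proj i (free_proj 0 f * free_proj 0 g) + free_proj i (free_proj 1 f * free_proj 0 g)
      + (free_proj i (free_proj 0 f * free_proj 1 g) + free_proj i (free_proj 1 f * free_proj 1 g))"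
    by (simp only: distrib_left distrib_right free_proj_add)
  also have "\<dots> = free_proj i f * free_proj 0 g + free_proj (i + 1) f * free_proj 1 g"
  proof (cases "i = 0")
    case True
    then show ?thesis unfolding p by simp
  next
    case False
    then have "i = 1" by simp
    then show ?thesis unfolding p by simp
  qed
  finally show ?thesis .
qed

lemma cliff_rels_carrier: "cliff_rels N d \<subseteq> carrier (free_algebra N)"
proof -
  interpret F: ring "free_algebra N :: 'a free_elt ring" by (rule ring_free_algebra)
  have g: "free_gen i \<in> carrier (free_algebra N :: 'a free_elt ring)" if "i \<in> N" for i
    using that by (auto simp: free_gen_def free_algebra_carrier)
  have c: "- free_const c \<in> carrier (free_algebra N :: 'a free_elt ring)" for c
    by (auto simp: free_const_def free_algebra_carrier zero_free_mon_def)
  have "free_gen i * free_gen j + free_gen j * free_gen i + - free_const c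
     \<in> carrier (free_algebra N :: 'a free_elt ring)" if "i \<in> N" "j \<in> N" for i j c
    using F.a_closed[OF F.a_closed[OF F.m_closed[OF g g] F.m_closed[OF g g]] c] that by simp
  then show ?thesis by (auto simp: cliff_rels_def)
qed

lemma ideal_cliff_ideal: "ideal (cliff_ideal N d) (free_algebra N)"
  unfolding cliff_ideal_def
  by (rule ring.genideal_ideal[OF ring_free_algebra cliff_rels_carrier])

lemma free_proj_cliff_ideal:
  assumes "f \<in> cliff_ideal N d"
  shows "free_proj i f \<in> cliff_ideal N d"
proof -
  let ?F = "free_algebra N :: 'a free_elt ring"
  interpret F: ring ?F by (rule ring_free_algebra)
  interpret I: ideal "cliff_ideal N d" ?F by (rule ideal_cliff_ideal)
  define J where "J = {f \<in> carrier ?F. \<forall>i. free_proj i f \<in> cliff_ideal N d}"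
  have pc: "free_proj i f \<in> carrier ?F" if "f \<in> carrier ?F" for i f
    using free_proj_homog[OF that] by (simp add: free_homog_def)
  have inv: "\<ominus>\<^bsub>?F\<^esub> f = - f" if "f \<in> carrier ?F" for f
    using that by (intro F.minus_equality) (auto simp: free_algebra_carrier)
  have "ideal J ?F"
  proof (rule idealI)
    show "subgroup J (add_monoid ?F)"
    proof
      fix f g assume "f \<in> J" "g \<in> J"
      then show "f \<otimes>\<^bsub>add_monoid ?F\<^esub> g \<in> J"
        using F.a_closed[of f g] I.a_closed unfolding J_def by (auto simp: free_proj_add)
      have f: "f \<in> carrier ?F" "free_proj i f \<in> cliff_ideal N d" for i
        using \<open>f \<in> J\<close> by (auto simp: J_def)
      have "free_proj i (\<ominus>\<^bsub>?F\<^esub> f) = \<ominus>\<^bsub>?F\<^esub> (free_proj i f)" for i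
        using inv[OF f(1)] inv[OF pc[OF f(1)]] by (simp add: free_proj_uminus)
      then have "\<ominus>\<^bsub>?F\<^esub> f \<in> J"
        using F.a_inv_closed[OF f(1)] I.a_inv_closed[OF f(2)] by (simp add: J_def)
      then show "inv\<^bsub>add_monoid ?F\<^esub> f \<in> J" by (simp add: a_inv_def)
    qed (use I.zero_closed in \<open>auto simp: J_def free_proj_zero free_algebra_carrier\<close>)
  next
    fix a x assume "a \<in> J" "x \<in> carrier ?F"
    then show "x \<otimes>\<^bsub>?F\<^esub> a \<in> J" "a \<otimes>\<^bsub>?F\<^esub> x \<in> J"
      using F.m_closed[of a x] F.m_closed[of x a] I.I_l_closed I.I_r_closed I.a_closed pc
      unfolding J_def by (auto simp: free_proj_mult)
  qed (rule ring_free_algebra)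
  moreover have "cliff_rels N d \<subseteq> J"
  proof
    fix r assume r: "r \<in> cliff_rels N d"
    then obtain i j where "r = free_gen i * free_gen j + free_gen j * free_gen i
        - free_const (if i = j then 2 * d i else 0)" by (auto simp: cliff_rels_def)
    then have "free_proj k r = (if k = 0 then r else 0)" for k
      by (cases k) (simp_all add: free_proj_add free_proj_diff free_gen_def free_const_def
          free_proj_single Poly_Mapping.mult_single plus_free_mon_def zero_free_mon_def)
    moreover have "r \<in> cliff_ideal N d"
      using F.genideal_self[OF cliff_rels_carrier] r unfolding cliff_ideal_def by blast
    ultimately show "r \<in> J"
      using r cliff_rels_carrier[of N d] I.zero_closed unfolding J_def by auto
  qed
  ultimately have "cliff_ideal N d \<subseteq> J"
    unfolding cliff_ideal_def by (rule F.genideal_minimal)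
  with assms show ?thesis by (auto simp: J_def)
qed

lemma superalgebra_clifford: "superalgebra (clifford N d)"
proof -
  let ?F = "free_algebra N :: 'a free_elt ring" and ?I = "cliff_ideal N d"
  let ?Q = "?F Quot ?I" and ?C = "clifford N d"
  let ?\<phi> = "\<lambda>f. ?I +>\<^bsub>?F\<^esub> f"
  interpret F: ring ?F by (rule ring_free_algebra)
  interpret I: ideal ?I ?F by (rule ideal_cliff_ideal)
  interpret Q: ring ?Q by (rule I.quotient_is_ring)
  interpret phi: ring_hom_ring ?F ?Q ?\<phi> by (rule I.rcos_ring_hom_ring)
  have C [simp]: "carrier ?C = carrier ?Q" "monoid.mult ?C = monoid.mult ?Q"
      "monoid.one ?C = monoid.one ?Q" "ring.zero ?C = ring.zero ?Q" "ring.add ?C = ring.add ?Q"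
      "Module.module.smult ?C c x = ?\<phi> (free_const c) \<otimes>\<^bsub>?Q\<^esub> x"
      "homog ?C i = ?\<phi> ` free_homog N i" for c x i
    by (simp_all add: clifford_def Let_def)
  have ringC: "ring ?C"
  proof (rule ringI)
    show "abelian_group ?C"
    proof (rule abelian_groupI)
      fix x assume "x \<in> carrier ?C"
      then show "\<exists>y\<in>carrier ?C. y \<oplus>\<^bsub>?C\<^esub> x = \<zero>\<^bsub>?C\<^esub>"
        by (intro bexI[of _ "\<ominus>\<^bsub>?Q\<^esub> x"]) (auto simp: Q.l_neg)
    qed (simp_all add: Q.a_ac)
    show "Group.monoid ?C" by (rule monoidI) (auto simp: Q.m_assoc)
  qed (auto simp: Q.l_distr Q.r_distr)
  have cc: "free_const c \<in> carrier ?F" for c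
    by (auto simp: free_const_def free_algebra_carrier zero_free_mon_def)
  have ch: "free_const c \<in> free_homog N 0" for c :: 'a
    using cc[of c] by (auto simp: free_homog_def free_const_def zero_free_mon_def)
  have surj: "\<exists>f\<in>carrier ?F. x = ?\<phi> f" if "x \<in> carrier ?Q" for x
    using that by (auto simp: FactRing_def A_RCOSETS_def RCOSETS_def a_r_coset_def)
  have central: "free_const c * f = f * free_const c" for c and f :: "'a free_elt"
  proof (induction f rule: update_induct)
    case (update g a b)
    then have "Poly_Mapping.update a b g = g + Poly_Mapping.single a b"
      by (intro poly_mapping_eqI)
         (auto simp: lookup_update lookup_add lookup_single in_keys_iff when_def)
    then show ?case
      using update by (simp add: free_const_def Poly_Mapping.mult_single mult.commute algebra_simps)
  qed simp
  have hc: "f \<in> free_homog N i \<Longrightarrow> f \<in> carrier ?F" for f i by (simp add: free_homog_def)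
  have phi_add: "?\<phi> (f + g) = ?\<phi> f \<oplus>\<^bsub>?Q\<^esub> ?\<phi> g" if "f \<in> carrier ?F" "g \<in> carrier ?F" for f g
    using phi.hom_add[OF that] by simp
  have phi_mult: "?\<phi> (f * g) = ?\<phi> f \<otimes>\<^bsub>?Q\<^esub> ?\<phi> g" if "f \<in> carrier ?F" "g \<in> carrier ?F" for f g
    using phi.hom_mult[OF that] by simp
  have const: "free_const (c + d) = free_const c + (free_const d :: 'a free_elt)"
    "free_const (c * d) = free_const c * (free_const d :: 'a free_elt)"
    "free_const 1 = (1 :: 'a free_elt)" for c d
    by (simp_all add: free_const_def Poly_Mapping.single_add Poly_Mapping.mult_single)
  have subQ: "additive_subgroup (?\<phi> ` free_homog N i) ?Q" for i
    using group_hom.subgroup_img_is_subgroup[OF phi.a_group_hom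
        additive_subgroup.a_subgroup[OF free_homog_subgroup]]
    by (rule additive_subgroup.intro)
  have add_monoid_C: "subgroup H (add_monoid ?C)" if "subgroup H (add_monoid ?Q)" for H
  proof -
    interpret H: additive_subgroup H ?Q by (rule additive_subgroup.intro) (rule that)
    interpret C: ring ?C by (rule ringC)
    have "\<ominus>\<^bsub>?C\<^esub> x = \<ominus>\<^bsub>?Q\<^esub> x" if "x \<in> carrier ?Q" for x
      using that by (intro C.minus_equality) (auto simp: Q.l_neg)
    then have "inv\<^bsub>add_monoid ?C\<^esub> x \<in> H" if "x \<in> H" for x
      using that H.a_inv_closed H.a_Hcarr unfolding a_inv_def by metis
    then show ?thesis
      using H.a_subset H.a_closed H.zero_closed by (intro subgroup.intro) auto
  qed
  have sa: "S <+>\<^bsub>?C\<^esub> T = (\<Union>s\<in>S. \<Union>t\<in>T. {s \<oplus>\<^bsub>?Q\<^esub> t})" for S T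
    by (simp add: set_add_defs)
  show ?thesis
  proof (intro superalgebra.intro superalgebra_axioms.intro ringC)
    fix x :: "'a free_elt set" and c d :: 'a assume x: "x \<in> carrier ?C"
    then obtain f where f: "f \<in> carrier ?F" "x = ?\<phi> f" using surj by auto
    show "c \<odot>\<^bsub>?C\<^esub> x \<in> carrier ?C" using x cc by simp
    show "(c + d) \<odot>\<^bsub>?C\<^esub> x = c \<odot>\<^bsub>?C\<^esub> x \<oplus>\<^bsub>?C\<^esub> d \<odot>\<^bsub>?C\<^esub> x"
      using x cc by (simp add: const phi_add Q.l_distr)
    show "(c * d) \<odot>\<^bsub>?C\<^esub> x = c \<odot>\<^bsub>?C\<^esub> (d \<odot>\<^bsub>?C\<^esub> x)"
      using x cc by (simp add: const phi_mult Q.m_assoc)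
    show "1 \<odot>\<^bsub>?C\<^esub> x = x"
      using x phi.hom_one by (simp add: const)
    fix y assume y: "y \<in> carrier ?C"
    show "c \<odot>\<^bsub>?C\<^esub> (x \<oplus>\<^bsub>?C\<^esub> y) = c \<odot>\<^bsub>?C\<^esub> x \<oplus>\<^bsub>?C\<^esub> c \<odot>\<^bsub>?C\<^esub> y"
      using x y cc by (simp add: Q.r_distr)
    show "c \<odot>\<^bsub>?C\<^esub> (x \<otimes>\<^bsub>?C\<^esub> y) = c \<odot>\<^bsub>?C\<^esub> x \<otimes>\<^bsub>?C\<^esub> y"
      using x y cc by (simp add: Q.m_assoc)
    have "?\<phi> (free_const c) \<otimes>\<^bsub>?Q\<^esub> x = x \<otimes>\<^bsub>?Q\<^esub> ?\<phi> (free_const c)"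
      using f cc central by (metis phi_mult)
    then show "c \<odot>\<^bsub>?C\<^esub> (x \<otimes>\<^bsub>?C\<^esub> y) = x \<otimes>\<^bsub>?C\<^esub> (c \<odot>\<^bsub>?C\<^esub> y)"
      using x y cc by simp (metis Q.m_assoc phi.hom_closed)
  next
    fix i show "additive_subgroup (homog ?C i) ?C"
      using subQ[of i] add_monoid_C by (simp add: additive_subgroup_def)
  next
    fix x i and c :: 'a assume "x \<in> homog ?C i"
    then obtain f where f: "f \<in> free_homog N i" "x = ?\<phi> f" by auto
    have "c \<odot>\<^bsub>?C\<^esub> x = ?\<phi> (free_const c * f)"
      using phi_mult[OF cc hc[OF f(1)]] f(2) by simp
    then show "c \<odot>\<^bsub>?C\<^esub> x \<in> homog ?C i"
      using free_homog_mult[OF ch[of c] f(1)] unfolding C(7) add_0_left by (metis imageI)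
  next
    have "x \<in> homog ?C 0 <+>\<^bsub>?C\<^esub> homog ?C 1" if x: "x \<in> carrier ?C" for x
    proof -
      obtain f where f: "f \<in> carrier ?F" "x = ?\<phi> f" using surj x by auto
      then have "x = ?\<phi> (free_proj 0 f) \<oplus>\<^bsub>?Q\<^esub> ?\<phi> (free_proj 1 f)"
        using phi_add[OF hc[OF free_proj_homog[OF f(1)]] hc[OF free_proj_homog[OF f(1)]], of 0 1]
        by (simp add: free_proj_sum)
      then show ?thesis
        using imageI[OF free_proj_homog[OF f(1)], of ?\<phi>] unfolding sa C(7) UN_iff singleton_iff by metis
    qed
    moreover have "x \<in> carrier ?C" if x: "x \<in> homog ?C 0 <+>\<^bsub>?C\<^esub> homog ?C 1" for x
    proof -
      obtain s t where st: "s \<in> homog ?C 0" "t \<in> homog ?C 1" "x = s \<oplus>\<^bsub>?Q\<^esub> t"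
        using x unfolding sa by blast
      then have "s \<in> carrier ?Q" "t \<in> carrier ?Q"
        using additive_subgroup.a_Hcarr[OF subQ] unfolding C(7) by metis+
      then show ?thesis using st(3) by simp
    qed
    ultimately show "carrier ?C = homog ?C 0 <+>\<^bsub>?C\<^esub> homog ?C 1"
      by blast
  next
    have "x = ?I" if x: "x \<in> homog ?C 0" "x \<in> homog ?C 1" for x
    proof -
      obtain f g where fg: "f \<in> free_homog N 0" "g \<in> free_homog N 1" "x = ?\<phi> f" "x = ?\<phi> g"
        using x unfolding C(7) image_iff by blast
      have "f \<in> ?\<phi> g" using I.a_rcos_self[OF hc[OF fg(1)]] fg by simp
      then obtain h where h: "h \<in> ?I" "f = h + g"
        by (auto simp: a_r_coset_def r_coset_def)
      have "f = free_proj 0 h"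
        using h(2) fg free_proj_id[OF fg(1), of 0] free_proj_id[OF fg(2), of 0] by (simp add: free_proj_add)
      then have "f \<in> ?I" using free_proj_cliff_ideal[OF h(1)] by simp
      then show ?thesis using fg(3) by (simp add: I.a_rcos_const)
    qed
    moreover have "?I \<in> homog ?C i" for i
      using additive_subgroup.zero_closed[OF subQ[of i]] by (simp add: FactRing_def)
    ultimately show "homog ?C 0 \<inter> homog ?C 1 = {\<zero>\<^bsub>?C\<^esub>}"
      by (auto simp del: C(7) simp: FactRing_def)
  next
    show "\<one>\<^bsub>?C\<^esub> \<in> homog ?C 0"
      using ch[of 1] phi.hom_one by (auto simp: const image_iff intro!: bexI[of _ 1])
  next
    fix x y i j assume "x \<in> homog ?C i" "y \<in> homog ?C j"
    then obtain f g where fg: "f \<in> free_homog N i" "x = ?\<phi> f" "g \<in> free_homog N j" "y = ?\<phi> g"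
      by auto
    then show "x \<otimes>\<^bsub>?C\<^esub> y \<in> homog ?C (i + j)"
      using free_homog_mult[OF fg(1,3)] phi_mult[OF hc[OF fg(1)] hc[OF fg(3)]]
      by (metis C(2) C(7) imageI)
  qed
qed


section \<open>The quantum case\<close>

type_synonym qfield = "complex poly fract"

definition q_indet :: qfield where
  "q_indet = Fract [:0, 1:] 1"

definition Lam :: "int \<Rightarrow> qfield" where
  "Lam m =
     (q_indet powi (2 * m) - q_indet powi (- 2 * m)) / (q_indet\<^sup>2 - q_indet powi (-2))"

text \<open>
  A weight is given by its coefficients, a function on indices of which only the
  values at \<open>1, \<dots>, n\<close> are used.
\<close>

definition nonzero_indices :: "nat \<Rightarrow> (nat \<Rightarrow> int) \<Rightarrow> nat set" where
  "nonzero_indices n l = {i \<in> {1..n}. l i \<noteq> 0}"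

definition Delta :: "nat \<Rightarrow> (nat \<Rightarrow> int) \<Rightarrow> qfield" where
  "Delta n l = (\<Prod>i\<in>nonzero_indices n l. Lam (l i))"

definition square_class :: "'k::field \<Rightarrow> 'k set" where
  "square_class x = {x * c\<^sup>2 | c. c \<noteq> 0}"

type_synonym qcliff_elt = "qfield free_elt set"

definition Cliff_q :: "nat set \<Rightarrow> (nat \<Rightarrow> int) \<Rightarrow> (qfield, qcliff_elt) graded" where
  "Cliff_q N l = clifford N (\<lambda>i. Lam (l i))"

end

theory Submission
  imports Defs
    "HOL-Library.Nat_Bijection"
    "HOL-Computational_Algebra.Fundamental_Theorem_Algebra"
begin

text \<open>
  By Legendre's descent each binary form over \<open>\<complex>(q)\<close> represents \<open>1\<close>, so a rotation
  of two generators with squares \<open>a\<close>, \<open>b\<close> replaces them by generators with squares \<open>1\<close>, \<open>a b\<close>.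
  Iterating, one may assume that all squares but the last are \<open>1\<close>; the last is the discriminant,
  and it can be scaled to \<open>1\<close> if it is a square. If \<open>t\<^sub>a\<^sup>2 = t\<^sub>b\<^sup>2 = 1\<close> then
  \<open>S = \<i> t\<^sub>a t\<^sub>b\<close> is an even involution which anticommutes with \<open>t\<^sub>a\<close> and
  commutes with the other generators, and \<open>V \<mapsto> ker (S - 1)\<close> is an equivalence
  with the graded modules over the algebra without \<open>t\<^sub>a\<close> and \<open>t\<^sub>b\<close>, which halves the
  dimension. What remains are no generators, a single generator, or two generators whose
  product generates a quadratic field extension in even degree.
  Generators of square zero act by zero on a simple module.

  To do linear algebra, a module is embedded in a space of finitely supported functions, where its
  even and odd parts become a family of subspaces indexed by the parity.
\<close>

section \<open>Graded families of subspaces\<close>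

text \<open>Over a field that is not algebraically closed the rank of a quadratic form does not
  determine its Clifford modules. A change of generators keeps the space and its grading and only
  replaces operators, while a splitting shrinks the space. Both moves preserve
  \<open>split_form\<close>, so a claim is checked on the three terminal forms and carried back
  along the moves. Parity distinguishes a simple module from its shift exactly when no generator is
  left over, for an invertible odd generator moves vectors between the parities. Existence is a
  separate matter: an algebra given by generators and relations might collapse, so a nonzero module
  has to be exhibited, and a simple submodule of it found. The need for an embedding comes from the
  foundations: bases and spans live on whole types, whereas a module of the statement is a record
  with a carrier set.\<close>

declare add_bit_eq_xor [simp del]

lemma bit_add_one_one [simp]: "(p::bit) + 1 + 1 = p"
  by (simp add: add.assoc)

definition psc :: "'k::field \<Rightarrow> ('m \<Rightarrow>\<^sub>0 'k) \<Rightarrow> ('m \<Rightarrow>\<^sub>0 'k)" where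
  "psc c f = Poly_Mapping.map ((*) c) f"

lemma lookup_psc [simp]: "Poly_Mapping.lookup (psc c f) x = c * Poly_Mapping.lookup f x"
  by (simp add: psc_def Poly_Mapping.map.rep_eq when_def)

interpretation pm: vector_space psc
  by unfold_locales (auto intro!: poly_mapping_eqI simp: lookup_add algebra_simps)

definition graded_stable ::
    "nat set \<Rightarrow> (nat \<Rightarrow> ('m \<Rightarrow>\<^sub>0 'k) \<Rightarrow> ('m \<Rightarrow>\<^sub>0 'k)) \<Rightarrow> (bit \<Rightarrow> ('m \<Rightarrow>\<^sub>0 'k::field) set) \<Rightarrow> bool" where
  "graded_stable N T U \<longleftrightarrow>
     (\<forall>p. pm.subspace (U p)) \<and> (\<forall>i\<in>N. \<forall>p. \<forall>x\<in>U p. T i x \<in> U (p + 1))"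

definition graded_simple ::
    "nat set \<Rightarrow> (nat \<Rightarrow> ('m \<Rightarrow>\<^sub>0 'k) \<Rightarrow> ('m \<Rightarrow>\<^sub>0 'k)) \<Rightarrow> (bit \<Rightarrow> ('m \<Rightarrow>\<^sub>0 'k::field) set) \<Rightarrow> bool" where
  "graded_simple N T V \<longleftrightarrow>
     graded_stable N T V \<and> (\<exists>p. V p \<noteq> {0}) \<and>
     (\<forall>U. graded_stable N T U \<and> U \<le> V \<longrightarrow> (\<forall>p. U p = {0}) \<or> U = V)"

text \<open>There is one map per parity, linear on its own component. The two maps are glued
  together only when an isomorphism of modules is built from them.\<close>

definition graded_iso ::
    "nat set \<Rightarrow> (nat \<Rightarrow> ('m \<Rightarrow>\<^sub>0 'k) \<Rightarrow> ('m \<Rightarrow>\<^sub>0 'k)) \<Rightarrow> (bit \<Rightarrow> ('m \<Rightarrow>\<^sub>0 'k::field) set) \<Rightarrow>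
     (nat \<Rightarrow> ('n \<Rightarrow>\<^sub>0 'k) \<Rightarrow> ('n \<Rightarrow>\<^sub>0 'k)) \<Rightarrow> (bit \<Rightarrow> ('n \<Rightarrow>\<^sub>0 'k) set) \<Rightarrow> bool" where
  "graded_iso N T V T' V' \<longleftrightarrow>
     (\<exists>\<phi>. \<forall>p. bij_betw (\<phi> p) (V p) (V' p) \<and>
        (\<forall>x\<in>V p. \<forall>y\<in>V p. \<phi> p (x + y) = \<phi> p x + \<phi> p y) \<and>
        (\<forall>c. \<forall>x\<in>V p. \<phi> p (psc c x) = psc c (\<phi> p x)) \<and>
        (\<forall>i\<in>N. \<forall>x\<in>V p. \<phi> (p + 1) (T i x) = T' i (\<phi> p x)))"

definition shift :: "(bit \<Rightarrow> 'v set) \<Rightarrow> bit \<Rightarrow> 'v set" where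
  "shift V p = V (p + 1)"

text \<open>Generation by simple submodules passes easily through a change of generators and through
  the splitting. A direct sum is extracted from it once, by Zorn's lemma.\<close>

definition spanned_by_simples ::
    "nat set \<Rightarrow> (nat \<Rightarrow> ('m \<Rightarrow>\<^sub>0 'k) \<Rightarrow> ('m \<Rightarrow>\<^sub>0 'k)) \<Rightarrow> (bit \<Rightarrow> ('m \<Rightarrow>\<^sub>0 'k::field) set) \<Rightarrow> bool" where
  "spanned_by_simples N T V \<longleftrightarrow> (\<forall>p. V p \<subseteq> pm.span (\<Union>{U p | U. graded_simple N T U \<and> U \<le> V}))"

definition dim_is :: "('m \<Rightarrow>\<^sub>0 'k::field) set \<Rightarrow> nat \<Rightarrow> bool" where
  "dim_is W n \<longleftrightarrow> (\<exists>B. finite B \<and> pm.independent B \<and> pm.span B = W \<and> card B = n)"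

text \<open>Linearity is asked on the whole ambient space and for every index, so that
  \<open>module_hom\<close> applies to images and spans; the Clifford relations are asked on
  \<open>V\<close> only, so that stable subfamilies inherit them. Invertibility of 2 turns the
  relation for \<open>i = j\<close> into \<open>T i (T i x) = psc (d i) x\<close>.\<close>

locale clmod =
  fixes N :: "nat set" and d :: "nat \<Rightarrow> 'k::field"
    and T :: "nat \<Rightarrow> ('m \<Rightarrow>\<^sub>0 'k) \<Rightarrow> ('m \<Rightarrow>\<^sub>0 'k)" and V :: "bit \<Rightarrow> ('m \<Rightarrow>\<^sub>0 'k) set"
  assumes sub: "pm.subspace (V p)"
    and T_add [simp]: "T i (x + y) = T i x + T i y"
    and T_psc [simp]: "T i (psc c x) = psc c (T i x)"
    and T_odd: "\<lbrakk>i \<in> N; x \<in> V p\<rbrakk> \<Longrightarrow> T i x \<in> V (p + 1)"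
    and rel: "\<lbrakk>i \<in> N; j \<in> N; x \<in> V p\<rbrakk> \<Longrightarrow>
        T i (T j x) + T j (T i x) = psc (if i = j then 2 * d i else 0) x"
    and two: "(2 :: 'k) \<noteq> 0"
begin

lemma T_0 [simp]: "T i 0 = 0"
  using T_psc[of i 0 0] by simp

lemma T_minus [simp]: "T i (- x) = - T i x"
  using T_psc[of i "-1" x] by simp

lemma T_diff [simp]: "T i (x - y) = T i x - T i y"
  using T_add[of i x "- y"] by simp

lemma T_hom: "module_hom psc psc (T i)"
  by unfold_locales simp_all

lemma psc_two_cancel:
  fixes x y :: "'m \<Rightarrow>\<^sub>0 'k"
  assumes "x + x = psc (2 * c) y"
  shows "x = psc c y"
proof -
  have "psc 2 x = psc 2 (psc c y)"
    using assms by (metis pm.scale_left_distrib pm.scale_one pm.scale_scale one_add_one)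
  then have "psc (1 / 2) (psc 2 x) = psc (1 / 2) (psc 2 (psc c y))"
    by simp
  then show ?thesis
    using two by simp
qed

lemma T_T: "\<lbrakk>i \<in> N; x \<in> V p\<rbrakk> \<Longrightarrow> T i (T i x) = psc (d i) x"
  using rel[of i i x p] by (auto intro: psc_two_cancel)

lemma T_anti: "\<lbrakk>i \<in> N; j \<in> N; i \<noteq> j; x \<in> V p\<rbrakk> \<Longrightarrow> T i (T j x) = - T j (T i x)"
  using rel[of i j x p] by (simp add: add_eq_0_iff2)

lemma stable: "graded_stable N T V"
  using sub T_odd by (auto simp: graded_stable_def)

lemma V_closed:
  "0 \<in> V p" "x \<in> V p \<Longrightarrow> y \<in> V p \<Longrightarrow> x + y \<in> V p" "x \<in> V p \<Longrightarrow> y \<in> V p \<Longrightarrow> x - y \<in> V p"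
  "x \<in> V p \<Longrightarrow> psc c x \<in> V p" "x \<in> V p \<Longrightarrow> - x \<in> V p"
  using sub[of p] by (auto simp: pm.subspace_0 pm.subspace_add pm.subspace_diff pm.subspace_scale pm.subspace_neg)

lemma clmod_stable:
  assumes "graded_stable N T U" "U \<le> V"
  shows "clmod N d T U"
proof unfold_locales
  fix i j x p assume "i \<in> N" "j \<in> N" "x \<in> U p"
  then show "T i (T j x) + T j (T i x) = psc (if i = j then 2 * d i else 0) x"
    by (intro rel subsetD[OF le_funD[OF assms(2)]])
qed (use assms two in \<open>auto simp: graded_stable_def\<close>)

lemma clmod_subset: "N' \<subseteq> N \<Longrightarrow> clmod N' d T V"
  using sub T_odd rel two by unfold_locales (auto simp: subset_iff)

lemma clmod_shift: "clmod N d T (shift V)"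
  using sub T_odd[of _ _ "_ + 1"] rel two by unfold_locales (auto simp: shift_def)

end

lemma graded_stable_shift: "graded_stable N T U \<Longrightarrow> graded_stable N T (shift U)"
  unfolding graded_stable_def shift_def by blast

lemma shift_shift [simp]: "shift (shift U) = U"
  by (simp add: shift_def fun_eq_iff)

lemma shift_mono: "U \<le> Y \<Longrightarrow> shift U \<le> shift Y"
  by (auto simp: le_fun_def shift_def)

text \<open>\<open>shift\<close> is an involution on families that respects stability and inclusion,
  so it permutes the simple ones.\<close>

lemma graded_simple_shift:
  assumes "graded_simple N T V"
  shows "graded_simple N T (shift V)"
  unfolding graded_simple_def
proof (intro conjI allI impI)
  show "graded_stable N T (shift V)"
    using assms graded_stable_shift by (auto simp: graded_simple_def)
  obtain p where "V p \<noteq> {0}"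
    using assms by (auto simp: graded_simple_def)
  then show "\<exists>p. shift V p \<noteq> {0}"
    by (intro exI[of _ "p + 1"]) (simp add: shift_def)
  fix U assume U: "graded_stable N T U \<and> U \<le> shift V"
  then have "graded_stable N T (shift U)" "shift U \<le> V"
    using graded_stable_shift shift_mono[of U "shift V"] by auto
  then have "(\<forall>p. shift U p = {0}) \<or> shift U = V"
    using assms by (auto simp: graded_simple_def)
  then show "(\<forall>p. U p = {0}) \<or> U = shift V"
    by (metis shift_def shift_shift)
qed

section \<open>Change of generators\<close>

text \<open>The rows \<open>(x, y)\<close> and \<open>(z, w)\<close> are the coordinates of the new
  generators in terms of the old ones at \<open>a\<close> and \<open>b\<close>.\<close>

definition subst_ops where
  "subst_ops a b x y z w T =
     T(a := \<lambda>v. psc x (T a v) + psc y (T b v), b := \<lambda>v. psc z (T a v) + psc w (T b v))"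

lemma subst_ops_inverse:
  assumes "a \<noteq> b" and D: "x * w - y * z \<noteq> 0"
  defines "D \<equiv> x * w - y * z"
  shows "subst_ops a b (w / D) (- y / D) (- z / D) (x / D) (subst_ops a b x y z w T) = T"
proof -
  have 1: "psc \<alpha> (psc x u + psc y v) + psc \<beta> (psc z u + psc w v) =
      psc (\<alpha> * x + \<beta> * z) u + psc (\<alpha> * y + \<beta> * w) v" for \<alpha> \<beta> u v
    by (simp add: pm.scale_right_distrib pm.scale_left_distrib)
  have 2: "w / D * x + - y / D * z = 1" "w / D * y + - y / D * w = 0"
      "- z / D * x + x / D * z = 0" "- z / D * y + x / D * w = 1"
  proof -
    have D': "D \<noteq> 0" "D = x * w - y * z"
      using D by (simp_all add: D_def)
    have "w / D * x + - y / D * z = (x * w - y * z) / D" "w / D * y + - y / D * w = 0"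
      "- z / D * x + x / D * z = 0" "- z / D * y + x / D * w = (x * w - y * z) / D"
      by (simp_all add: diff_divide_distrib mult.commute)
    then show "w / D * x + - y / D * z = 1" "w / D * y + - y / D * w = 0"
      "- z / D * x + x / D * z = 0" "- z / D * y + x / D * w = 1"
      using D' by simp_all
  qed
  show ?thesis
    using \<open>a \<noteq> b\<close> unfolding subst_ops_def fun_eq_iff by (simp only: fun_upd_apply 1 2 if_True if_False refl) simp
qed

lemma graded_stable_subst_imp:
  assumes U: "graded_stable N T U" and "a \<in> N" "b \<in> N"
  shows "graded_stable N (subst_ops a b x y z w T) U"
  using assms unfolding graded_stable_def subst_ops_def
  by (auto intro!: pm.subspace_add pm.subspace_scale)

text \<open>Stability depends only on the span of the two operators, and an invertible change has an
  inverse of the same kind.\<close>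

lemma graded_stable_subst:
  assumes "a \<in> N" "b \<in> N" "a \<noteq> b" "x * w - y * z \<noteq> 0"
  shows "graded_stable N (subst_ops a b x y z w T) = graded_stable N T"
proof (intro ext iffI)
  fix U assume "graded_stable N (subst_ops a b x y z w T) U"
  then show "graded_stable N T U"
    using graded_stable_subst_imp[OF _ assms(1,2)] subst_ops_inverse[OF assms(3,4), of T] by metis
qed (rule graded_stable_subst_imp[OF _ assms(1,2)])

lemma graded_simple_subst:
  assumes "a \<in> N" "b \<in> N" "a \<noteq> b" "x * w - y * z \<noteq> 0"
  shows "graded_simple N (subst_ops a b x y z w T) = graded_simple N T"
  unfolding graded_simple_def[abs_def] graded_stable_subst[OF assms] ..

lemma graded_iso_subst_imp:
  assumes iso: "graded_iso N T V T2 V2" and V: "graded_stable N T V" and "a \<in> N" "b \<in> N"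
  shows "graded_iso N (subst_ops a b x y z w T) V (subst_ops a b x y z w T2) V2"
proof -
  obtain \<phi> where \<phi>: "bij_betw (\<phi> p) (V p) (V2 p)"
    "\<And>x y. x \<in> V p \<Longrightarrow> y \<in> V p \<Longrightarrow> \<phi> p (x + y) = \<phi> p x + \<phi> p y"
    "\<And>c x. x \<in> V p \<Longrightarrow> \<phi> p (psc c x) = psc c (\<phi> p x)"
    "\<And>i x. i \<in> N \<Longrightarrow> x \<in> V p \<Longrightarrow> \<phi> (p + 1) (T i x) = T2 i (\<phi> p x)" for p
    using iso unfolding graded_iso_def by blast
  have cl: "pm.subspace (V p)" "i \<in> N \<Longrightarrow> x \<in> V p \<Longrightarrow> T i x \<in> V (p + 1)" for x p i
    using V by (auto simp: graded_stable_def)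
  have "\<phi> (p + 1) (subst_ops a b x y z w T i v) = subst_ops a b x y z w T2 i (\<phi> p v)"
    if "i \<in> N" "v \<in> V p" for i p v
    using that assms(3,4) by (simp add: subst_ops_def \<phi> cl pm.subspace_scale)
  then show ?thesis
    using \<phi>(1-3) unfolding graded_iso_def by blast
qed

lemma graded_iso_subst:
  assumes V: "graded_stable N T V" and ab: "a \<in> N" "b \<in> N" "a \<noteq> b" "x * w - y * z \<noteq> 0"
  shows "graded_iso N (subst_ops a b x y z w T) V (subst_ops a b x y z w T2) V2 \<longleftrightarrow> graded_iso N T V T2 V2"
proof
  assume "graded_iso N (subst_ops a b x y z w T) V (subst_ops a b x y z w T2) V2"
  from graded_iso_subst_imp[OF this _ ab(1,2)] show "graded_iso N T V T2 V2"
    using subst_ops_inverse[OF ab(3,4)] graded_stable_subst_imp[OF V ab(1,2)] by metis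
qed (rule graded_iso_subst_imp[OF _ V ab(1,2)])

text \<open>These are the squares of the new generators, since the cross terms cancel by
  anticommutation of the old ones. That the new generators anticommute with each other is the
  orthogonality condition \<open>ortho\<close> below.\<close>

definition subst_coeffs where
  "subst_coeffs a b x y z w d = d(a := x\<^sup>2 * d a + y\<^sup>2 * d b, b := z\<^sup>2 * d a + w\<^sup>2 * (d b :: 'k::field))"

lemma (in clmod) clmod_subst:
  assumes ab: "a \<in> N" "b \<in> N" "a \<noteq> b" and ortho: "x * z * d a + y * w * d b = 0"
  shows "clmod N (subst_coeffs a b x y z w d) (subst_ops a b x y z w T) V"
proof
  fix p show "pm.subspace (V p)" by (rule sub)
next
  fix i u v
  show "subst_ops a b x y z w T i (u + v) = subst_ops a b x y z w T i u + subst_ops a b x y z w T i v"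
    by (simp add: subst_ops_def pm.scale_right_distrib)
next
  fix i c v
  show "subst_ops a b x y z w T i (psc c v) = psc c (subst_ops a b x y z w T i v)"
    by (simp add: subst_ops_def pm.scale_right_distrib mult.commute)
next
  fix i v p assume "i \<in> N" "v \<in> V p"
  then show "subst_ops a b x y z w T i v \<in> V (p + 1)"
    using graded_stable_subst_imp[OF stable ab(1,2), of x y z w] by (simp add: graded_stable_def)
next
  fix i j v p assume ij: "i \<in> N" "j \<in> N" and v: "v \<in> V p"
  have bil: "(psc s (T k (psc s' (T k' v) + psc t' (T l' v))) + psc t (T l (psc s' (T k' v) + psc t' (T l' v)))) +
      (psc s' (T k' (psc s (T k v) + psc t (T l v))) + psc t' (T l' (psc s (T k v) + psc t (T l v)))) =
      psc (s * s' * (if k = k' then 2 * d k else 0) + s * t' * (if k = l' then 2 * d k else 0)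
       + t * s' * (if l = k' then 2 * d l else 0) + t * t' * (if l = l' then 2 * d l else 0)) v"
    (is "?L = ?R") if "k \<in> N" "l \<in> N" "k' \<in> N" "l' \<in> N" for s t s' t' k l k' l'
  proof -
    have "?L = psc (s * s') (T k (T k' v) + T k' (T k v)) + psc (s * t') (T k (T l' v) + T l' (T k v))
      + psc (t * s') (T l (T k' v) + T k' (T l v)) + psc (t * t') (T l (T l' v) + T l' (T l v))"
      by (simp add: pm.scale_right_distrib mult.commute add_ac)
    also have "\<dots> = ?R"
      unfolding rel[OF that(1,3) v] rel[OF that(1,4) v] rel[OF that(2,3) v] rel[OF that(2,4) v]
      by (simp only: pm.scale_scale pm.scale_left_distrib)
    finally show ?thesis .
  qed
  \<comment> \<open>Unchanged generators are written in the form \<open>(1, 0, i, i)\<close>, so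
    that the single bilinear identity \<open>bil\<close> covers all pairs, equal or not.\<close>
  define r where "r i = (if i = a then (x, y, a, b) else if i = b then (z, w, a, b) else (1, 0, i, i))" for i
  have r: "subst_ops a b x y z w T i u = (case r i of (s, t, k, l) \<Rightarrow> psc s (T k u) + psc t (T l u))" for i u
    using ab(3) by (simp add: subst_ops_def r_def)
  obtain s t k l where ri: "r i = (s, t, k, l)"
    by (cases "r i")
  obtain s' t' k' l' where rj: "r j = (s', t', k', l')"
    by (cases "r j")
  have kl: "k \<in> N" "l \<in> N" "k' \<in> N" "l' \<in> N"
    using ri rj ij ab by (auto simp: r_def split: if_splits)
  have ortho': "d a * (x * z) + d b * (y * w) = 0"
    using ortho by (simp add: mult_ac)
  have ortho2: "d a * (x * (z * 2)) + d b * (y * (w * 2)) = 0"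
    using arg_cong[OF ortho', of "\<lambda>c. c * 2"] by (simp add: distrib_right mult_ac)
  have "s * s' * (if k = k' then 2 * d k else 0) + s * t' * (if k = l' then 2 * d k else 0)
       + t * s' * (if l = k' then 2 * d l else 0) + t * t' * (if l = l' then 2 * d l else 0) =
      (if i = j then 2 * subst_coeffs a b x y z w d i else 0)"
    using ri rj ab ortho2
    by (auto simp: r_def subst_coeffs_def power2_eq_square algebra_simps split: if_splits)
  then show "subst_ops a b x y z w T i (subst_ops a b x y z w T j v) + subst_ops a b x y z w T j (subst_ops a b x y z w T i v) =
      psc (if i = j then 2 * subst_coeffs a b x y z w d i else 0) v"
    using bil[OF kl, of s s' t' t] unfolding r ri rj prod.case by (simp only:)
qed (rule two)

section \<open>Splitting off a hyperbolic plane\<close>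

definition inv_op where "inv_op e a b T v = psc e (T a (T b v))"

definition proj_op where "proj_op e a b T v = psc (1 / 2) (v + inv_op e a b T v)"

definition plus_part :: "'k::field \<Rightarrow> nat \<Rightarrow> nat \<Rightarrow> (nat \<Rightarrow> ('m \<Rightarrow>\<^sub>0 'k) \<Rightarrow> ('m \<Rightarrow>\<^sub>0 'k)) \<Rightarrow>
    (bit \<Rightarrow> ('m \<Rightarrow>\<^sub>0 'k) set) \<Rightarrow> bit \<Rightarrow> ('m \<Rightarrow>\<^sub>0 'k) set" where
  "plus_part e a b T U p = {x \<in> U p. inv_op e a b T x = x}"

locale clmod_strip = clmod N d T V
  for N and d :: "nat \<Rightarrow> 'k::field" and T :: "nat \<Rightarrow> ('m \<Rightarrow>\<^sub>0 'k) \<Rightarrow> ('m \<Rightarrow>\<^sub>0 'k)" and V +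
  fixes a b :: nat and e :: 'k
  assumes ab: "a \<in> N" "b \<in> N" "a \<noteq> b" and dab: "d a = 1" "d b = 1" and e: "e * e = - 1"
begin

abbreviation S where "S \<equiv> inv_op e a b T"
abbreviation P where "P \<equiv> proj_op e a b T"
abbreviation plus where "plus \<equiv> plus_part e a b T"

lemma S_linear [simp]:
  "S (x + y) = S x + S y" "S (psc c x) = psc c (S x)" "S (x - y) = S x - S y" "S (- x) = - S x" "S 0 = 0"
  by (simp_all add: inv_op_def pm.scale_right_distrib pm.scale_right_diff_distrib mult.commute)

lemma P_linear [simp]:
  "P (x + y) = P x + P y" "P (psc c x) = psc c (P x)" "P (x - y) = P x - P y" "P (- x) = - P x" "P 0 = 0"
  by (simp_all add: proj_op_def algebra_simps)

lemma Ta_V: "x \<in> V p \<Longrightarrow> T a x \<in> V (p + 1)" and Tb_V: "x \<in> V p \<Longrightarrow> T b x \<in> V (p + 1)"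
  and Ta_V': "x \<in> V (p + 1) \<Longrightarrow> T a x \<in> V p"
  using T_odd[of _ _ p] T_odd[of _ _ "p + 1"] ab by auto

lemma S_V: "x \<in> V p \<Longrightarrow> S x \<in> V p"
  using Ta_V'[OF Tb_V] V_closed by (auto simp: inv_op_def)

lemma P_V: "x \<in> V p \<Longrightarrow> P x \<in> V p"
  using S_V V_closed by (auto simp: proj_op_def)

lemma Ta_Ta [simp]: "x \<in> V p \<Longrightarrow> T a (T a x) = x" and Tb_Tb: "x \<in> V p \<Longrightarrow> T b (T b x) = x"
  using T_T ab dab by auto

lemma Tb_Ta: "x \<in> V p \<Longrightarrow> T b (T a x) = - T a (T b x)"
  using T_anti ab by blast

lemma S_S: "x \<in> V p \<Longrightarrow> S (S x) = x"
  by (simp add: inv_op_def Tb_Ta[OF Tb_V] Tb_Tb e)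

lemma S_Ta: "x \<in> V p \<Longrightarrow> S (T a x) = - T a (S x)"
  by (simp add: inv_op_def Tb_Ta)

text \<open>Since \<open>T a\<close> after \<open>S\<close> is \<open>e\<close> times
  \<open>T b\<close> and \<open>e * e = - 1\<close>, the generator \<open>b\<close> can be recovered
  from \<open>S\<close> and \<open>T a\<close>. Stability and equivariance for \<open>b\<close> are
  deduced from those for \<open>S\<close> and \<open>T a\<close>.\<close>

lemma Tb_eq: "x \<in> V p \<Longrightarrow> T b x = - psc e (T a (S x))"
  using Ta_Ta[OF Tb_V] e by (simp add: inv_op_def)

lemma S_T: "j \<in> N - {a, b} \<Longrightarrow> x \<in> V p \<Longrightarrow> S (T j x) = T j (S x)"
  using T_anti[of b j x p] T_anti[of a j "T b x" "p + 1"] Tb_V[of x p] ab by (auto simp: inv_op_def)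

lemma half_double [simp]: "psc (1 / 2) (x + x) = (x :: 'm \<Rightarrow>\<^sub>0 'k)"
proof -
  have "psc (1 / 2) (x + x) = psc (1 / 2 + 1 / 2) x"
    by (simp only: pm.scale_right_distrib pm.scale_left_distrib)
  then show ?thesis
    using two by simp
qed

lemma S_P: "x \<in> V p \<Longrightarrow> S (P x) = P x"
  by (simp add: proj_op_def S_S add.commute)

lemma P_fix: "S x = x \<Longrightarrow> P x = x"
  by (simp add: proj_op_def)

text \<open>\<open>T a\<close> exchanges the two eigenspaces of \<open>S\<close>, because it
  anticommutes with \<open>S\<close>.\<close>

lemma P_Ta: "x \<in> V p \<Longrightarrow> P (T a x) = T a (x - P x)"
proof -
  assume x: "x \<in> V p"
  have "T a x = psc (1 / 2) (T a x + T a x)"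
    by simp
  then have "T a (x - P x) = psc (1 / 2) (T a x + T a x) - T a (P x)"
    unfolding T_diff by simp
  then show ?thesis
    using S_Ta[OF x] by (simp add: proj_op_def pm.scale_right_distrib pm.scale_right_diff_distrib)
qed

lemma P_Ta_plus: "x \<in> V p \<Longrightarrow> S x = x \<Longrightarrow> P (T a x) = 0"
  by (simp add: P_Ta P_fix)

lemma P_Ta_V: "x \<in> V p \<Longrightarrow> P (T a x) \<in> V (p + 1)"
  by (intro P_V Ta_V)

text \<open>The component of \<open>x\<close> in the eigenspace -1 is moved by \<open>T a\<close>
  into the eigenspace +1 and back again. Thus \<open>P x\<close> and \<open>P (T a x)\<close>, both
  in the eigenspace +1, are coordinates of \<open>x\<close>.\<close>

lemma decomp: "x \<in> V p \<Longrightarrow> x = P x + T a (P (T a x))"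
  using P_Ta[of x p] Ta_Ta[of "x - P x" p] V_closed(3)[OF _ P_V] by simp

lemma P_T: "j \<in> N - {a, b} \<Longrightarrow> x \<in> V p \<Longrightarrow> P (T j x) = T j (P x)"
  by (simp add: proj_op_def S_T)

text \<open>The sign is the price of moving \<open>T j\<close> past \<open>T a\<close>: on the
  second coordinate the remaining generators act by \<open>- T j\<close>.\<close>

lemma P_Ta_T: "j \<in> N - {a, b} \<Longrightarrow> x \<in> V p \<Longrightarrow> P (T a (T j x)) = - T j (P (T a x))"
  using T_anti[of a j x p] P_T[OF _ Ta_V[of x p]] ab by auto

lemma P_S: "x \<in> V p \<Longrightarrow> P (S x) = P x"
  by (simp add: proj_op_def S_S add.commute)

lemma P_Ta_S: "x \<in> V p \<Longrightarrow> P (T a (S x)) = - P (T a x)"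
  using P_S[OF Ta_V, of x p] S_Ta[of x p] by (metis P_linear(4) minus_minus)

section \<open>Correspondence of the graded submodules of \<open>V\<close> and of the eigenspace
  +1\<close>

lemma stable_S: "graded_stable N T U \<Longrightarrow> x \<in> U p \<Longrightarrow> S x \<in> U p"
  using ab unfolding graded_stable_def inv_op_def
  by (metis bit_add_one_one pm.subspace_scale)

lemma stable_P: "graded_stable N T U \<Longrightarrow> x \<in> U p \<Longrightarrow> P x \<in> U p"
  using stable_S[of U x p] unfolding proj_op_def
  by (auto simp: graded_stable_def intro!: pm.subspace_scale pm.subspace_add)

lemma subspaceD:
  assumes "graded_stable N' T U"
  shows "0 \<in> U p" "x \<in> U p \<Longrightarrow> y \<in> U p \<Longrightarrow> x + y \<in> U p" "x \<in> U p \<Longrightarrow> psc c x \<in> U p"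
    "x \<in> U p \<Longrightarrow> - x \<in> U p" "j \<in> N' \<Longrightarrow> x \<in> U p \<Longrightarrow> T j x \<in> U (p + 1)"
    "j \<in> N' \<Longrightarrow> x \<in> U (p + 1) \<Longrightarrow> T j x \<in> U p"
  using assms unfolding graded_stable_def
  by (auto simp: pm.subspace_0 pm.subspace_add pm.subspace_scale pm.subspace_neg) (metis bit_add_one_one)

lemma stable_plus:
  assumes "graded_stable N T U" "U \<le> V"
  shows "graded_stable (N - {a, b}) T (plus U)"
proof -
  have "T j x \<in> plus U (p + 1)" if "x \<in> plus U p" "j \<in> N - {a, b}" for x p j
    using that S_T[of j x p] subspaceD(5)[OF assms(1), of j x p] le_funD[OF assms(2), of p]
    by (auto simp: plus_part_def)
  then show ?thesis
    using subspaceD(1-3)[OF assms(1)] by (auto simp: graded_stable_def plus_part_def intro!: pm.subspaceI)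
qed

lemma plus_mono: "U \<le> U' \<Longrightarrow> plus U \<le> plus U'"
  by (auto simp: le_fun_def plus_part_def)

lemma clmod_plus: "clmod (N - {a, b}) d T (plus V)"
  using clmod.clmod_stable[OF clmod_subset stable_plus[OF stable order.refl]]
  by (auto simp: plus_part_def le_fun_def)

text \<open>This is \<open>U\<close> plus its image under \<open>T a\<close>, the inverse
  construction to \<open>plus\<close>. Describing it by the two coordinates of \<open>x\<close>
  avoids unpacking sums.\<close>

definition ind where
  "ind U p = {x \<in> V p. P x \<in> U p \<and> P (T a x) \<in> U (p + 1)}"

lemma ind_le: "ind U \<le> V"
  by (auto simp: ind_def le_fun_def)

lemma stable_ind:
  assumes U: "graded_stable (N - {a, b}) T U" and le: "U \<le> plus V"
  shows "graded_stable N T (ind U)"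
proof -
  note cl = subspaceD[OF U]
  have a: "T a x \<in> ind U (p + 1)" if "x \<in> ind U p" for x p
    using that by (auto simp: ind_def Ta_V)
  have S: "S x \<in> ind U p" if "x \<in> ind U p" for x p
    using that cl(4) by (auto simp: ind_def S_V P_S P_Ta_S)
  have sc: "pm.subspace (ind U p)" for p
    using cl(1-3) V_closed by (auto simp: ind_def intro!: pm.subspaceI)
  have b: "T b x \<in> ind U (p + 1)" if "x \<in> ind U p" for x p
  proof -
    have "x \<in> V p"
      using that by (simp add: ind_def)
    then show ?thesis
      using a[OF S[OF that]] sc[of "p + 1"] by (simp add: Tb_eq pm.subspace_neg pm.subspace_scale)
  qed
  have j: "T j x \<in> ind U (p + 1)" if "x \<in> ind U p" "j \<in> N - {a, b}" for x p j
    using that cl(4)[of _ p] cl(5)[of j] cl(6)[of j _ p] by (auto simp: ind_def P_T P_Ta_T T_odd)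
  show ?thesis
    using sc a b j unfolding graded_stable_def by blast
qed

lemma plus_ind: "graded_stable N' T U \<Longrightarrow> U \<le> plus V \<Longrightarrow> plus (ind U) = U"
  using subspaceD(1)[of N' U]
  by (force simp: fun_eq_iff ind_def plus_part_def le_fun_def P_fix P_Ta_plus)

lemma ind_plus:
  assumes U: "graded_stable N T U" and le: "U \<le> V"
  shows "ind (plus U) = U"
proof (intro ext equalityI subsetI)
  fix p x assume x: "x \<in> ind (plus U) p"
  then have "x \<in> V p" "P x \<in> U p" "T a (P (T a x)) \<in> U p"
    using ab subspaceD(6)[OF U, of a "P (T a x)" p] by (auto simp: ind_def plus_part_def)
  then show "x \<in> U p"
    using subspaceD(2)[OF U] decomp[of x p] by metis
next
  fix p x assume x: "x \<in> U p"
  then have "x \<in> V p"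
    using le by (auto simp: le_fun_def)
  with x show "x \<in> ind (plus U) p"
    using ab subspaceD(5)[OF U, of a x p] stable_P[OF U]
    by (auto simp: ind_def plus_part_def S_P S_P[OF Ta_V])
qed

lemma plus_shift: "plus (shift U) = shift (plus U)"
  by (simp add: plus_part_def shift_def fun_eq_iff)

lemma plus_zero: "(\<forall>p. U p = {0}) \<Longrightarrow> (\<forall>p. plus U p = {0})"
  by (auto simp: plus_part_def)

lemma ind_zero: "(\<forall>p. U p = {0}) \<Longrightarrow> (\<forall>p. ind U p = {0})"
  using decomp V_closed(1) by (fastforce simp: ind_def)

text \<open>\<open>plus\<close> and \<open>ind\<close> are mutually inverse and monotone between the
  stable families below \<open>V\<close> and those below \<open>plus V\<close>, so each of them
  preserves minimality among nonzero stable families.\<close>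

lemma simple_ind:
  assumes U: "graded_simple (N - {a, b}) T U" and le: "U \<le> plus V"
  shows "graded_simple N T (ind U)"
proof -
  have st: "graded_stable (N - {a, b}) T U"
    using U by (simp add: graded_simple_def)
  have "\<exists>p. ind U p \<noteq> {0}"
    using U plus_zero[of "ind U"] plus_ind[OF st le] by (auto simp: graded_simple_def)
  moreover have "(\<forall>p. W p = {0}) \<or> W = ind U" if W: "graded_stable N T W" "W \<le> ind U" for W
  proof -
    have WV: "W \<le> V"
      using W(2) ind_le order.trans by blast
    have "plus W \<le> U"
      using plus_mono[OF W(2)] plus_ind[OF st le] by simp
    then have "(\<forall>p. plus W p = {0}) \<or> plus W = U"
      using U stable_plus[OF W(1) WV] by (simp add: graded_simple_def)
    then show ?thesis
      using ind_plus[OF W(1) WV] ind_zero[of "plus W"] by auto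
  qed
  ultimately show ?thesis
    using stable_ind[OF st le] by (simp add: graded_simple_def)
qed

lemma simple_plus:
  assumes V: "graded_simple N T V"
  shows "graded_simple (N - {a, b}) T (plus V)"
proof -
  have "\<exists>p. plus V p \<noteq> {0}"
    using V ind_zero[of "plus V"] ind_plus[OF stable order.refl] by (auto simp: graded_simple_def)
  moreover have "(\<forall>p. W p = {0}) \<or> W = plus V" if W: "graded_stable (N - {a, b}) T W" "W \<le> plus V" for W
  proof -
    have "(\<forall>p. ind W p = {0}) \<or> ind W = V"
      using V stable_ind[OF W] ind_le by (simp add: graded_simple_def)
    then show ?thesis
      using plus_ind[OF W] plus_zero[of "ind W"] by auto
  qed
  ultimately show ?thesis
    using stable_plus[OF stable order.refl] by (simp add: graded_simple_def)
qed

text \<open>In \<open>x = P x + T a (P (T a x))\<close> both projections are sums of vectors from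
  simple subfamilies \<open>U\<close> of the eigenspace. Each such \<open>U\<close> lies in the
  simple family \<open>ind U\<close>, which also contains \<open>T a\<close> of its vectors.\<close>

lemma spanned_by_simples_strip:
  assumes "spanned_by_simples (N - {a, b}) T (plus V)"
  shows "spanned_by_simples N T V"
  unfolding spanned_by_simples_def
proof (intro allI subsetI)
  fix p x assume x: "x \<in> V p"
  let ?G = "\<lambda>p. \<Union>{U p |U. graded_simple N T U \<and> U \<le> V}"
  let ?H = "\<lambda>p. \<Union>{U p |U. graded_simple (N - {a, b}) T U \<and> U \<le> plus V}"
  have sub: "?H p \<subseteq> ?G p" for p
  proof
    fix y assume "y \<in> ?H p"
    then obtain U where U: "graded_simple (N - {a, b}) T U" "U \<le> plus V" "y \<in> U p"
      by blast
    have "U p = plus (ind U) p"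
      using plus_ind[OF _ U(2)] U(1) by (auto simp: graded_simple_def)
    then have "y \<in> ind U p"
      using U(3) by (simp add: plus_part_def)
    then show "y \<in> ?G p"
      using simple_ind[OF U(1,2)] ind_le by blast
  qed
  have Ta: "T a ` ?H (p + 1) \<subseteq> ?G p"
  proof
    fix y assume "y \<in> T a ` ?H (p + 1)"
    then obtain u U where U: "graded_simple N T U" "U \<le> V" "u \<in> U (p + 1)" "y = T a u"
      using sub[of "p + 1"] by blast
    then have "y \<in> U p"
      using ab subspaceD(6)[of N U a u p] by (auto simp: graded_simple_def)
    then show "y \<in> ?G p"
      using U by blast
  qed
  have "P x \<in> pm.span (?H p)"
    using assms x P_V S_P unfolding spanned_by_simples_def plus_part_def by blast
  then have 1: "P x \<in> pm.span (?G p)"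
    using pm.span_mono[OF sub] by blast
  have "P (T a x) \<in> pm.span (?H (p + 1))"
    using assms x P_Ta_V S_P[OF Ta_V] unfolding spanned_by_simples_def plus_part_def by blast
  then have "T a (P (T a x)) \<in> pm.span (T a ` ?H (p + 1))"
    using module_hom.span_image[OF T_hom, of a] by blast
  then have 2: "T a (P (T a x)) \<in> pm.span (?G p)"
    using pm.span_mono[OF Ta] by blast
  show "x \<in> pm.span (?G p)"
    using decomp[OF x] pm.span_add[OF 1 2] by simp
qed

end

section \<open>Isomorphisms and the splitting\<close>

lemma graded_isoE:
  assumes "graded_iso N T V T' V'"
  obtains \<phi> where "\<And>p. bij_betw (\<phi> p) (V p) (V' p)"
    "\<And>p x y. x \<in> V p \<Longrightarrow> y \<in> V p \<Longrightarrow> \<phi> p (x + y) = \<phi> p x + \<phi> p y"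
    "\<And>p c x. x \<in> V p \<Longrightarrow> \<phi> p (psc c x) = psc c (\<phi> p x)"
    "\<And>p i x. i \<in> N \<Longrightarrow> x \<in> V p \<Longrightarrow> \<phi> (p + 1) (T i x) = T' i (\<phi> p x)"
  using assms unfolding graded_iso_def by blast

lemma graded_isoI:
  assumes "\<And>p. inj_on (\<phi> p) (V p)" "\<And>p. \<phi> p ` V p = V' p"
    "\<And>p x y. x \<in> V p \<Longrightarrow> y \<in> V p \<Longrightarrow> \<phi> p (x + y) = \<phi> p x + \<phi> p y"
    "\<And>p c x. x \<in> V p \<Longrightarrow> \<phi> p (psc c x) = psc c (\<phi> p x)"
    "\<And>p i x. i \<in> N \<Longrightarrow> x \<in> V p \<Longrightarrow> \<phi> (p + 1) (T i x) = T' i (\<phi> p x)"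
  shows "graded_iso N T V T' V'"
  using assms unfolding graded_iso_def bij_betw_def by blast

lemma (in clmod_strip) graded_iso_plus:
  assumes V': "clmod_strip N d T' V' a b e" and iso: "graded_iso N T V T' V'"
  shows "graded_iso (N - {a, b}) T (plus V) T' (plus_part e a b T' V')"
proof -
  interpret V': clmod_strip N d T' V' a b e by (rule V')
  obtain \<phi> where bij: "\<And>p. bij_betw (\<phi> p) (V p) (V' p)"
    and add: "\<And>p x y. x \<in> V p \<Longrightarrow> y \<in> V p \<Longrightarrow> \<phi> p (x + y) = \<phi> p x + \<phi> p y"
    and scale: "\<And>p c x. x \<in> V p \<Longrightarrow> \<phi> p (psc c x) = psc c (\<phi> p x)"
    and T: "\<And>p i x. i \<in> N \<Longrightarrow> x \<in> V p \<Longrightarrow> \<phi> (p + 1) (T i x) = T' i (\<phi> p x)"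
    using graded_isoE[OF iso] by blast
  have S: "\<phi> p (S x) = V'.S (\<phi> p x)" if "x \<in> V p" for x p
    using that T[of a "T b x" "p + 1"] T[of b x p] Tb_V[of x p] ab scale[of "T a (T b x)" p] Ta_V'[of "T b x" p]
    by (simp add: inv_op_def)
  show ?thesis
  proof (rule graded_isoI[where \<phi> = \<phi>])
    fix p
    show inj: "inj_on (\<phi> p) (plus V p)"
      using bij[of p] by (auto simp: bij_betw_def plus_part_def intro: inj_on_subset)
    have "\<phi> p x \<in> plus_part e a b T' V' p" if "x \<in> plus V p" for x
      using that S[of x p] bij_betwE[OF bij[of p]] by (auto simp: plus_part_def)
    moreover have "y \<in> \<phi> p ` plus V p" if y: "y \<in> plus_part e a b T' V' p" for y
    proof -
      obtain x where x: "x \<in> V p" "y = \<phi> p x"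
        using y bij[of p] by (auto simp: plus_part_def bij_betw_def)
      then have "\<phi> p (S x) = \<phi> p x"
        using y S[of x p] by (simp add: plus_part_def)
      then have "S x = x"
        using x(1) S_V bij[of p] by (auto simp: bij_betw_def inj_on_def)
      then show ?thesis
        using x by (auto simp: plus_part_def)
    qed
    ultimately show "\<phi> p ` plus V p = plus_part e a b T' V' p"
      by blast
  qed (auto simp: plus_part_def add scale T)
qed

text \<open>An isomorphism \<open>\<phi>\<close> of the eigenspaces is extended coordinatewise:
  \<open>\<psi>\<close> applies \<open>\<phi>\<close> to both coordinates of \<open>x\<close> and
  reassembles them with \<open>T' a\<close>. Equivariance is checked for \<open>T a\<close>, for
  \<open>S\<close>, and for the remaining generators; \<open>T b\<close> follows from the first
  two.\<close>

lemma (in clmod_strip) graded_iso_strip: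
  assumes V': "clmod_strip N d T' V' a b e"
    and iso: "graded_iso (N - {a, b}) T (plus V) T' (plus_part e a b T' V')"
  shows "graded_iso N T V T' V'"
proof -
  interpret V': clmod_strip N d T' V' a b e by (rule V')
  obtain \<phi> where bij: "\<And>p. bij_betw (\<phi> p) (plus V p) (V'.plus V' p)"
    and add: "\<And>p x y. x \<in> plus V p \<Longrightarrow> y \<in> plus V p \<Longrightarrow> \<phi> p (x + y) = \<phi> p x + \<phi> p y"
    and scale: "\<And>p c x. x \<in> plus V p \<Longrightarrow> \<phi> p (psc c x) = psc c (\<phi> p x)"
    and T: "\<And>p i x. i \<in> N - {a, b} \<Longrightarrow> x \<in> plus V p \<Longrightarrow> \<phi> (p + 1) (T i x) = T' i (\<phi> p x)"
    using graded_isoE[OF iso] by blast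
  define \<psi> where "\<psi> p x = \<phi> p (P x) + T' a (\<phi> (p + 1) (P (T a x)))" for p x
  have Pp: "P x \<in> plus V p" "P (T a x) \<in> plus V (p + 1)" if "x \<in> V p" for x p
    using that P_V S_P P_Ta_V S_P[OF Ta_V] by (auto simp: plus_part_def)
  have \<phi>: "\<phi> p u \<in> V' p" "V'.S (\<phi> p u) = \<phi> p u" if "u \<in> plus V p" for u p
    using that bij_betwE[OF bij[of p]] by (auto simp: plus_part_def)
  have \<phi>0: "\<phi> p 0 = 0" for p
    using scale[of 0 p 0] V_closed(1) by (simp add: plus_part_def)
  have \<phi>m: "\<phi> p (- u) = - \<phi> p u" if "u \<in> plus V p" for u p
    using scale[of u p "-1"] that by simp
  have \<psi>V: "\<psi> p x \<in> V' p" if "x \<in> V p" for x p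
    using \<phi>[OF Pp(1)[OF that]] \<phi>[OF Pp(2)[OF that]] V'.Ta_V' V'.V_closed by (simp add: \<psi>_def)
  have P\<psi>: "V'.P (\<psi> p x) = \<phi> p (P x)" and PT\<psi>: "V'.P (T' a (\<psi> p x)) = \<phi> (p + 1) (P (T a x))"
    if "x \<in> V p" for x p
    using \<phi>[OF Pp(1)[OF that]] \<phi>[OF Pp(2)[OF that]]
    by (simp_all add: \<psi>_def V'.P_fix V'.P_Ta_plus)
  have \<psi>a: "\<psi> p (x + y) = \<psi> p x + \<psi> p y" if "x \<in> V p" "y \<in> V p" for x y p
    using Pp[OF that(1)] Pp[OF that(2)] add by (simp add: \<psi>_def)
  have \<psi>s: "\<psi> p (psc c x) = psc c (\<psi> p x)" if "x \<in> V p" for x c p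
    using Pp[OF that(1)] scale by (simp add: \<psi>_def pm.scale_right_distrib)
  have \<psi>Ta: "\<psi> (p + 1) (T a x) = T' a (\<psi> p x)" if "x \<in> V p" for x p
    using \<phi>[OF Pp(1)[OF that]] \<phi>[OF Pp(2)[OF that]] that by (simp add: \<psi>_def add.commute)
  have \<psi>S: "\<psi> p (S x) = V'.S (\<psi> p x)" if "x \<in> V p" for x p
    using \<phi>[OF Pp(1)[OF that]] \<phi>[OF Pp(2)[OF that]] that
    by (simp add: \<psi>_def P_S P_Ta_S \<phi>m Pp V'.S_Ta)
  have \<psi>T: "\<psi> (p + 1) (T j x) = T' j (\<psi> p x)" if x: "x \<in> V p" and j: "j \<in> N - {a, b}" for x p j
  proof -
    have j': "j \<in> N" "j \<noteq> a"
      using j by auto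
    have Tj: "T j (P (T a x)) \<in> plus V p"
      using Pp(2)[OF x] S_T[OF j, of "P (T a x)" "p + 1"] T_odd[OF j'(1), of "P (T a x)" "p + 1"]
      by (simp add: plus_part_def)
    \<comment> \<open>Two signs cancel: one from the action of \<open>T j\<close> on the second
      coordinate, one from moving \<open>T' j\<close> past \<open>T' a\<close> in the
      target.\<close>
    have "\<psi> (p + 1) (T j x) = T' j (\<phi> p (P x)) - T' a (\<phi> p (T j (P (T a x))))"
      using T[OF j Pp(1)[OF x]] by (simp add: \<psi>_def P_T[OF j x] P_Ta_T[OF j x] \<phi>m[OF Tj])
    also have "\<phi> p (T j (P (T a x))) = T' j (\<phi> (p + 1) (P (T a x)))"
      using T[OF j Pp(2)[OF x]] by simp
    also have "T' a \<dots> = - T' j (T' a (\<phi> (p + 1) (P (T a x))))"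
      using V'.T_anti[OF V'.ab(1) j'(1) _ \<phi>(1)[OF Pp(2)[OF x]]] j'(2) by auto
    finally show ?thesis
      by (simp add: \<psi>_def)
  qed
  have \<psi>Tb: "\<psi> (p + 1) (T b x) = T' b (\<psi> p x)" if x: "x \<in> V p" for x p
  proof -
    have 1: "T b x = psc (- e) (T a (S x))" "T' b (\<psi> p x) = psc (- e) (T' a (V'.S (\<psi> p x)))"
      using Tb_eq[OF x] V'.Tb_eq[OF \<psi>V[OF x]] by simp_all
    show ?thesis
      unfolding 1 \<psi>s[OF Ta_V[OF S_V[OF x]]] \<psi>Ta[OF S_V[OF x]] \<psi>S[OF x] ..
  qed
  show ?thesis
  proof (rule graded_isoI[where \<phi> = \<psi>])
    fix p
    show "inj_on (\<psi> p) (V p)"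
    proof (rule inj_onI)
      fix x y assume xy: "x \<in> V p" "y \<in> V p" "\<psi> p x = \<psi> p y"
      then have "\<phi> p (P x) = \<phi> p (P y)" "\<phi> (p + 1) (P (T a x)) = \<phi> (p + 1) (P (T a y))"
        using P\<psi>[of x p] P\<psi>[of y p] PT\<psi>[of x p] PT\<psi>[of y p] by simp_all
      then have "P x = P y" "P (T a x) = P (T a y)"
        using bij[of p] bij[of "p + 1"] Pp[OF xy(1)] Pp[OF xy(2)] by (auto simp: bij_betw_def inj_on_def)
      then show "x = y"
        using decomp[OF xy(1)] decomp[OF xy(2)] by simp
    qed
    have "y \<in> \<psi> p ` V p" if y: "y \<in> V' p" for y
    proof -
      have "V'.P y \<in> V'.plus V' p" "V'.P (T' a y) \<in> V'.plus V' (p + 1)"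
        unfolding plus_part_def using V'.P_V[OF y] V'.S_P[OF y] V'.P_Ta_V[OF y] V'.S_P[OF V'.Ta_V[OF y]] by simp_all
      then have "V'.P y \<in> \<phi> p ` plus V p" "V'.P (T' a y) \<in> \<phi> (p + 1) ` plus V (p + 1)"
        unfolding bij_betw_imp_surj_on[OF bij] .
      then obtain u u' where u: "u \<in> plus V p" "V'.P y = \<phi> p u" "u' \<in> plus V (p + 1)" "V'.P (T' a y) = \<phi> (p + 1) u'"
        by blast
      have x: "u + T a u' \<in> V p"
        using u Ta_V' V_closed by (auto simp: plus_part_def)
      have uV: "u \<in> V p" "S u = u" "u' \<in> V (p + 1)" "S u' = u'"
        using u by (auto simp: plus_part_def)
      then have "P (u + T a u') = u" "P (T a (u + T a u')) = u'"
        using P_fix[of u] P_fix[of u'] P_Ta_plus[OF uV(1,2)] P_Ta_plus[OF uV(3,4)] Ta_Ta[OF uV(3)] by simp_all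
      then have "\<psi> p (u + T a u') = y"
        using V'.decomp[OF y] u by (simp add: \<psi>_def del: T_add P_linear)
      then show ?thesis
        using x by blast
    qed
    then show "\<psi> p ` V p = V' p"
      using \<psi>V by blast
    fix i x assume "i \<in> N" "x \<in> V p"
    then show "\<psi> (p + 1) (T i x) = T' i (\<psi> p x)"
      using \<psi>T \<psi>Ta \<psi>Tb by (cases "i = a \<or> i = b") auto
  qed (rule \<psi>a \<psi>s; assumption)+
qed

section \<open>Dimensions\<close>

lemma independent_Un:
  assumes B: "pm.independent B" and C: "finite C" "pm.independent C" and disj: "pm.span B \<inter> pm.span C = {0}"
  shows "pm.independent (B \<union> C)"
  using C disj
proof (induction C rule: finite_induct)
  case (insert c C)
  have "pm.span C \<subseteq> pm.span (insert c C)"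
    by (intro pm.span_mono) blast
  then have "pm.span B \<inter> pm.span C = {0}"
    using insert.prems(2) pm.span_zero[of B] pm.span_zero[of C] by blast
  moreover have C: "pm.independent C" "c \<notin> pm.span C"
    using insert.prems(1) insert.hyps(2) pm.independent_insert[of c C] by simp_all
  ultimately have IH: "pm.independent (B \<union> C)"
    using insert.IH by blast
  have "c \<notin> pm.span (B \<union> C)"
  proof
    assume "c \<in> pm.span (B \<union> C)"
    then obtain u v where uv: "c = u + v" "u \<in> pm.span B" "v \<in> pm.span C"
      unfolding pm.span_Un by blast
    then have "u \<in> pm.span (insert c C)"
      using pm.span_diff[of c "insert c C" v] pm.span_base[of c "insert c C"] \<open>pm.span C \<subseteq> _\<close> by auto
    then have "u = 0"
      using uv(2) insert.prems(2) by blast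
    then show False
      using uv C by simp
  qed
  then show ?case
    using IH pm.independent_insert[of c "B \<union> C"] by (simp add: Un_insert_right pm.span_base)
qed (use B in simp)

text \<open>The square of \<open>T i\<close> is the nonzero scalar \<open>d i\<close>, so
  \<open>T i\<close> is injective on \<open>V p\<close> and maps bases to bases.\<close>

lemma (in clmod) dim_is_T:
  assumes W: "dim_is W n" and V: "W \<subseteq> V p" and i: "i \<in> N" "d i \<noteq> 0"
  shows "dim_is (T i ` W) n"
proof -
  obtain B where B: "finite B" "pm.independent B" "pm.span B = W" "card B = n"
    using W by (auto simp: dim_is_def)
  have inj: "inj_on (T i) (V p)"
  proof (rule inj_onI)
    fix x y assume xy: "x \<in> V p" "y \<in> V p" "T i x = T i y"
    then have "psc (d i) x = psc (d i) y"
      unfolding T_T[OF i(1) xy(1), symmetric] T_T[OF i(1) xy(2), symmetric] by (simp only:)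
    then show "x = y"
      using i(2) by auto
  qed
  have "pm.independent (T i ` B)"
    using module_hom.independent_injective_image[OF T_hom B(2)] inj V B(3) inj_on_subset by blast
  moreover have "card (T i ` B) = n"
    using B V pm.span_superset[of B] inj by (subst card_image) (auto intro: inj_on_subset)
  ultimately show ?thesis
    unfolding dim_is_def using B module_hom.span_image[OF T_hom, of i B]
    by (intro exI[of _ "T i ` B"]) simp
qed

lemma dim_is_sum:
  assumes "dim_is W m" "dim_is W' n" "W \<inter> W' = {0}"
  shows "dim_is {x + y | x y. x \<in> W \<and> y \<in> W'} (m + n)"
proof -
  obtain B C where B: "finite B" "pm.independent B" "pm.span B = W" "card B = m"
    and C: "finite C" "pm.independent C" "pm.span C = W'" "card C = n"
    using assms(1,2) by (auto simp: dim_is_def)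
  have "0 \<notin> B"
    using B(2) pm.dependent_zero by blast
  then have "B \<inter> C = {}"
  proof (intro equals0I)
    fix x assume "x \<in> B \<inter> C"
    then have "x \<in> W \<inter> W'"
      using pm.span_base B(3) C(3) by auto
    then show False
      using assms(3) \<open>0 \<notin> B\<close> \<open>x \<in> B \<inter> C\<close> by auto
  qed
  then have "card (B \<union> C) = m + n"
    using B C by (simp add: card_Un_disjoint)
  moreover have "pm.independent (B \<union> C)"
    using B C assms(3) by (intro independent_Un) auto
  moreover have "pm.span (B \<union> C) = {x + y | x y. x \<in> W \<and> y \<in> W'}"
    unfolding pm.span_Un B(3) C(3) by blast
  ultimately show ?thesis
    unfolding dim_is_def using B(1) C(1) by (intro exI[of _ "B \<union> C"]) simp
qed

text \<open>\<open>V p\<close> is the direct sum of \<open>plus V p\<close> and the image under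
  \<open>T a\<close> of \<open>plus V (p + 1)\<close>. Hence both parities receive the same
  dimension, even when the eigenspace is concentrated in a single parity.\<close>

lemma (in clmod_strip) dim_is_strip:
  assumes m: "\<And>p. dim_is (plus V p) (m p)"
  shows "dim_is (V p) (m 0 + m 1)"
proof -
  have 1: "dim_is (T a ` plus V (p + 1)) (m (p + 1))"
    by (rule dim_is_T[OF m, of _ "p + 1"]) (auto simp: plus_part_def ab dab)
  have "x = 0" if x: "x \<in> plus V p" "y \<in> plus V (p + 1)" "x = T a y" for x y
  proof -
    have "P x = 0"
      using x P_Ta_plus[of y "p + 1"] by (simp add: plus_part_def)
    then show ?thesis
      using x by (simp add: plus_part_def P_fix)
  qed
  moreover have "0 \<in> plus V p" "0 \<in> plus V (p + 1)"
    using V_closed(1) by (auto simp: plus_part_def)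
  ultimately have 2: "plus V p \<inter> T a ` plus V (p + 1) = {0}"
    using T_0[of a] by (auto intro!: rev_image_eqI[of 0])
  have "V p = {x + y | x y. x \<in> plus V p \<and> y \<in> T a ` plus V (p + 1)}"
  proof (intro equalityI subsetI)
    fix x assume x: "x \<in> V p"
    then have "P x \<in> plus V p" "P (T a x) \<in> plus V (p + 1)"
      unfolding plus_part_def using P_V[OF x] S_P[OF x] P_Ta_V[OF x] S_P[OF Ta_V[OF x]] by simp_all
    then show "x \<in> {x + y | x y. x \<in> plus V p \<and> y \<in> T a ` plus V (p + 1)}"
      using decomp[OF x] by blast
  next
    fix x assume "x \<in> {x + y | x y. x \<in> plus V p \<and> y \<in> T a ` plus V (p + 1)}"
    then obtain u u' where "x = u + T a u'" "u \<in> V p" "u' \<in> V (p + 1)"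
      by (auto simp: plus_part_def)
    then show "x \<in> V p"
      using V_closed(2) Ta_V' by simp
  qed
  then have "dim_is (V p) (m p + m (p + 1))"
    using dim_is_sum[OF m[of p] 1 2] by simp
  moreover have "m p + m (p + 1) = m 0 + m 1"
    by (cases p) (simp_all add: add.commute)
  ultimately show ?thesis
    by simp
qed

section \<open>Reduction to at most two generators\<close>

text \<open>This is even rank together with a square discriminant. The sign that usually enters the
  discriminant is absorbed by the square root of -1 that is available whenever the notion is
  applied.\<close>

definition split_form :: "nat set \<Rightarrow> (nat \<Rightarrow> 'k::field) \<Rightarrow> bool" where
  "split_form N d \<longleftrightarrow> even (card N) \<and> (\<exists>c. (\<Prod>i\<in>N. d i) = c\<^sup>2)"

lemma prod_two_elements:
  assumes "finite N" "a \<in> N" "b \<in> N" "a \<noteq> b"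
  shows "prod f N = f a * f b * prod f (N - {a, b} :: nat set)"
proof -
  have "prod f N = prod f (insert a (insert b (N - {a, b})))"
    using assms by (intro arg_cong[of _ _ "prod f"]) auto
  then show ?thesis
    using assms by (simp add: mult.assoc)
qed

text \<open>The determinant of the Gram matrix is multiplied by the square of the determinant of the
  change of basis. The squared cross term in the first identity is the off-diagonal entry, which
  vanishes by orthogonality.\<close>

lemma split_form_subst:
  assumes N: "finite N" "a \<in> N" "b \<in> N" "a \<noteq> b"
    and ortho: "x * z * d a + y * w * d b = 0" and det: "x * w - y * z \<noteq> 0"
  shows "split_form N (subst_coeffs a b x y z w d) \<longleftrightarrow> split_form N d"
proof -
  let ?d = "subst_coeffs a b x y z w d" and ?D = "x * w - y * z"
  have "?d a * ?d b = d a * d b * ?D\<^sup>2 + (x * z * d a + y * w * d b)\<^sup>2"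
    using N(4) by (simp add: subst_coeffs_def power2_eq_square algebra_simps)
  moreover have "prod ?d (N - {a, b}) = prod d (N - {a, b})"
    by (intro prod.cong) (auto simp: subst_coeffs_def)
  ultimately have D: "prod ?d N = prod d N * ?D\<^sup>2"
    using ortho unfolding prod_two_elements[OF N] by simp
  have "prod d N = (c / ?D)\<^sup>2" if "prod d N * ?D\<^sup>2 = c\<^sup>2" for c
    using that det by (simp add: power_divide field_simps)
  then show ?thesis
    unfolding split_form_def D by (metis power_mult_distrib)
qed

lemma split_form_strip:
  assumes "finite N" "a \<in> N" "b \<in> N" "a \<noteq> b" "d a = 1" "d b = 1"
  shows "split_form (N - {a, b}) d \<longleftrightarrow> split_form N d"
proof -
  have "card N = card (N - {a, b}) + 2"
    using assms card_Diff_subset[of "{a, b}" N] card_mono[of N "{a, b}"] by simp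
  then show ?thesis
    using assms prod_two_elements[OF assms(1-4), of d] by (simp add: split_form_def)
qed

text \<open>The induction runs over \<open>card N\<close>, which only \<open>strip\<close> lowers;
  changes of generators are inserted in between to create two squares equal to 1. In the terminal
  pair the discriminant is not a square, so no change of generators can make both squares 1.
  Operators and spaces do not occur in the rule and are kept arbitrary where it is applied.\<close>

lemma clifford_induct [consumes 3, case_names empty single pair subst strip]:
  fixes d :: "nat \<Rightarrow> 'k::field"
  assumes fin: "finite N" and nz: "\<forall>i\<in>N. d i \<noteq> 0"
    and binary: "\<forall>a b :: 'k. a \<noteq> 0 \<longrightarrow> b \<noteq> 0 \<longrightarrow> (\<exists>x y. x\<^sup>2 * a + y\<^sup>2 * b = 1)"
    and empty: "\<And>d. P {} d"
    and single: "\<And>i d. d i \<noteq> 0 \<Longrightarrow> P {i} d"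
    and pair: "\<And>i j d. i \<noteq> j \<Longrightarrow> d i = 1 \<Longrightarrow> \<nexists>c. d j = c\<^sup>2 \<Longrightarrow> P {i, j} d"
    and subst: "\<And>N d a b x y z w. \<lbrakk>finite N; a \<in> N; b \<in> N; a \<noteq> b; x * z * d a + y * w * d b = 0;
        x * w - y * z \<noteq> 0; P N (subst_coeffs a b x y z w d)\<rbrakk> \<Longrightarrow> P N d"
    and strip: "\<And>N d a b. \<lbrakk>finite N; a \<in> N; b \<in> N; a \<noteq> b; d a = 1; d b = 1; P (N - {a, b}) d\<rbrakk> \<Longrightarrow> P N d"
  shows "P N d"
  using fin nz
proof (induction "card N" arbitrary: N d rule: less_induct)
  case less
  have one: "P N' d'" if N': "finite N'" "a \<in> N'" "b \<in> N'" "a \<noteq> b" "d' a \<noteq> 0" "d' b \<noteq> 0"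
    and P: "P N' (d'(a := 1, b := d' a * d' b))" for N' a b d'
  proof -
    obtain x y where xy: "x\<^sup>2 * d' a + y\<^sup>2 * d' b = 1"
      using binary N'(5,6) by blast
    \<comment> \<open>The second row \<open>(- y * d' b, x * d' a)\<close> is orthogonal to
      \<open>(x, y)\<close> for the form. The determinant of the change equals the value 1
      represented by \<open>(x, y)\<close>, so the product of the two squares is kept and the second
      one becomes \<open>d' a * d' b\<close>.\<close>
    have "(y * d' b)\<^sup>2 * d' a + (x * d' a)\<^sup>2 * d' b = d' a * d' b * (x\<^sup>2 * d' a + y\<^sup>2 * d' b)"
      by (simp add: power2_eq_square algebra_simps)
    then have "subst_coeffs a b x y (- y * d' b) (x * d' a) d' = d'(a := 1, b := d' a * d' b)"
      using xy by (simp add: subst_coeffs_def)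
    moreover have "x * (x * d' a) - y * (- y * d' b) \<noteq> 0"
      using xy by (simp add: power2_eq_square mult.assoc)
    ultimately show ?thesis
      using N' P by (intro subst[of N' a b x "- y * d' b" d' y "x * d' a"]) simp_all
  qed
  consider "N = {}" | i where "N = {i}" | i j where "i \<noteq> j" "N = {i, j}"
    | i j k where "i \<in> N" "j \<in> N" "k \<in> N" "i \<noteq> j" "j \<noteq> k" "i \<noteq> k"
    by blast
  then show ?case
  proof cases
    case 1
    then show ?thesis by (simp add: empty)
  next
    case 2
    then show ?thesis using less.prems by (simp add: single)
  next
    case (3 i j)
    let ?d = "d(i := 1, j := d i * d j)"
    have "P N ?d"
    proof (cases "\<exists>c. ?d j = c\<^sup>2")
      case True
      then obtain c where c: "?d j = c\<^sup>2" by blast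
      have "c \<noteq> 0"
        using less.prems 3 c by auto
      have "P N (?d(j := 1))"
      proof (rule strip)
        have "N - {i, j} = {}"
          using 3 by auto
        then show "P (N - {i, j}) (?d(j := 1))"
          by (simp only: empty)
      qed (use 3 less.prems in auto)
      moreover have "subst_coeffs i j 1 0 0 (1 / c) ?d = ?d(j := 1)"
        using 3 c \<open>c \<noteq> 0\<close> by (auto simp: subst_coeffs_def power_divide)
      ultimately show ?thesis
        using 3 less.prems \<open>c \<noteq> 0\<close> by (intro subst[of N i j 1 0 ?d 0 "1 / c"]) auto
    next
      case False
      then show ?thesis
        using pair[of i j ?d] 3 by auto
    qed
    then show ?thesis
      using 3 less.prems by (intro one[of N i j d]) auto
  next
    case (4 i j k)
    let ?d = "d(i := 1, j := d i * d j)"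
    \<comment> \<open>Two rotations in a row: \<open>i\<close>, \<open>j\<close> become 1 and
      \<open>d i * d j\<close>, and then \<open>j\<close>, \<open>k\<close> become 1 and the product
      of all three. Now \<open>i\<close> and \<open>j\<close> both have square 1 and can be split
      off.\<close>
    let ?d' = "?d(j := 1, k := ?d j * ?d k)"
    have "card (N - {i, j}) < card N"
      using 4 less.prems by (intro psubset_card_mono) auto
    then have "P (N - {i, j}) ?d'"
      using 4 less.prems by (intro less.hyps) auto
    then have "P N ?d'"
      using 4 less.prems by (intro strip[of N i j ?d']) auto
    then have "P N ?d"
      using 4 less.prems by (intro one[of N j k ?d]) auto
    then show ?thesis
      using 4 less.prems by (intro one[of N i j d]) auto
  qed
qed

section \<open>At most two generators\<close>

text \<open>One vector \<open>v\<close> generates \<open>U\<close>, and every nonzero homogeneous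
  vector of \<open>U\<close> generates \<open>v\<close> in turn.\<close>

lemma graded_simpleI:
  assumes U: "graded_stable N T U" and v: "v \<in> U p" "v \<noteq> 0"
    and min: "\<And>W. graded_stable N T W \<Longrightarrow> v \<in> W p \<Longrightarrow> U \<le> W"
    and ex: "\<And>W q u. graded_stable N T W \<Longrightarrow> W \<le> U \<Longrightarrow> u \<in> W q \<Longrightarrow> u \<noteq> 0 \<Longrightarrow> v \<in> W p"
  shows "graded_simple N T U"
  unfolding graded_simple_def
proof (intro conjI allI impI)
  show "\<exists>p. U p \<noteq> {0}"
    using v by blast
  fix W assume W: "graded_stable N T W \<and> W \<le> U"
  show "(\<forall>p. W p = {0}) \<or> W = U"
  proof (cases "\<forall>p. W p \<subseteq> {0}")
    case True
    then show ?thesis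
      using W by (auto simp: graded_stable_def pm.subspace_0 subset_singleton_iff)
  next
    case False
    then have "v \<in> W p"
      using ex W by blast
    then show ?thesis
      using min W by (simp add: order.antisym)
  qed
qed (rule U)

lemma graded_simple_le_eq:
  assumes "graded_simple N T V" "graded_stable N T U" "U \<le> V" "v \<in> U p" "v \<noteq> 0"
  shows "U = V"
  using assms unfolding graded_simple_def by blast

lemma graded_simple_nonzero:
  assumes "graded_simple N T V"
  obtains p v where "v \<in> V p" "v \<noteq> 0"
  using assms unfolding graded_simple_def graded_stable_def by (metis pm.subspace_0 singletonI subsetI subset_singletonD insertI1 empty_iff subset_antisym singletonD)

lemma spanned_by_simplesI:
  assumes "\<And>p v. v \<in> V p \<Longrightarrow> v \<noteq> 0 \<Longrightarrow> \<exists>U. graded_simple N T U \<and> U \<le> V \<and> v \<in> U p"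
  shows "spanned_by_simples N T V"
  unfolding spanned_by_simples_def
proof (intro allI subsetI)
  fix p v assume "v \<in> V p"
  then show "v \<in> pm.span (\<Union>{U p |U. graded_simple N T U \<and> U \<le> V})"
    using assms[of v p] by (cases "v = 0") (auto simp: pm.span_zero intro!: pm.span_base)
qed

text \<open>
  A graded module over a Clifford superalgebra with an invertible generator is determined by its
  even part, as a module over the even part of the superalgebra.
\<close>

lemma (in clmod) graded_iso_from_even:
  assumes V': "clmod N d T' V'" and i: "i \<in> N" "d i \<noteq> 0"
    and bij: "bij_betw f (V p) (V' p)"
    and add: "\<And>x y. x \<in> V p \<Longrightarrow> y \<in> V p \<Longrightarrow> f (x + y) = f x + f y"
    and scale: "\<And>c x. x \<in> V p \<Longrightarrow> f (psc c x) = psc c (f x)"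
    and T: "\<And>j x. j \<in> N \<Longrightarrow> x \<in> V p \<Longrightarrow> f (T i (T j x)) = T' i (T' j (f x))"
  shows "graded_iso N T V T' V'"
proof -
  interpret V': clmod N d T' V' by (rule V')
  have fV: "f x \<in> V' p" if "x \<in> V p" for x
    using that bij by (auto simp: bij_betw_def)
  \<comment> \<open>On the other parity the map is forced: move to parity \<open>p\<close> by
    \<open>T i\<close>, apply \<open>f\<close>, return by \<open>T' i\<close>, and divide by the
    square \<open>d i\<close>.\<close>
  define g where "g x = psc (1 / d i) (T' i (f (T i x)))" for x
  define \<phi> where "\<phi> q = (if q = p then f else g)" for q
  have odd: "T j x \<in> V p" if "x \<in> V (p + 1)" "j \<in> N" for x j
    using T_odd[OF that(2,1)] by simp
  have odd': "T' j x \<in> V' p" if "x \<in> V' (p + 1)" "j \<in> N" for x j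
    using V'.T_odd[OF that(2,1)] by simp
  have gT: "g (T j x) = T' j (f x)" if "x \<in> V p" "j \<in> N" for x j
    using T[OF that(2,1)] V'.T_T[OF i(1) V'.T_odd[OF that(2) fV[OF that(1)]]] i(2) by (simp add: g_def)
  have ex: "\<exists>y\<in>V p. x = T i y" if "x \<in> V (p + 1)" for x
    using T_T[OF i(1) that] odd[OF that i(1)] V_closed(4) i(2)
    by (intro bexI[of _ "psc (1 / d i) (T i x)"]) simp_all
  have fT: "f (T j x) = T' j (g x)" if x: "x \<in> V (p + 1)" and j: "j \<in> N" for x j
  proof -
    obtain y where y: "y \<in> V p" "x = T i y"
      using ex[OF x] by blast
    have m: "f (- u) = - f u" if "u \<in> V p" for u
      using scale[OF that, of "-1"] by simp
    \<comment> \<open>The hypothesis on \<open>f\<close> covers \<open>T i\<close> after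
      \<open>T j\<close>. For \<open>j \<noteq> i\<close> the reversed order costs one sign in the
      source and one in the target; for \<open>j = i\<close> the orders agree.\<close>
    have "f (T j (T i y)) = T' j (T' i (f y))"
    proof (cases "j = i")
      case True
      then show ?thesis
        using T[OF i(1) y(1)] by simp
    next
      case False
      then show ?thesis
        using T_anti[OF j i(1) _ y(1)] V'.T_anti[OF j i(1) _ fV[OF y(1)]] T[OF j y(1)]
          m[OF odd[OF T_odd[OF j y(1)] i(1)]] by simp
    qed
    then show ?thesis
      using gT[OF y(1) i(1)] y(2) by simp
  qed
  have p: "q = p \<or> q = p + 1" for q :: bit
    by (cases p; cases q) simp_all
  have neq: "p + 1 \<noteq> p"
    by simp
  have injf: "inj_on f (V p)" and surjf: "f ` V p = V' p"
    using bij by (auto simp: bij_betw_def)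
  have inj': "x = y" if "x \<in> V' p" "y \<in> V' p" "T' i x = T' i y" for x y
    using V'.T_T[OF i(1) that(1)] V'.T_T[OF i(1) that(2)] that(3) i(2) by (metis pm.scale_left_imp_eq pm.scale_cancel_left)
  have "inj_on g (V (p + 1))"
  proof (rule inj_onI)
    fix x y assume xy: "x \<in> V (p + 1)" "y \<in> V (p + 1)" "g x = g y"
    obtain x' y' where x'y': "x' \<in> V p" "x = T i x'" "y' \<in> V p" "y = T i y'"
      using ex xy by metis
    then have "f x' = f y'"
      using xy(3) gT[OF _ i(1)] inj'[OF fV fV] by simp
    then show "x = y"
      using injf x'y' by (auto simp: inj_on_def)
  qed
  moreover have "g ` V (p + 1) = V' (p + 1)"
  proof (intro equalityI subsetI)
    fix y assume "y \<in> g ` V (p + 1)"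
    then show "y \<in> V' (p + 1)"
      using ex gT[OF _ i(1)] V'.T_odd[OF i(1) fV] by (metis imageE)
  next
    fix y assume y: "y \<in> V' (p + 1)"
    then have "psc (1 / d i) (T' i y) \<in> f ` V p"
      unfolding surjf using odd'[OF y i(1)] V'.V_closed(4) by blast
    then obtain x where x: "x \<in> V p" "psc (1 / d i) (T' i y) = f x"
      by blast
    then have "g (T i x) = y"
      using gT[OF x(1) i(1)] V'.T_T[OF i(1) y] i(2) by (simp flip: x(2))
    then show "y \<in> g ` V (p + 1)"
      using T_odd[OF i(1) x(1)] by blast
  qed
  ultimately have bijg: "bij_betw g (V (p + 1)) (V' (p + 1))"
    by (simp add: bij_betw_def)
  show ?thesis
  proof (rule graded_isoI[where \<phi> = \<phi>])
    fix q
    show "inj_on (\<phi> q) (V q)" "\<phi> q ` V q = V' q"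
      using p[of q] bij bijg neq by (auto simp: \<phi>_def bij_betw_def)
    fix x y assume xy: "x \<in> V q" "y \<in> V q"
    show "\<phi> q (x + y) = \<phi> q x + \<phi> q y"
      using p[of q]
    proof
      assume "q = p" then show ?thesis using add xy by (simp add: \<phi>_def)
    next
      assume "q = p + 1" then show ?thesis
        using add[OF odd odd] xy i(1) neq by (simp add: \<phi>_def g_def pm.scale_right_distrib)
    qed
  next
    fix q c x assume x: "x \<in> V q"
    show "\<phi> q (psc c x) = psc c (\<phi> q x)"
      using p[of q]
    proof
      assume "q = p" then show ?thesis using scale x by (simp add: \<phi>_def)
    next
      assume "q = p + 1" then show ?thesis
        using scale[OF odd] x i(1) neq by (simp add: \<phi>_def g_def mult.commute)
    qed
  next
    fix q j x assume x: "j \<in> N" "x \<in> V q"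
    show "\<phi> (q + 1) (T j x) = T' j (\<phi> q x)"
      using p[of q]
    proof
      assume "q = p" then show ?thesis using gT x neq by (simp add: \<phi>_def)
    next
      assume "q = p + 1" then show ?thesis using fT x neq by (simp add: \<phi>_def)
    qed
  qed
qed

lemma span_singleton: "pm.span {v} = range (\<lambda>c. psc c v)"
  by (simp add: pm.span_singleton)

lemma subspace_line: "pm.subspace (range (\<lambda>c. psc c v))"
  unfolding span_singleton[symmetric] by (rule pm.subspace_span)

lemma dim_is_line: "v \<noteq> 0 \<Longrightarrow> dim_is (range (\<lambda>c. psc c v)) 1"
  unfolding dim_is_def span_singleton[symmetric] by (intro exI[of _ "{v}"]) simp

lemma dim_is_zero: "dim_is {0} 0"
  unfolding dim_is_def by (intro exI[of _ "{}"]) (simp add: pm.independent_empty)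

definition line_map where "line_map v v' x = psc (THE c. x = psc c v) v'"

lemma line_map [simp]: "v \<noteq> 0 \<Longrightarrow> line_map v v' (psc c v) = psc c v'"
  by (simp add: line_map_def)

lemma bij_line_map:
  assumes "v \<noteq> 0" "v' \<noteq> 0"
  shows "bij_betw (line_map v v') (range (\<lambda>c. psc c v)) (range (\<lambda>c. psc c v'))"
  using assms by (auto simp: bij_betw_def inj_on_def image_image)

subsection \<open>No generators\<close>

definition no_gen where "no_gen p v = (\<lambda>q. if q = p then range (\<lambda>c. psc c v) else {0})"

lemma no_gen_simple:
  assumes v: "v \<noteq> 0"
  shows "graded_simple {} T (no_gen p v)"
proof (rule graded_simpleI[where p = p and v = v])
  show "graded_stable {} T (no_gen p v)"
    by (simp add: graded_stable_def no_gen_def subspace_line pm.subspace_single_0)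
  show "v \<in> no_gen p v p"
    using pm.scale_one[of v] by (auto simp: no_gen_def intro: range_eqI[of _ _ 1])
  fix W assume W: "graded_stable {} T W"
  then have sc: "pm.subspace (W q)" for q
    by (simp add: graded_stable_def)
  show "no_gen p v \<le> W" if "v \<in> W p"
    using that sc by (auto simp: no_gen_def le_fun_def pm.subspace_scale pm.subspace_0)
  fix q u assume u: "W \<le> no_gen p v" "u \<in> W q" "u \<noteq> 0"
  then have "u \<in> no_gen p v q"
    by (auto simp: le_fun_def)
  then obtain c where c: "q = p" "u = psc c v"
    using u(3) by (auto simp: no_gen_def split: if_splits)
  then have "psc (1 / c) u = v"
    using u(3) by auto
  then show "v \<in> W p"
    using c u(2) sc pm.subspace_scale by metis
qed (rule v)

lemma no_gen_le: "(\<And>p. pm.subspace (V p)) \<Longrightarrow> v \<in> V p \<Longrightarrow> no_gen p v \<le> V"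
  by (auto simp: no_gen_def le_fun_def pm.subspace_scale pm.subspace_0)

lemma no_gen_mem: "v \<in> no_gen p v p"
  by (auto simp: no_gen_def intro: range_eqI[of _ _ 1])

lemma no_gen_eq:
  assumes V: "graded_simple {} T V"
  obtains p v where "v \<noteq> 0" "V = no_gen p v"
proof -
  obtain p v where v: "v \<in> V p" "v \<noteq> 0"
    using graded_simple_nonzero[OF V] .
  have "graded_stable {} T (no_gen p v)" "no_gen p v \<le> V"
    using no_gen_simple[OF v(2), of T p] no_gen_le[of V v p] v V by (auto simp: graded_simple_def graded_stable_def)
  then show ?thesis
    using graded_simple_le_eq[OF V, where U = "no_gen p v" and p = p] no_gen_mem[of v p] that v(2) by blast
qed

lemma no_gen_iso:
  assumes "v \<noteq> 0" "v' \<noteq> 0"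
  shows "graded_iso {} T (no_gen p v) T' (no_gen p v')"
proof (rule graded_isoI[where \<phi> = "\<lambda>q. if q = p then line_map v v' else (\<lambda>_. 0)"])
  fix q
  show "inj_on (if q = p then line_map v v' else (\<lambda>_. 0)) (no_gen p v q)"
    "(if q = p then line_map v v' else (\<lambda>_. 0)) ` no_gen p v q = no_gen p v' q"
    using bij_line_map[OF assms] by (auto simp: no_gen_def bij_betw_def)
  fix c x y assume x: "x \<in> no_gen p v q"
  show "(if q = p then line_map v v' else (\<lambda>_. 0)) (psc c x) = psc c ((if q = p then line_map v v' else (\<lambda>_. 0)) x)"
    using x assms by (auto simp: no_gen_def)
  assume y: "y \<in> no_gen p v q"
  show "(if q = p then line_map v v' else (\<lambda>_. 0)) (x + y) =
      (if q = p then line_map v v' else (\<lambda>_. 0)) x + (if q = p then line_map v v' else (\<lambda>_. 0)) y"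
    using x y assms by (auto simp: no_gen_def simp flip: pm.scale_left_distrib)
qed simp

lemma shift_no_gen: "shift (no_gen p v) = no_gen (p + 1) v"
proof
  fix q show "shift (no_gen p v) q = no_gen (p + 1) v q"
    by (cases p; cases q) (simp_all add: shift_def no_gen_def)
qed

text \<open>In parity \<open>p\<close> one side is a line and the other is zero, and without
  generators nothing moves a vector to the other parity.\<close>

lemma no_gen_not_iso_shift:
  assumes "v \<noteq> 0"
  shows "\<not> graded_iso {} T (no_gen p v) T' (shift (no_gen p v))"
proof
  assume "graded_iso {} T (no_gen p v) T' (shift (no_gen p v))"
  then obtain \<phi> where "bij_betw \<phi> (no_gen p v p) (shift (no_gen p v) p)"
    using graded_isoE[of "{}" T "no_gen p v" T' "shift (no_gen p v)"] by metis
  then have "inj_on \<phi> (no_gen p v p)" "\<phi> ` no_gen p v p \<subseteq> {0}"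
    by (auto simp: bij_betw_def shift_def no_gen_def split: if_splits)
  moreover have "v \<in> no_gen p v p" "0 \<in> no_gen p v p"
    using no_gen_mem by (auto simp: no_gen_def intro: range_eqI[of _ _ 0])
  ultimately have "v = 0"
    by (metis (no_types) imageI inj_onD singletonD subsetD)
  then show False
    using assms by simp
qed

subsection \<open>One generator\<close>

context clmod
begin

definition one_gen where "one_gen i p v = (\<lambda>q. range (\<lambda>c. psc c (if q = p then v else T i v)))"

text \<open>\<open>T i\<close> is invertible on \<open>V\<close>, as its square is
  \<open>d i \<noteq> 0\<close>, so a nonzero vector of either parity recovers \<open>v\<close>.
  Every nonzero homogeneous vector thus lies in a simple subfamily.\<close>

lemma one_gen_simple:
  assumes N: "N = {i}" "d i \<noteq> 0" and v: "v \<in> V p" "v \<noteq> 0"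
  shows "graded_simple N T (one_gen i p v)" "one_gen i p v \<le> V" "v \<in> one_gen i p v p"
proof -
  have Tv: "T i v \<in> V (p + 1)" "T i (T i v) = psc (d i) v"
    using T_odd T_T v N by auto
  then have T0: "T i v \<noteq> 0"
    using v N(2) T_0[of i] by auto
  have par: "q = p \<or> q = p + 1" for q :: bit
    by (cases p; cases q) simp_all
  show mem: "v \<in> one_gen i p v p"
    by (auto simp: one_gen_def intro: range_eqI[of _ _ 1])
  show "one_gen i p v \<le> V"
    unfolding le_fun_def
  proof
    fix q show "one_gen i p v q \<subseteq> V q"
      using par[of q] v Tv V_closed(4) by (auto simp: one_gen_def)
  qed
  show "graded_simple N T (one_gen i p v)"
  proof (rule graded_simpleI[where p = p and v = v])
    have "T i u \<in> one_gen i p v (q + 1)" if "u \<in> one_gen i p v q" for u q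
      using that par[of q] Tv(2) by (auto simp: one_gen_def split: if_splits)
    then show "graded_stable N T (one_gen i p v)"
      by (simp add: graded_stable_def one_gen_def subspace_line N(1))
    fix W assume W: "graded_stable N T W"
    have sc: "pm.subspace (W q)" for q
      using W by (simp add: graded_stable_def)
    have Ti: "T i x \<in> W (q + 1)" if "x \<in> W q" for x q
      using W that N by (simp add: graded_stable_def)
    show "one_gen i p v \<le> W" if "v \<in> W p"
      unfolding le_fun_def
    proof
      fix q show "one_gen i p v q \<subseteq> W q"
        using par[of q] that Ti[OF that] sc by (auto simp: one_gen_def pm.subspace_scale)
    qed
    fix q u assume u: "W \<le> one_gen i p v" "u \<in> W q" "u \<noteq> 0"
    have uU: "u \<in> one_gen i p v q"
      using u by (auto simp: le_fun_def)
    from par[of q] show "v \<in> W p"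
    proof
      assume q: "q = p"
      then obtain c where c: "u = psc c v"
        using uU by (auto simp: one_gen_def)
      then have "psc (1 / c) u = v"
        using u(3) by auto
      then show ?thesis
        using q u(2) sc pm.subspace_scale by metis
    next
      assume q: "q = p + 1"
      then obtain c where c: "u = psc c (T i v)"
        using uU by (auto simp: one_gen_def)
      then have "psc (1 / (c * d i)) (T i u) = v"
        using u(3) N(2) Tv(2) by auto
      then show ?thesis
        using q Ti[OF u(2)] sc[of p] pm.subspace_scale by (metis bit_add_one_one)
    qed
  qed (use mem v in auto)
qed

text \<open>The parity \<open>p\<close> of the generating vector can be prescribed, since
  \<open>T i\<close> carries a nonzero vector to a nonzero vector of the other parity. This is why
  parity does not distinguish such modules.\<close>

lemma one_gen_eq:
  assumes "N = {i}" "d i \<noteq> 0" and V: "graded_simple N T V"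
  obtains v where "v \<noteq> 0" "V = one_gen i p v" "v \<in> V p"
proof -
  obtain q u where u: "u \<in> V q" "u \<noteq> 0"
    using graded_simple_nonzero[OF V] .
  have "\<exists>v\<in>V p. v \<noteq> 0"
  proof (cases "q = p")
    case False
    then have "p = q + 1"
      by (cases p; cases q) auto
    moreover have "T i u \<noteq> 0"
      using T_T[of i u q] u assms(1,2) T_0[of i] by auto
    ultimately show ?thesis
      using T_odd[of i u q] u assms(1) by auto
  qed (use u in blast)
  then obtain v where v: "v \<in> V p" "v \<noteq> 0"
    by blast
  note s = one_gen_simple[OF assms(1,2) v]
  show ?thesis
    using graded_simple_le_eq[OF V _ s(2) s(3) v(2)] s(1) that v by (auto simp: graded_simple_def)
qed

lemma one_gen_iso:
  assumes N: "N = {i}" "d i \<noteq> 0" and V: "graded_simple N T V"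
    and V': "clmod N d T' V'" "graded_simple N T' V'"
  shows "graded_iso N T V T' V'"
proof -
  interpret V': clmod N d T' V' by (rule V')
  obtain v where v: "v \<noteq> 0" "V = one_gen i 0 v" "v \<in> V 0"
    using one_gen_eq[OF N V] .
  obtain v' where v': "v' \<noteq> 0" "V' = V'.one_gen i 0 v'" "v' \<in> V' 0"
    using V'.one_gen_eq[OF N V'(2)] .
  have V0: "V 0 = range (\<lambda>c. psc c v)" "V' 0 = range (\<lambda>c. psc c v')"
    by (subst v(2), simp add: one_gen_def) (subst v'(2), simp add: V'.one_gen_def)
  show ?thesis
  proof (rule graded_iso_from_even[OF V'(1), where i = i and p = 0 and f = "line_map v v'"])
    show "bij_betw (line_map v v') (V 0) (V' 0)"
      unfolding V0 by (rule bij_line_map[OF v(1) v'(1)])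
    fix j x assume "j \<in> N" and x: "x \<in> V 0"
    then have "j = i" "i \<in> N"
      using N by auto
    moreover have "line_map v v' x \<in> V' 0"
      using x v unfolding V0 by auto
    ultimately show "line_map v v' (T i (T j x)) = T' i (T' j (line_map v v' x))"
      using T_T[of i x 0] V'.T_T[of i _ 0] x v unfolding V0 by auto
  next
    fix x y assume "x \<in> V 0" "y \<in> V 0"
    then show "line_map v v' (x + y) = line_map v v' x + line_map v v' y"
      using v(1) unfolding V0 by (auto simp flip: pm.scale_left_distrib)
  next
    fix c x assume "x \<in> V 0"
    then show "line_map v v' (psc c x) = psc c (line_map v v' x)"
      using v(1) unfolding V0 by auto
  qed (use N in simp_all)
qed

lemma one_gen_dim:
  assumes N: "N = {i}" "d i \<noteq> 0" and V: "graded_simple N T V"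
  shows "dim_is (V p) 1"
proof -
  obtain v where v: "v \<noteq> 0" "V = one_gen i p v" "v \<in> V p"
    using one_gen_eq[OF N V] .
  have "V p = range (\<lambda>c. psc c v)"
    by (subst v(2)) (simp add: one_gen_def)
  then show ?thesis
    using dim_is_line[OF v(1)] by simp
qed

end

subsection \<open>Two generators\<close>

definition plane where "plane u w = {psc a u + psc b w | a b. True}"

lemma plane_closed: "pm.subspace (plane u w)"
proof (rule pm.subspaceI)
  show "0 \<in> plane u w"
    unfolding plane_def by (auto intro!: exI[of _ 0])
  fix x y c assume x: "x \<in> plane u w"
  then obtain a b where ab: "x = psc a u + psc b w"
    by (auto simp: plane_def)
  then have "psc c x = psc (c * a) u + psc (c * b) w"
    by (simp add: pm.scale_right_distrib)
  then show "psc c x \<in> plane u w"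
    by (auto simp: plane_def)
  assume "y \<in> plane u w"
  then obtain a' b' where "y = psc a' u + psc b' w"
    by (auto simp: plane_def)
  with ab have "x + y = psc (a + a') u + psc (b + b') w"
    by (simp add: pm.scale_left_distrib)
  then show "x + y \<in> plane u w"
    by (auto simp: plane_def)
qed

lemma plane_subset: "pm.subspace W \<Longrightarrow> u \<in> W \<Longrightarrow> w \<in> W \<Longrightarrow> plane u w \<subseteq> W"
  by (auto simp: plane_def intro!: pm.subspace_add pm.subspace_scale)

lemma planeI [intro]: "psc a u + psc b w \<in> plane u w"
  by (auto simp: plane_def)

lemma dim_is_plane:
  assumes indep: "\<And>a b. psc a u + psc b w = 0 \<Longrightarrow> a = 0 \<and> b = 0"
  shows "dim_is (plane u w) 2"
proof -
  have nz: "u \<noteq> 0" "w \<noteq> 0"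
    using indep[of 1 0] indep[of 0 1] by auto
  have int: "x = 0" if "x = psc a u" "x = psc b w" for x a b
    using indep[of a "- b"] that by simp
  have "range (\<lambda>c. psc c u) \<inter> range (\<lambda>c. psc c w) = {0}"
  proof (intro equalityI subsetI)
    fix x assume "x \<in> range (\<lambda>c. psc c u) \<inter> range (\<lambda>c. psc c w)"
    then show "x \<in> {0}"
      using int by blast
  qed (auto intro: range_eqI[of _ _ 0])
  from dim_is_sum[OF dim_is_line[OF nz(1)] dim_is_line[OF nz(2)] this]
  have "dim_is {x + y |x y. x \<in> range (\<lambda>c. psc c u) \<and> y \<in> range (\<lambda>c. psc c w)} 2"
    by (simp add: numeral_2_eq_2)
  moreover have "{x + y |x y. x \<in> range (\<lambda>c. psc c u) \<and> y \<in> range (\<lambda>c. psc c w)} = plane u w"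
    by (auto simp: plane_def)
  ultimately show ?thesis
    by simp
qed

definition plane_map where
  "plane_map u w u' w' x = (case (THE (a, b). x = psc a u + psc b w) of (a, b) \<Rightarrow> psc a u' + psc b w')"

lemma plane_map:
  assumes indep: "\<And>a b. psc a u + psc b w = 0 \<Longrightarrow> a = 0 \<and> b = 0"
  shows "plane_map u w u' w' (psc a u + psc b w) = psc a u' + psc b w'"
proof -
  have "(THE (a', b'). psc a u + psc b w = psc a' u + psc b' w) = (a, b)"
  proof (rule the_equality)
    fix c assume "case c of (a', b') \<Rightarrow> psc a u + psc b w = psc a' u + psc b' w"
    then have "psc (a - fst c) u + psc (b - snd c) w = 0"
      by (auto simp: pm.scale_left_diff_distrib algebra_simps split: prod.splits)
    from indep[OF this] show "c = (a, b)"
      by (cases c) auto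
  qed simp
  then show ?thesis
    by (simp add: plane_map_def)
qed

locale clmod_pair = clmod N d T V
  for N and d :: "nat \<Rightarrow> 'k::field" and T :: "nat \<Rightarrow> ('m \<Rightarrow>\<^sub>0 'k) \<Rightarrow> ('m \<Rightarrow>\<^sub>0 'k)" and V +
  fixes i j :: nat and e :: 'k
  assumes N: "N = {i, j}" "i \<noteq> j" and di: "d i = 1" and dj: "\<nexists>c. d j = c\<^sup>2" and e: "e * e = - 1"
begin

text \<open>The even operator \<open>z = T i T j\<close> satisfies \<open>z^2 = - d j\<close>. Each
  component is a line over the quadratic extension generated by \<open>z\<close>; the odd one is its
  image under \<open>T i\<close>.\<close>

definition two_gen where
  "two_gen p v = (\<lambda>q. if q = p then plane v (T i (T j v)) else plane (T i v) (T j v))"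

lemma ops:
  assumes v: "v \<in> V p"
  shows "T i (T i v) = v" "T j (T j v) = psc (d j) v" "T j (T i v) = - T i (T j v)"
    "T i (T i (T j v)) = T j v" "T j (T i (T j v)) = - psc (d j) (T i v)"
    "T i (T j (T i (T j v))) = - psc (d j) v" "T i v \<in> V (p + 1)" "T j v \<in> V (p + 1)" "T i (T j v) \<in> V p"
proof -
  have ij: "i \<in> N" "j \<in> N" "j \<noteq> i"
    using N by auto
  show 1: "T i (T i v) = v" "T j (T j v) = psc (d j) v" "T j (T i v) = - T i (T j v)"
    "T i v \<in> V (p + 1)" "T j v \<in> V (p + 1)"
    using T_T[OF ij(1) v] T_T[OF ij(2) v] T_anti[OF ij(2,1,3) v] di T_odd v ij by auto
  then show "T i (T j v) \<in> V p"
    using T_odd[OF ij(1) 1(5)] by simp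
  show "T i (T i (T j v)) = T j v"
    using T_T[OF ij(1) 1(5)] di by simp
  show 2: "T j (T i (T j v)) = - psc (d j) (T i v)"
    using T_anti[OF ij(2,1,3) 1(5)] 1(2) by simp
  show "T i (T j (T i (T j v))) = - psc (d j) v"
    using 1(1) by (simp add: 2)
qed

text \<open>This is the norm form of the extension by \<open>z\<close>. A nontrivial zero would make
  \<open>- d j\<close> a square, and hence \<open>d j\<close>, as -1 is the square of
  \<open>e\<close>.\<close>

lemma norm_nonzero:
  assumes "a * a + b * b * d j = 0"
  shows "a = 0 \<and> b = 0"
proof -
  have "b = 0"
  proof (rule ccontr)
    assume "b \<noteq> 0"
    have "d j * (b * b) = - (a * a)"
      using assms by (simp add: algebra_simps eq_neg_iff_add_eq_0)
    then have "d j * (b * b) = (e * e) * (a * a)"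
      using e by simp
    then have "d j = (e * a / b)\<^sup>2"
      using \<open>b \<noteq> 0\<close> by (simp add: power2_eq_square field_simps)
    then show False
      using dj by blast
  qed
  then show ?thesis
    using assms by simp
qed

text \<open>The conjugate \<open>a - b z\<close> times \<open>a + b z\<close> is the norm, a scalar.
  Up to this nonzero scalar, \<open>v\<close> is thereby recovered from any nonzero vector of its
  plane.\<close>

lemma conj_mult:
  assumes v: "v \<in> V p"
  shows "psc a (psc a v + psc b (T i (T j v))) - psc b (T i (T j (psc a v + psc b (T i (T j v))))) =
    psc (a * a + b * b * d j) v"
  by (simp add: ops[OF v] pm.scale_right_distrib pm.scale_left_distrib pm.scale_right_diff_distrib mult_ac)

lemma indep:
  assumes v: "v \<in> V p" "v \<noteq> 0" and "psc a v + psc b (T i (T j v)) = 0"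
  shows "a = 0 \<and> b = 0"
proof -
  have "psc (a * a + b * b * d j) v = 0"
    using conj_mult[OF v(1), of a b] unfolding assms(3) by simp
  then show ?thesis
    using v(2) by (intro norm_nonzero) simp
qed

lemma two_gen_simple:
  assumes v: "v \<in> V p" "v \<noteq> 0"
  shows "graded_simple N T (two_gen p v)" "two_gen p v \<le> V" "v \<in> two_gen p v p"
proof -
  note ops = ops[OF v(1)]
  have par: "q = p \<or> q = p + 1" for q :: bit
    by (cases p; cases q) simp_all
  have np: "p + 1 \<noteq> p"
    by simp
  show mem: "v \<in> two_gen p v p"
    using planeI[of 1 v 0] by (simp add: two_gen_def)
  show "two_gen p v \<le> V"
    unfolding le_fun_def
  proof
    fix q show "two_gen p v q \<subseteq> V q"
      using par[of q] plane_subset[OF sub v(1) ops(9)] plane_subset[OF sub ops(7,8)]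
      by (auto simp: two_gen_def)
  qed
  have sub2: "pm.subspace (two_gen p v q)" for q
    by (simp add: two_gen_def plane_closed)
  show "graded_simple N T (two_gen p v)"
  proof (rule graded_simpleI[where p = p and v = v])
    have "T i u \<in> two_gen p v (q + 1) \<and> T j u \<in> two_gen p v (q + 1)" if u: "u \<in> two_gen p v q" for u q
      using par[of q]
    proof
      assume q: "q = p"
      then obtain a b where u: "u = psc a v + psc b (T i (T j v))"
        using u by (auto simp: two_gen_def plane_def)
      have "T j u = psc (- (b * d j)) (T i v) + psc a (T j v)"
        by (simp add: u ops mult.commute)
      then have "T j u \<in> plane (T i v) (T j v)"
        by (simp only: planeI)
      moreover have "T i u \<in> plane (T i v) (T j v)"
        unfolding u using planeI by (simp add: ops)
      ultimately show ?thesis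
        using q np by (simp add: two_gen_def)
    next
      assume q: "q = p + 1"
      then obtain a b where u: "u = psc a (T i v) + psc b (T j v)"
        using u by (auto simp: two_gen_def plane_def)
      have "T j u = psc (b * d j) v + psc (- a) (T i (T j v))"
        by (simp add: u ops mult.commute)
      then have "T j u \<in> plane v (T i (T j v))"
        by (simp only: planeI)
      moreover have "T i u \<in> plane v (T i (T j v))"
        unfolding u using planeI by (simp add: ops)
      ultimately show ?thesis
        using q by (simp add: two_gen_def)
    qed
    then show "graded_stable N T (two_gen p v)"
      using sub2 by (auto simp: graded_stable_def N)
    fix W assume W: "graded_stable N T W"
    have sc: "pm.subspace (W q)" for q
      using W by (simp add: graded_stable_def)
    have Tij: "T i x \<in> W (q + 1)" "T j x \<in> W (q + 1)" if "x \<in> W q" for x q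
      using W that N by (auto simp: graded_stable_def)
    have z: "T i (T j x) \<in> W q" if "x \<in> W q" for x q
      using Tij(1)[OF Tij(2)[OF that]] by simp
    show "two_gen p v \<le> W" if "v \<in> W p"
      unfolding le_fun_def
    proof
      fix q show "two_gen p v q \<subseteq> W q"
        using par[of q] plane_subset[OF sc that z[OF that]] plane_subset[OF sc Tij[OF that]]
        by (auto simp: two_gen_def)
    qed
    have main: "v \<in> W p" if u: "W \<le> two_gen p v" "u \<in> W p" "u \<noteq> 0" for u
    proof -
      have "u \<in> two_gen p v p"
        using u by (auto simp: le_fun_def)
      then obtain a b where ab: "u = psc a v + psc b (T i (T j v))"
        by (auto simp: two_gen_def plane_def)
      have "a * a + b * b * d j \<noteq> 0"
        using u(3) ab norm_nonzero[of a b] by auto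
      moreover have "psc (a * a + b * b * d j) v \<in> W p"
        unfolding conj_mult[OF v(1), symmetric] ab[symmetric]
        using u(2) z sc by (intro pm.subspace_diff pm.subspace_scale) auto
      ultimately show "v \<in> W p"
        using pm.subspace_scale[OF sc, of "psc (a * a + b * b * d j) v" p "1 / (a * a + b * b * d j)"] by simp
    qed
    fix q u assume u: "W \<le> two_gen p v" "u \<in> W q" "u \<noteq> 0"
    from par[of q] show "v \<in> W p"
    proof
      assume q: "q = p + 1"
      have "u \<in> V q"
        using u \<open>two_gen p v \<le> V\<close> by (auto simp: le_fun_def)
      then have "T i (T i u) = u"
        using T_T[of i u q] N di by simp
      then have "T i u \<noteq> 0"
        using u(3) T_0[of i] by metis
      then show ?thesis
        using main[OF u(1), of "T i u"] Tij(1)[OF u(2)] q by simp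
    qed (use main u in blast)
  qed (use mem v in auto)
qed

lemma two_gen_eq:
  assumes V: "graded_simple N T V"
  obtains v where "v \<noteq> 0" "V p = plane v (T i (T j v))" "v \<in> V p"
proof -
  obtain q u where u: "u \<in> V q" "u \<noteq> 0"
    using graded_simple_nonzero[OF V] .
  have "\<exists>v\<in>V p. v \<noteq> 0"
  proof (cases "q = p")
    case False
    then have "p = q + 1"
      by (cases p; cases q) auto
    moreover have "T i u \<noteq> 0"
      using ops(1)[OF u(1)] u(2) T_0[of i] by metis
    ultimately show ?thesis
      using ops(7)[OF u(1)] by auto
  qed (use u in blast)
  then obtain v where v: "v \<in> V p" "v \<noteq> 0"
    by blast
  note s = two_gen_simple[OF v]
  have "two_gen p v = V"
    using graded_simple_le_eq[OF V _ s(2) s(3) v(2)] s(1) by (auto simp: graded_simple_def)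
  then have "V p = plane v (T i (T j v))"
    by (auto simp: two_gen_def)
  then show ?thesis
    using that v by blast
qed

text \<open>The map between the even planes is linear over the quadratic extension, so it commutes
  with \<open>T i T j\<close>; the product of \<open>T i\<close> with itself is the identity.
  Together these two products are all that is needed to extend the map to the odd part.\<close>

lemma two_gen_iso:
  assumes V: "graded_simple N T V" and V': "clmod_pair N d T' V' i j e" "graded_simple N T' V'"
  shows "graded_iso N T V T' V'"
proof -
  interpret V': clmod_pair N d T' V' i j e by (rule V')
  obtain v where v: "v \<noteq> 0" "V 0 = plane v (T i (T j v))" "v \<in> V 0"
    using two_gen_eq[OF V] .
  obtain v' where v': "v' \<noteq> 0" "V' 0 = plane v' (T' i (T' j v'))" "v' \<in> V' 0"
    using V'.two_gen_eq[OF V'(2)] .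
  let ?f = "plane_map v (T i (T j v)) v' (T' i (T' j v'))"
  let ?g = "plane_map v' (T' i (T' j v')) v (T i (T j v))"
  have f: "?f (psc a v + psc b (T i (T j v))) = psc a v' + psc b (T' i (T' j v'))" for a b
    by (rule plane_map) (rule indep[OF v(3,1)])
  have g: "?g (psc a v' + psc b (T' i (T' j v'))) = psc a v + psc b (T i (T j v))" for a b
    by (rule plane_map) (rule V'.indep[OF v'(3,1)])
  have V0: "\<exists>a b. x = psc a v + psc b (T i (T j v))" if "x \<in> V 0" for x
    using that unfolding v(2) by (auto simp: plane_def)
  have V'0: "\<exists>a b. x = psc a v' + psc b (T' i (T' j v'))" if "x \<in> V' 0" for x
    using that unfolding v'(2) by (auto simp: plane_def)
  have z: "?f (T i (T j x)) = T' i (T' j (?f x))" if x: "x \<in> V 0" for x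
  proof -
    obtain a b where ab: "x = psc a v + psc b (T i (T j v))"
      using V0[OF x] by blast
    have 1: "T i (T j x) = psc (- (b * d j)) v + psc a (T i (T j v))"
      by (simp add: ab ops[OF v(3)] mult.commute)
    have 2: "T' i (T' j (?f x)) = psc (- (b * d j)) v' + psc a (T' i (T' j v'))"
      unfolding ab f by (simp add: V'.ops[OF v'(3)] mult.commute)
    show ?thesis
      unfolding 2 unfolding 1 f ..
  qed
  have fV: "?f x \<in> V' 0" if "x \<in> V 0" for x
    using V0[OF that] f v'(2) by auto
  show ?thesis
  proof (rule graded_iso_from_even[OF V'.clmod_axioms, where i = i and p = 0 and f = ?f])
    show "bij_betw ?f (V 0) (V' 0)"
    proof (rule bij_betw_byWitness[where f' = ?g])
      show "\<forall>a\<in>V 0. ?g (?f a) = a"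
        using V0 f g by metis
      show "\<forall>a\<in>V' 0. ?f (?g a) = a"
        using V'0 f g by metis
      show "?f ` V 0 \<subseteq> V' 0"
        using fV by blast
      show "?g ` V' 0 \<subseteq> V 0"
        using V'0 g v(2) by fastforce
    qed
    fix x assume x: "x \<in> V 0"
    obtain a b where ab: "x = psc a v + psc b (T i (T j v))"
      using V0[OF x] by blast
    show "?f (psc c x) = psc c (?f x)" for c
      using f[of "c * a" "c * b"] f[of a b] by (simp add: ab pm.scale_right_distrib)
    show "?f (T i (T k x)) = T' i (T' k (?f x))" if "k \<in> N" for k
    proof (cases "k = i")
      case True
      then show ?thesis
        using ops(1)[OF x] V'.ops(1)[OF fV[OF x]] by simp
    next
      case False
      then show ?thesis
        using that N(1) z[OF x] by auto
    qed
    fix y assume "y \<in> V 0"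
    then obtain a' b' where a'b': "y = psc a' v + psc b' (T i (T j v))"
      using V0 by blast
    show "?f (x + y) = ?f x + ?f y"
      using f[of "a + a'" "b + b'"] f[of a b] f[of a' b'] by (simp add: ab a'b' pm.scale_left_distrib algebra_simps)
  qed (use N di in simp_all)
qed

lemma two_gen_dim:
  assumes V: "graded_simple N T V"
  shows "dim_is (V p) 2"
proof -
  obtain v where v: "v \<noteq> 0" "V p = plane v (T i (T j v))" "v \<in> V p"
    using two_gen_eq[OF V] .
  show ?thesis
    unfolding v(2) by (rule dim_is_plane) (rule indep[OF v(3,1)])
qed

end

section \<open>Simple modules over a field with universal binary forms\<close>

lemma not_split_single: "\<not> split_form {i} d"
  by (simp add: split_form_def)

lemma not_split_pair: "i \<noteq> j \<Longrightarrow> d i = 1 \<Longrightarrow> \<nexists>c. d j = c\<^sup>2 \<Longrightarrow> \<not> split_form {i, j} d"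
  by (simp add: split_form_def)

lemma split_empty: "split_form {} d"
  by (simp add: split_form_def exI[of _ 1])

context
  fixes e :: "'k::field"
  assumes e: "e * e = - 1"
    and binary: "\<forall>a b :: 'k. a \<noteq> 0 \<longrightarrow> b \<noteq> 0 \<longrightarrow> (\<exists>x y. x\<^sup>2 * a + y\<^sup>2 * b = 1)"
begin

lemma clmod_stripI:
  assumes "clmod N d T V" "a \<in> N" "b \<in> N" "a \<noteq> b" "d a = 1" "d b = 1"
  shows "clmod_strip N d T V a b e"
  using assms e by (simp add: clmod_strip_def clmod_strip_axioms_def)

lemma clmod_pairI:
  assumes "clmod {i, j} d T V" "i \<noteq> j" "d i = 1" "\<nexists>c. d j = c\<^sup>2"
  shows "clmod_pair {i, j} d T V i j e"
  using assms e by (simp add: clmod_pair_def clmod_pair_axioms_def)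

text \<open>In each terminal case every nonzero homogeneous vector lies in a simple subfamily,
  namely the one it generates.\<close>

theorem clmod_spanned_by_simples:
  fixes d :: "nat \<Rightarrow> 'k"
  assumes "finite N" "\<forall>i\<in>N. d i \<noteq> 0" "clmod N d T V"
  shows "spanned_by_simples N T V"
  using assms(1,2) binary assms(3)
proof (induction N d arbitrary: T V rule: clifford_induct)
  case (empty d)
  interpret clmod "{}" d T V by (rule empty)
  show ?case
  proof (rule spanned_by_simplesI)
    fix p v assume "v \<in> V p" "v \<noteq> 0"
    then show "\<exists>U. graded_simple {} T U \<and> U \<le> V \<and> v \<in> U p"
      using no_gen_simple no_gen_le[OF sub] no_gen_mem by (intro exI[of _ "no_gen p v"]) auto
  qed
next
  case (single i d)
  interpret clmod "{i}" d T V by (rule single)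
  show ?case
  proof (rule spanned_by_simplesI)
    fix p v assume "v \<in> V p" "v \<noteq> 0"
    then show "\<exists>U. graded_simple {i} T U \<and> U \<le> V \<and> v \<in> U p"
      using one_gen_simple[OF refl single(1)] by (intro exI[of _ "one_gen i p v"]) auto
  qed
next
  case (pair i j d)
  interpret clmod_pair "{i, j}" d T V i j e by (rule clmod_pairI) (use pair in auto)
  show ?case
  proof (rule spanned_by_simplesI)
    fix p v assume "v \<in> V p" "v \<noteq> 0"
    then show "\<exists>U. graded_simple {i, j} T U \<and> U \<le> V \<and> v \<in> U p"
      using two_gen_simple by (intro exI[of _ "two_gen p v"]) auto
  qed
next
  case (subst N d a b x y z w)
  have "spanned_by_simples N (subst_ops a b x y z w T) V"
    using clmod.clmod_subst[OF subst(8) subst(2-5)] by (rule subst(7))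
  then show ?case
    by (simp add: spanned_by_simples_def graded_simple_subst[OF subst(2-4,6)])
next
  case (strip N d a b)
  interpret clmod_strip N d T V a b e by (rule clmod_stripI) (use strip in auto)
  show ?case
    by (rule spanned_by_simples_strip) (rule strip(7)[OF clmod_plus])
qed

text \<open>The alternative with \<open>shift\<close> arises at a single point, the form without
  generators, where the two lines may sit in different parities. The other terminal forms always
  give an isomorphism to \<open>V'\<close> itself. The alternative travels back since
  \<open>plus\<close> commutes with \<open>shift\<close> and \<open>split_form\<close> is
  invariant.\<close>

theorem clmod_simple_iso:
  fixes d :: "nat \<Rightarrow> 'k"
  assumes "finite N" "\<forall>i\<in>N. d i \<noteq> 0" "clmod N d T V" "clmod N d T' V'"
    "graded_simple N T V" "graded_simple N T' V'"
  shows "graded_iso N T V T' V' \<or> split_form N d \<and> graded_iso N T V T' (shift V')"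
  using assms(1,2) binary assms(3-)
proof (induction N d arbitrary: T V T' V' rule: clifford_induct)
  case (empty d)
  obtain p v where v: "v \<noteq> 0" "V = no_gen p v"
    using no_gen_eq[OF empty(3)] .
  obtain p' v' where v': "v' \<noteq> 0" "V' = no_gen p' v'"
    using no_gen_eq[OF empty(4)] .
  have "V' = no_gen p v' \<or> shift V' = no_gen p v'"
    unfolding v'(2) shift_no_gen by (cases p; cases p') auto
  then show ?case
    using no_gen_iso[OF v(1) v'(1)] v(2) split_empty by metis
next
  case (single i d)
  then show ?case
    using clmod.one_gen_iso[OF single(2) refl single(1) single(4,3,5)] by blast
next
  case (pair i j d)
  then show ?case
    using clmod_pair.two_gen_iso[OF clmod_pairI[OF pair(4)] _ clmod_pairI[OF pair(5)]] by blast
next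
  case (subst N d a b x y z w)
  have st: "graded_stable N T V"
    using subst(10) by (simp add: graded_simple_def)
  note s = graded_simple_subst[OF subst(2-4,6)] graded_iso_subst[OF st subst(2-4,6)]
    split_form_subst[OF subst(1-6)]
  show ?case
    using subst(7)[OF clmod.clmod_subst[OF subst(8) subst(2-5)] clmod.clmod_subst[OF subst(9) subst(2-5)]] subst(10,11)
    unfolding s by blast
next
  case (strip N d a b)
  interpret clmod_strip N d T V a b e by (rule clmod_stripI) (use strip in auto)
  interpret V': clmod_strip N d T' V' a b e by (rule clmod_stripI) (use strip in auto)
  have sh: "clmod_strip N d T' (shift V') a b e"
    by (rule clmod_stripI[OF V'.clmod_shift]) (use strip in auto)
  have "graded_iso (N - {a, b}) T (plus V) T' (V'.plus V') \<or>
    split_form (N - {a, b}) d \<and> graded_iso (N - {a, b}) T (plus V) T' (V'.plus (shift V'))"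
    unfolding V'.plus_shift
    by (rule strip(7)[OF clmod_plus V'.clmod_plus simple_plus[OF strip(10)] V'.simple_plus[OF strip(11)]])
  then show ?case
    using graded_iso_strip[OF V'.clmod_strip_axioms] graded_iso_strip[OF sh] split_form_strip[OF strip(1-6)] by blast
qed

text \<open>Invariance of \<open>split_form\<close> excludes the terminal forms with one or two
  generators, so a split form ends in a single line, where the parities can be compared.\<close>

theorem clmod_simple_not_iso_shift:
  fixes d :: "nat \<Rightarrow> 'k"
  assumes "finite N" "\<forall>i\<in>N. d i \<noteq> 0" "clmod N d T V" "graded_simple N T V" "split_form N d"
  shows "\<not> graded_iso N T V T (shift V)"
  using assms(1,2) binary assms(3-)
proof (induction N d arbitrary: T V rule: clifford_induct)
  case (empty d)
  then show ?case
    using no_gen_eq no_gen_not_iso_shift by metis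
next
  case (subst N d a b x y z w)
  have st: "graded_stable N T V"
    using subst(9) by (simp add: graded_simple_def)
  note s = graded_simple_subst[OF subst(2-4,6)] graded_iso_subst[OF st subst(2-4,6)]
    split_form_subst[OF subst(1-6)]
  show ?case
    using subst(7)[OF clmod.clmod_subst[OF subst(8) subst(2-5)]] subst(9,10)
    unfolding s by blast
next
  case (strip N d a b)
  interpret clmod_strip N d T V a b e by (rule clmod_stripI) (use strip in auto)
  have sh: "clmod_strip N d T (shift V) a b e"
    by (rule clmod_stripI[OF clmod_shift]) (use strip in auto)
  show ?case
    using strip(7)[OF clmod_plus simple_plus[OF strip(9)]] graded_iso_plus[OF sh] split_form_strip[OF strip(1-6)] strip(10)
    unfolding plus_shift by blast
qed (auto simp: not_split_single not_split_pair)

text \<open>\<open>m\<close> depends on the parity because a line without generators has dimensions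
  1|0 or 0|1. Undoing a splitting puts the total into each parity, so the total doubles. The
  terminal totals 1, 2 and 4 account for the extra exponent of the nonsplit forms.\<close>

theorem clmod_simple_dim:
  fixes d :: "nat \<Rightarrow> 'k"
  assumes "finite N" "\<forall>i\<in>N. d i \<noteq> 0" "clmod N d T V" "graded_simple N T V"
  shows "\<exists>m. (\<forall>p. dim_is (V p) (m p)) \<and> (N \<noteq> {} \<longrightarrow> m 0 = m 1) \<and>
    m 0 + m 1 = 2 ^ (card N div 2 + (if split_form N d then 0 else 1))"
  using assms(1,2) binary assms(3-)
proof (induction N d arbitrary: T V rule: clifford_induct)
  case (empty d)
  obtain p v where v: "v \<noteq> 0" "V = no_gen p v"
    using no_gen_eq[OF empty(2)] .
  show ?case
  proof (intro exI[of _ "\<lambda>q. if q = p then 1 else 0"] conjI allI)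
    fix q show "dim_is (V q) (if q = p then 1 else 0)"
      using dim_is_line[OF v(1)] by (simp add: v(2) no_gen_def dim_is_zero)
  qed (cases p; simp add: split_empty)+
next
  case (single i d)
  then show ?case
    using clmod.one_gen_dim[OF single(2) refl single(1) single(3)] 
    by (intro exI[of _ "\<lambda>_. 1"]) (simp add: not_split_single)
next
  case (pair i j d)
  then show ?case
    using clmod_pair.two_gen_dim[OF clmod_pairI[OF pair(4)]]
    by (intro exI[of _ "\<lambda>_. 2"]) (simp add: not_split_pair)
next
  case (subst N d a b x y z w)
  show ?case
    using subst(7)[OF clmod.clmod_subst[OF subst(8) subst(2-5)]] subst(9)
    unfolding graded_simple_subst[OF subst(2-4,6)] split_form_subst[OF subst(1-6)] by blast
next
  case (strip N d a b)
  interpret clmod_strip N d T V a b e by (rule clmod_stripI) (use strip in auto)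
  obtain m where m: "\<And>p. dim_is (plus V p) (m p)"
    and s: "m 0 + m 1 = 2 ^ (card (N - {a, b}) div 2 + (if split_form N d then 0 else 1))"
    using strip(7)[OF clmod_plus simple_plus[OF strip(9)]] split_form_strip[OF strip(1-6)] by auto
  have "card N = card (N - {a, b}) + 2"
    using strip(1-4) card_Diff_subset[of "{a, b}" N] card_mono[of N "{a, b}"] by simp
  then show ?case
    using dim_is_strip[OF m] s by (intro exI[of _ "\<lambda>_. m 0 + m 1"]) simp
qed

end

section \<open>Generators of square zero\<close>

text \<open>The image of \<open>T i\<close> is stable, because the other generators anticommute with
  it, so it is zero or everything. If it were everything, every vector would be in the image of
  \<open>T i\<close> applied twice, which is zero.\<close>

lemma (in clmod) graded_simple_zero_gen:
  assumes V: "graded_simple N T V" and i: "i \<in> N" "d i = 0" and x: "x \<in> V p"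
  shows "T i x = 0"
proof -
  define W where "W q = T i ` V (q + 1)" for q
  have st: "graded_stable N T W"
    unfolding graded_stable_def
  proof (intro conjI allI ballI)
    fix q show "pm.subspace (W q)"
      unfolding W_def by (rule module_hom.subspace_image[OF T_hom sub])
    fix j x assume j: "j \<in> N" "x \<in> W q"
    then obtain y where y: "y \<in> V (q + 1)" "x = T i y"
      by (auto simp: W_def)
    have "T j x = T i (if j = i then 0 else - T j y)"
      using y j(1) i T_T[OF i(1) y(1)] T_anti[OF j(1) i(1) _ y(1)] by auto
    moreover have "(if j = i then 0 else - T j y) \<in> V (q + 1 + 1)"
      using T_odd[OF j(1) y(1)] V_closed by auto
    ultimately show "T j x \<in> W (q + 1)"
      unfolding W_def by (metis imageI)
  qed
  have le: "W \<le> V"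
    using T_odd[OF i(1), of _ "_ + 1"] by (auto simp: W_def le_fun_def)
  have "(\<forall>p. W p = {0}) \<or> W = V"
    using V st le by (simp add: graded_simple_def)
  moreover have "W \<noteq> V"
  proof
    assume "W = V"
    have "x = 0" if "x \<in> V q" for x q
    proof -
      have V_W: "V q' = T i ` V (q' + 1)" for q'
        using fun_cong[OF \<open>W = V\<close>, of q'] by (simp add: W_def)
      have "x \<in> T i ` V (q + 1)"
        unfolding V_W[of q, symmetric] by (rule that)
      then obtain y where y: "y \<in> V (q + 1)" "x = T i y"
        by blast
      have "y \<in> T i ` V (q + 1 + 1)"
        unfolding V_W[of "q + 1", symmetric] by (rule y(1))
      then obtain u where u: "u \<in> V q" "y = T i u"
        unfolding bit_add_one_one by blast
      show ?thesis
        unfolding y(2) u(2) T_T[OF i(1) u(1)] i(2) by simp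
    qed
    then show False
      using graded_simple_nonzero[OF V] by blast
  qed
  ultimately have "W (p + 1) = {0}"
    by blast
  then show ?thesis
    using x unfolding W_def by auto
qed

lemma graded_stable_zero_gens:
  assumes "N' \<subseteq> N" "\<And>i x p. i \<in> N - N' \<Longrightarrow> x \<in> V p \<Longrightarrow> T i x = 0" "U \<le> V"
  shows "graded_stable N T U \<longleftrightarrow> graded_stable N' T U"
  using assms unfolding graded_stable_def le_fun_def by (metis DiffI pm.subspace_0 subsetD)

text \<open>Stability under an operator that vanishes on \<open>V\<close> is automatic for
  subfamilies of \<open>V\<close>.\<close>

lemma graded_simple_zero_gens:
  assumes "N' \<subseteq> N" "\<And>i x p. i \<in> N - N' \<Longrightarrow> x \<in> V p \<Longrightarrow> T i x = 0"
  shows "graded_simple N T V \<longleftrightarrow> graded_simple N' T V"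
proof -
  have "(graded_stable N T U \<and> U \<le> V) = (graded_stable N' T U \<and> U \<le> V)" for U
    using graded_stable_zero_gens[of N' N V T U, OF assms] by (cases "U \<le> V") auto
  moreover have "graded_stable N T V = graded_stable N' T V"
    by (rule graded_stable_zero_gens[OF assms order.refl])
  ultimately show ?thesis
    by (simp only: graded_simple_def)
qed

lemma graded_iso_zero_gens:
  assumes "N' \<subseteq> N" "\<And>i x p. i \<in> N - N' \<Longrightarrow> x \<in> V p \<Longrightarrow> T i x = 0"
    "\<And>i x p. i \<in> N - N' \<Longrightarrow> x \<in> V' p \<Longrightarrow> T' i x = 0" "\<And>p. pm.subspace (V p)"
    and iso: "graded_iso N' T V T' V'"
  shows "graded_iso N T V T' V'"
proof -
  obtain \<phi> where \<phi>: "\<And>p. bij_betw (\<phi> p) (V p) (V' p)"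
    "\<And>p x y. x \<in> V p \<Longrightarrow> y \<in> V p \<Longrightarrow> \<phi> p (x + y) = \<phi> p x + \<phi> p y"
    "\<And>p c x. x \<in> V p \<Longrightarrow> \<phi> p (psc c x) = psc c (\<phi> p x)"
    "\<And>p i x. i \<in> N' \<Longrightarrow> x \<in> V p \<Longrightarrow> \<phi> (p + 1) (T i x) = T' i (\<phi> p x)"
    using graded_isoE[OF iso] by blast
  have 0: "\<phi> p 0 = 0" for p
    using \<phi>(3)[of 0 p 0] assms(4) by (simp add: pm.subspace_0)
  have "\<phi> (p + 1) (T i x) = T' i (\<phi> p x)" if "i \<in> N" "x \<in> V p" for i x p
    using that \<phi>(4) assms(2)[of i x p] assms(3)[of i "\<phi> p x" p] 0 bij_betwE[OF \<phi>(1), of p] by (cases "i \<in> N'") auto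
  then show ?thesis
    using \<phi>(1-3) by (intro graded_isoI[where \<phi> = \<phi>]) (auto simp: bij_betw_def)
qed

section \<open>Complete reducibility\<close>

text \<open>Independence is tested in each parity separately, which fits families of subspaces;
  relations of mixed parity are treated only when vectors of the total space are decomposed.\<close>

definition independent_family :: "(bit \<Rightarrow> ('m \<Rightarrow>\<^sub>0 'k::field) set) set \<Rightarrow> bool" where
  "independent_family \<G> \<longleftrightarrow>
     (\<forall>p F f. finite F \<and> F \<subseteq> \<G> \<and> (\<forall>U\<in>F. f U \<in> U p) \<and> (\<Sum>U\<in>F. f U) = 0 \<longrightarrow> (\<forall>U\<in>F. f U = 0))"

lemma independent_family_chain:
  assumes "subset.chain A C" "C \<noteq> {}" "\<And>\<G>. \<G> \<in> C \<Longrightarrow> independent_family \<G>"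
  shows "independent_family (\<Union>C)"
  unfolding independent_family_def
proof (intro allI impI)
  fix p F and f :: "(bit \<Rightarrow> ('a \<Rightarrow>\<^sub>0 'b) set) \<Rightarrow> _"
  assume *: "finite F \<and> F \<subseteq> \<Union>C \<and> (\<forall>U\<in>F. f U \<in> U p) \<and> (\<Sum>U\<in>F. f U) = 0"
  then obtain \<G> where \<G>: "\<G> \<in> C" "F \<subseteq> \<G>"
    using finite_subset_Union_chain[of F C A] assms(1,2) by blast
  then show "\<forall>U\<in>F. f U = 0"
    using assms(3)[OF \<G>(1)] * unfolding independent_family_def by blast
qed

text \<open>Zorn's lemma applies because a dependence relation involves finitely many members and
  thus already occurs in one member of a chain.\<close>

lemma maximal_independent_family:
  "\<exists>\<G>. \<G> \<subseteq> \<A> \<and> independent_family \<G> \<and> (\<forall>U\<in>\<A>. independent_family (insert U \<G>) \<longrightarrow> U \<in> \<G>)"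
proof -
  let ?A = "{\<G>. \<G> \<subseteq> \<A> \<and> independent_family \<G>}"
  have "\<exists>M\<in>?A. \<forall>\<G>\<in>?A. M \<subseteq> \<G> \<longrightarrow> \<G> = M"
  proof (rule subset_Zorn)
    fix C assume C: "subset.chain ?A C"
    show "\<exists>U\<in>?A. \<forall>\<G>\<in>C. \<G> \<subseteq> U"
    proof (cases "C = {}")
      case True
      have "{} \<in> ?A"
        by (simp add: independent_family_def)
      with True show ?thesis by blast
    next
      case False
      have "\<And>\<G>. \<G> \<in> C \<Longrightarrow> \<G> \<in> ?A"
        using C by (auto simp: subset.chain_def)
      then have "\<Union>C \<in> ?A"
        using independent_family_chain[OF C False] by blast
      then show ?thesis
        by blast
    qed
  qed
  then obtain M where "M \<in> ?A" and max: "\<forall>\<G>\<in>?A. M \<subseteq> \<G> \<longrightarrow> \<G> = M"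
    by (rule bexE)
  then have M: "M \<subseteq> \<A>" "independent_family M"
    by simp_all
  moreover have "U \<in> M" if "U \<in> \<A>" "independent_family (insert U M)" for U
  proof -
    have "insert U M = M"
      using that M(1) max by simp blast
    then show ?thesis
      by blast
  qed
  ultimately show ?thesis
    by (intro exI[of _ M] conjI ballI impI)
qed

text \<open>A simple \<open>U\<close> outside a maximal independent family is involved in a relation
  with its members. It therefore meets their span nontrivially and, being simple, is contained in
  it.\<close>

lemma (in clmod) simple_decomposition:
  assumes span: "spanned_by_simples N T V"
  shows "\<exists>\<G>. (\<forall>U\<in>\<G>. graded_simple N T U \<and> U \<le> V) \<and> independent_family \<G> \<and>
    (\<forall>p. V p \<subseteq> pm.span (\<Union>U\<in>\<G>. U p))"
proof -
  obtain \<G> where max: "\<G> \<subseteq> {U. graded_simple N T U \<and> U \<le> V} \<and> independent_family \<G> \<and>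
      (\<forall>U\<in>{U. graded_simple N T U \<and> U \<le> V}. independent_family (insert U \<G>) \<longrightarrow> U \<in> \<G>)"
    using maximal_independent_family by (rule exE)
  then have \<G>: "\<G> \<subseteq> {U. graded_simple N T U \<and> U \<le> V}" "independent_family \<G>"
    by simp_all
  define D where "D p = pm.span (\<Union>U\<in>\<G>. U p)" for p
  have stD: "graded_stable N T D"
    unfolding graded_stable_def
  proof (intro conjI allI ballI)
    fix i p x assume i: "i \<in> N" and x: "x \<in> D p"
    have "T i ` (\<Union>U\<in>\<G>. U p) \<subseteq> (\<Union>U\<in>\<G>. U (p + 1))"
      using \<G>(1) i by (fastforce simp: graded_simple_def graded_stable_def)
    then have "T i ` D p \<subseteq> D (p + 1)"
      unfolding D_def module_hom.span_image[OF T_hom, symmetric] by (rule pm.span_mono)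
    then show "T i x \<in> D (p + 1)"
      using x by blast
  qed (simp add: D_def)
  have le: "U \<le> D" if U: "graded_simple N T U" "U \<le> V" for U
  proof (cases "U \<in> \<G>")
    case True
    then show ?thesis
      unfolding D_def le_fun_def by (auto intro!: pm.span_base)
  next
    case False
    then have "\<not> independent_family (insert U \<G>)"
      using max[THEN conjunct2, THEN conjunct2, THEN bspec, of U] U by auto
    then obtain p F f where F: "finite F" "F \<subseteq> insert U \<G>" "\<And>W. W \<in> F \<Longrightarrow> f W \<in> W p" "(\<Sum>W\<in>F. f W) = 0"
      and nz: "\<exists>W\<in>F. f W \<noteq> 0"
      unfolding independent_family_def by blast
    \<comment> \<open>If \<open>U\<close> did not contribute, the relation would be one inside the
      independent family \<open>\<G>\<close>.\<close>
    have "U \<in> F \<and> f U \<noteq> 0"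
    proof (rule ccontr)
      assume not: "\<not> (U \<in> F \<and> f U \<noteq> 0)"
      then have "(\<Sum>W\<in>F - {U}. f W) = 0"
        using F(1,4) by (cases "U \<in> F") (simp_all add: sum.remove[of F U])
      moreover have "finite (F - {U})" "F - {U} \<subseteq> \<G>" "\<forall>W\<in>F - {U}. f W \<in> W p"
        using F by auto
      ultimately have "\<forall>W\<in>F - {U}. f W = 0"
        using \<G>(2) unfolding independent_family_def by blast
      then show False
        using nz not by blast
    qed
    then have UF: "U \<in> F" "f U \<noteq> 0"
      by auto
    then have "f U + (\<Sum>W\<in>F - {U}. f W) = 0"
      using F(4) sum.remove[OF F(1), of U f] by simp
    then have "f U = - (\<Sum>W\<in>F - {U}. f W)"
      by (simp add: eq_neg_iff_add_eq_0)
    also have "\<dots> \<in> D p"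
      unfolding D_def
    proof (intro pm.span_neg pm.span_sum pm.span_base)
      fix W assume "W \<in> F - {U}"
      then show "f W \<in> (\<Union>U\<in>\<G>. U p)"
        using F(2,3) by blast
    qed
    finally have fU: "f U \<in> U p \<inter> D p"
      using F(3)[OF UF(1)] by simp
    define I where "I q = U q \<inter> D q" for q
    have "graded_stable N T I"
      using U(1) stD unfolding graded_simple_def graded_stable_def I_def by (auto intro: pm.subspace_inter)
    then have "I = U"
      using graded_simple_le_eq[OF U(1), of I "f U" p] fU UF(2) by (auto simp: I_def le_fun_def)
    then show ?thesis
      by (auto simp: I_def le_fun_def fun_eq_iff)
  qed
  have "V p \<subseteq> pm.span (\<Union>U\<in>\<G>. U p)" for p
  proof -
    have "\<Union>{U p | U. graded_simple N T U \<and> U \<le> V} \<subseteq> D p"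
      using le by (auto simp: le_fun_def)
    then have "pm.span (\<Union>{U p | U. graded_simple N T U \<and> U \<le> V}) \<subseteq> D p"
      using stD unfolding graded_stable_def by (intro pm.span_minimal) auto
    then show ?thesis
      using span unfolding spanned_by_simples_def D_def by blast
  qed
  moreover have "\<forall>U\<in>\<G>. graded_simple N T U \<and> U \<le> V"
    using \<G>(1) by auto
  ultimately show ?thesis
    using \<G>(2) by (intro exI[of _ \<G>] conjI allI)
qed

lemma span_Union_sum:
  assumes v: "v \<in> pm.span (\<Union>U\<in>\<G>. U p)" and sub: "\<And>U. U \<in> \<G> \<Longrightarrow> pm.subspace (U p)"
  shows "\<exists>F f. finite F \<and> F \<subseteq> \<G> \<and> (\<forall>U\<in>\<G>. f U \<in> U p) \<and> (\<forall>U. U \<notin> F \<longrightarrow> f U = 0) \<and> v = (\<Sum>U\<in>F. f U)"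
  using v
proof (induction v rule: pm.span_induct_alt)
  case base
  show ?case
    using sub by (intro exI[of _ "{}"] exI[of _ "\<lambda>_. 0"]) (auto simp: pm.subspace_0)
next
  case (step c x y)
  then obtain F f where F: "finite F" "F \<subseteq> \<G>" "\<forall>U\<in>\<G>. f U \<in> U p" "\<forall>U. U \<notin> F \<longrightarrow> f U = 0" "y = (\<Sum>U\<in>F. f U)"
    by blast
  obtain W where W: "W \<in> \<G>" "x \<in> W p"
    using step by blast
  let ?f = "f(W := psc c x + f W)"
  have "(\<Sum>U\<in>insert W F. ?f U) = psc c x + (\<Sum>U\<in>insert W F. f U)"
    using F(1) by (simp add: sum.insert_remove add.assoc) 
  also have "(\<Sum>U\<in>insert W F. f U) = y"
    unfolding F(5) using F(1,4) by (intro sum.mono_neutral_right) auto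
  finally have "psc c x + y = (\<Sum>U\<in>insert W F. ?f U)" ..
  moreover have "psc c x + f W \<in> W p"
    using sub[OF W(1)] W F(3) by (simp add: pm.subspace_add pm.subspace_scale)
  ultimately show ?case
    using F W by (intro exI[of _ "insert W F"] exI[of _ ?f]) auto
qed

definition total_space :: "(bit \<Rightarrow> ('m \<Rightarrow>\<^sub>0 'k::field) set) \<Rightarrow> ('m \<Rightarrow>\<^sub>0 'k) set" where
  "total_space U = {x + y | x y. x \<in> U 0 \<and> y \<in> U 1}"

text \<open>Existence adds decompositions of the even and the odd part. For uniqueness the
  difference of two decompositions is separated by parity, which \<open>inter\<close> permits, and
  independence is applied in each parity.\<close>

lemma (in clmod) unique_decomposition:
  assumes inter: "V 0 \<inter> V 1 = {0}" and \<G>: "\<And>U. U \<in> \<G> \<Longrightarrow> graded_simple N T U \<and> U \<le> V"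
    and indep: "independent_family \<G>" and span: "\<And>p. V p \<subseteq> pm.span (\<Union>U\<in>\<G>. U p)"
    and v: "v \<in> total_space V"
  shows "\<exists>!f. f \<in> (\<Pi>\<^sub>E U\<in>\<G>. total_space U) \<and> finite {U\<in>\<G>. f U \<noteq> 0} \<and> v = (\<Sum>U\<in>{U\<in>\<G>. f U \<noteq> 0}. f U)"
proof -
  have sub: "pm.subspace (U p)" and le: "U p \<subseteq> V p" if "U \<in> \<G>" for U p
    using \<G>[OF that] by (auto simp: graded_simple_def graded_stable_def le_fun_def)
  obtain v0 v1 where v01: "v0 \<in> V 0" "v1 \<in> V 1" "v = v0 + v1"
    using v by (auto simp: total_space_def)
  obtain F0 f0 where f0: "finite F0" "F0 \<subseteq> \<G>" "\<forall>U\<in>\<G>. f0 U \<in> U 0" "\<forall>U. U \<notin> F0 \<longrightarrow> f0 U = 0" "v0 = (\<Sum>U\<in>F0. f0 U)"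
    using span_Union_sum[of v0 0 \<G>] span[of 0] v01(1) sub by blast
  obtain F1 f1 where f1: "finite F1" "F1 \<subseteq> \<G>" "\<forall>U\<in>\<G>. f1 U \<in> U 1" "\<forall>U. U \<notin> F1 \<longrightarrow> f1 U = 0" "v1 = (\<Sum>U\<in>F1. f1 U)"
    using span_Union_sum[of v1 1 \<G>] span[of 1] v01(2) sub by blast
  define g where "g = (\<lambda>U. if U \<in> \<G> then f0 U + f1 U else undefined)"
  have "f0 U + f1 U \<in> total_space U" if "U \<in> \<G>" for U
    using bspec[OF f0(3) that] bspec[OF f1(3) that] unfolding total_space_def by blast
  then have g1: "g \<in> (\<Pi>\<^sub>E U\<in>\<G>. total_space U)"
    by (simp add: g_def PiE_iff extensional_def)
  have supp: "{U\<in>\<G>. g U \<noteq> 0} \<subseteq> F0 \<union> F1"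
    using f0(4) f1(4) by (auto simp: g_def)
  then have g2: "finite {U\<in>\<G>. g U \<noteq> 0}"
    using f0(1) f1(1) finite_subset by blast
  have "(\<Sum>U\<in>{U\<in>\<G>. g U \<noteq> 0}. g U) = (\<Sum>U\<in>F0 \<union> F1. f0 U + f1 U)"
    using supp f0(1,2) f1(1,2) by (intro sum.mono_neutral_cong_left) (auto simp: g_def)
  also have "\<dots> = (\<Sum>U\<in>F0 \<union> F1. f0 U) + (\<Sum>U\<in>F0 \<union> F1. f1 U)"
    by (rule sum.distrib)
  also have "(\<Sum>U\<in>F0 \<union> F1. f0 U) = v0"
    unfolding f0(5) using f0(1,4) f1(1) by (intro sum.mono_neutral_right) auto
  also have "(\<Sum>U\<in>F0 \<union> F1. f1 U) = v1"
    unfolding f1(5) using f1(1,4) f0(1) by (intro sum.mono_neutral_right) auto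
  finally have g3: "v = (\<Sum>U\<in>{U\<in>\<G>. g U \<noteq> 0}. g U)"
    using v01(3) by simp
  have uniq: "f = f'" if f: "f \<in> (\<Pi>\<^sub>E U\<in>\<G>. total_space U)" "finite {U\<in>\<G>. f U \<noteq> 0}" "v = (\<Sum>U\<in>{U\<in>\<G>. f U \<noteq> 0}. f U)"
    and f': "f' \<in> (\<Pi>\<^sub>E U\<in>\<G>. total_space U)" "finite {U\<in>\<G>. f' U \<noteq> 0}" "v = (\<Sum>U\<in>{U\<in>\<G>. f' U \<noteq> 0}. f' U)" for f f'
  proof -
    define F where "F = {U\<in>\<G>. f U \<noteq> 0} \<union> {U\<in>\<G>. f' U \<noteq> 0}"
    have F: "finite F" "F \<subseteq> \<G>"
      using f(2) f'(2) by (auto simp: F_def)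
    have "v = (\<Sum>U\<in>F. f U)"
      unfolding f(3) using F(1) by (intro sum.mono_neutral_left) (auto simp: F_def)
    moreover have "v = (\<Sum>U\<in>F. f' U)"
      unfolding f'(3) using F(1) by (intro sum.mono_neutral_left) (auto simp: F_def)
    ultimately have diff: "(\<Sum>U\<in>F. f U - f' U) = 0"
      by (simp add: sum_subtractf)
    have "\<exists>x y. x \<in> U 0 \<and> y \<in> U 1 \<and> f U - f' U = x + y" if U: "U \<in> \<G>" for U
    proof -
      obtain x y x' y' where "x \<in> U 0" "y \<in> U 1" "f U = x + y" "x' \<in> U 0" "y' \<in> U 1" "f' U = x' + y'"
        using PiE_mem[OF f(1) U] PiE_mem[OF f'(1) U] by (auto simp: total_space_def)
      then show ?thesis
        using sub[OF U] by (intro exI[of _ "x - x'"] exI[of _ "y - y'"]) (simp add: pm.subspace_diff)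
    qed
    then obtain a b where ab: "\<And>U. U \<in> \<G> \<Longrightarrow> a U \<in> U 0 \<and> b U \<in> U 1 \<and> f U - f' U = a U + b U"
      by metis
    have "(\<Sum>U\<in>F. f U - f' U) = (\<Sum>U\<in>F. a U + b U)"
      using ab F(2) by (intro sum.cong) auto
    \<comment> \<open>An even sum equals an odd one, so both lie in \<open>V 0 \<inter> V 1\<close>
      and vanish.\<close>
    then have eq: "(\<Sum>U\<in>F. a U) = - (\<Sum>U\<in>F. b U)"
      using diff by (simp add: sum.distrib eq_neg_iff_add_eq_0)
    have "pm.subspace (V p)" for p
      using stable by (simp add: graded_stable_def)
    moreover have "a U \<in> V 0" "b U \<in> V 1" if "U \<in> F" for U
      using ab[of U] le[of U] F(2) that by auto
    ultimately have "(\<Sum>U\<in>F. a U) \<in> V 0" "(\<Sum>U\<in>F. b U) \<in> V 1"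
      by (simp_all add: pm.subspace_sum)
    then have "(\<Sum>U\<in>F. a U) \<in> V 0 \<inter> V 1"
      using V_closed(5) eq by auto
    then have "(\<Sum>U\<in>F. a U) = 0" "(\<Sum>U\<in>F. b U) = 0"
      using inter eq by auto
    moreover have "\<forall>U\<in>F. a U \<in> U 0" "\<forall>U\<in>F. b U \<in> U 1"
      using ab F(2) by auto
    ultimately have "\<forall>U\<in>F. a U = 0" "\<forall>U\<in>F. b U = 0"
      using indep F unfolding independent_family_def by blast+
    then have "f U = f' U" if "U \<in> F" for U
      using ab[of U] that F(2) by auto
    moreover have "f U = f' U" if "U \<in> \<G>" "U \<notin> F" for U
      using that by (auto simp: F_def)
    ultimately show ?thesis
      using PiE_ext[OF f(1) f'(1)] by blast
  qed
  show ?thesis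
    using g1 g2 g3 uniq by blast
qed

section \<open>Generators and relations\<close>

definition cl_class :: "nat set \<Rightarrow> (nat \<Rightarrow> 'k::field) \<Rightarrow> 'k free_elt \<Rightarrow> 'k free_elt set" where
  "cl_class N d f = cliff_ideal N d +>\<^bsub>free_algebra N\<^esub> f"

lemma clifford_sel:
  "carrier (clifford N d) = carrier (free_algebra N Quot cliff_ideal N d)"
  "monoid.mult (clifford N d) = monoid.mult (free_algebra N Quot cliff_ideal N d)"
  "monoid.one (clifford N d) = monoid.one (free_algebra N Quot cliff_ideal N d)"
  "ring.zero (clifford N d) = ring.zero (free_algebra N Quot cliff_ideal N d)"
  "ring.add (clifford N d) = ring.add (free_algebra N Quot cliff_ideal N d)"
  "Module.module.smult (clifford N d) c x = cl_class N d (free_const c) \<otimes>\<^bsub>free_algebra N Quot cliff_ideal N d\<^esub> x"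
  "homog (clifford N d) i = cl_class N d ` free_homog N i"
  by (simp_all add: clifford_def Let_def cl_class_def)

lemma free_const_carrier: "free_const c \<in> carrier (free_algebra N)"
  by (auto simp: free_const_def free_algebra_carrier zero_free_mon_def)

lemma free_gen_carrier: "i \<in> N \<Longrightarrow> free_gen i \<in> carrier (free_algebra N)"
  by (auto simp: free_gen_def free_algebra_carrier)

lemma free_const_simps:
  "free_const (c + d) = free_const c + free_const d" "free_const (c * d) = free_const c * free_const d"
  "free_const 1 = 1" "free_const 0 = 0"
  by (simp_all add: free_const_def Poly_Mapping.single_add Poly_Mapping.mult_single)

lemma free_carrier_closed:
  fixes f g :: "'k::field free_elt"
  assumes "f \<in> carrier (free_algebra N)" "g \<in> carrier (free_algebra N)"
  shows "f + g \<in> carrier (free_algebra N)" "f * g \<in> carrier (free_algebra N)" "f - g \<in> carrier (free_algebra N)"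
    "- f \<in> carrier (free_algebra N)"
proof -
  interpret F: ring "free_algebra N :: 'k free_elt ring" by (rule ring_free_algebra)
  show 1: "f + g \<in> carrier (free_algebra N)" "f * g \<in> carrier (free_algebra N)"
    using F.a_closed[OF assms] F.m_closed[OF assms] by simp_all
  have 2: "- h \<in> carrier (free_algebra N)" if "h \<in> carrier (free_algebra N)" for h :: "'k free_elt"
    using that by (auto simp: free_algebra_carrier)
  show "- f \<in> carrier (free_algebra N)"
    by (rule 2[OF assms(1)])
  show "f - g \<in> carrier (free_algebra N)"
    using F.a_closed[OF assms(1) 2[OF assms(2)]] by simp
qed

text \<open>Words are built up by multiplication with generators from the left only. This is the
  order in which a product acts on a module vector, so the induction step concerns one
  generator.\<close>

lemma free_elt_induct [consumes 1, case_names const gen_mult add]: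
  fixes f :: "'k::field free_elt"
  assumes f: "f \<in> carrier (free_algebra N)"
    and const: "\<And>c. P (free_const c)"
    and gen: "\<And>i f. i \<in> N \<Longrightarrow> f \<in> carrier (free_algebra N) \<Longrightarrow> P f \<Longrightarrow> P (free_gen i * f)"
    and add: "\<And>f g. f \<in> carrier (free_algebra N) \<Longrightarrow> g \<in> carrier (free_algebra N) \<Longrightarrow> P f \<Longrightarrow> P g \<Longrightarrow> P (f + g)"
  shows "P f"
proof -
  have single: "P (Poly_Mapping.single (Word xs) c)" if "set xs \<subseteq> N" for xs c
    using that
  proof (induction xs)
    case Nil
    then show ?case
      using const[of c] by (simp add: free_const_def zero_free_mon_def)
  next
    case (Cons i xs)
    have "free_gen i * Poly_Mapping.single (Word xs) c = Poly_Mapping.single (Word (i # xs)) c"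
      by (simp add: free_gen_def Poly_Mapping.mult_single plus_free_mon_def)
    moreover have "Poly_Mapping.single (Word xs) c \<in> carrier (free_algebra N)"
      using Cons.prems by (auto simp: free_algebra_carrier)
    ultimately show ?case
      using gen[of i "Poly_Mapping.single (Word xs) c"] Cons by auto
  qed
  from f show ?thesis
  proof (induction f rule: update_induct)
    case const
    then show ?case
      using assms(2)[of 0] by (simp add: free_const_simps)
  next
    case (update g w c)
    have eq: "Poly_Mapping.update w c g = Poly_Mapping.single w c + g"
      using update(1) by (intro poly_mapping_eqI)
         (auto simp: lookup_update lookup_add lookup_single in_keys_iff when_def)
    have "Poly_Mapping.keys (Poly_Mapping.update w c g) = insert w (Poly_Mapping.keys g)"
      using update(2) by (simp add: keys_update)
    then have w: "set (letters w) \<subseteq> N" and g: "g \<in> carrier (free_algebra N)"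
      using update.prems by (auto simp: free_algebra_carrier)
    have "P (Poly_Mapping.single w c)"
      using single[of "letters w" c] w by simp
    moreover have "Poly_Mapping.single w c \<in> carrier (free_algebra N)"
      using w by (auto simp: free_algebra_carrier)
    ultimately show ?case
      unfolding eq using update.IH g by (intro add) auto
  qed
qed

context
  fixes N :: "nat set" and d :: "nat \<Rightarrow> 'k::field"
begin

interpretation F: ring "free_algebra N :: 'k free_elt ring" by (rule ring_free_algebra)
interpretation I: ideal "cliff_ideal N d" "free_algebra N" by (rule ideal_cliff_ideal)
interpretation Q: ring "free_algebra N Quot cliff_ideal N d" by (rule I.quotient_is_ring)
interpretation phi: ring_hom_ring "free_algebra N" "free_algebra N Quot cliff_ideal N d" "cl_class N d"
  unfolding cl_class_def[abs_def] by (rule I.rcos_ring_hom_ring)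

lemma cl_class_closed: "f \<in> carrier (free_algebra N) \<Longrightarrow> cl_class N d f \<in> carrier (clifford N d)"
  by (simp add: clifford_sel)

lemma cl_class_add:
  "f \<in> carrier (free_algebra N) \<Longrightarrow> g \<in> carrier (free_algebra N) \<Longrightarrow>
   cl_class N d (f + g) = cl_class N d f \<oplus>\<^bsub>clifford N d\<^esub> cl_class N d g"
  using phi.hom_add[of f g] by (simp add: clifford_sel)

lemma cl_class_mult:
  "f \<in> carrier (free_algebra N) \<Longrightarrow> g \<in> carrier (free_algebra N) \<Longrightarrow>
   cl_class N d (f * g) = cl_class N d f \<otimes>\<^bsub>clifford N d\<^esub> cl_class N d g"
  using phi.hom_mult[of f g] by (simp add: clifford_sel)

lemma cl_class_one: "cl_class N d 1 = \<one>\<^bsub>clifford N d\<^esub>"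
  using phi.hom_one by (simp add: clifford_sel)

lemma cl_class_const: "c \<odot>\<^bsub>clifford N d\<^esub> \<one>\<^bsub>clifford N d\<^esub> = cl_class N d (free_const c)"
  using Q.r_one[OF phi.hom_closed[OF free_const_carrier]] by (simp add: clifford_sel)

lemma cl_class_surj: "x \<in> carrier (clifford N d) \<Longrightarrow> \<exists>f\<in>carrier (free_algebra N). x = cl_class N d f"
  by (auto simp: clifford_sel FactRing_def A_RCOSETS_def RCOSETS_def a_r_coset_def cl_class_def)

lemma cl_class_homog: "f \<in> free_homog N p \<Longrightarrow> cl_class N d f \<in> homog (clifford N d) p"
  by (simp add: clifford_sel)

lemma cl_class_eqI:
  assumes "f - g \<in> cliff_ideal N d" "f \<in> carrier (free_algebra N)" "g \<in> carrier (free_algebra N)"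
  shows "cl_class N d f = cl_class N d g"
proof -
  have "f = (f - g) + g"
    by simp
  then have "f \<in> cl_class N d g"
    using assms(1) unfolding cl_class_def a_r_coset_def r_coset_def by (auto intro!: bexI[of _ "f - g"])
  then show ?thesis
    using F.a_repr_independence[OF _ assms(3) I.a_subgroup] unfolding cl_class_def by simp
qed

lemma cl_class_eqD:
  assumes "cl_class N d f = cl_class N d g" "f \<in> carrier (free_algebra N)"
  shows "f - g \<in> cliff_ideal N d"
proof -
  have "f \<in> cl_class N d g"
    using I.a_rcos_self[OF assms(2)] assms(1) by (simp add: cl_class_def)
  then show ?thesis
    by (auto simp: cl_class_def a_r_coset_def r_coset_def)
qed

lemma clifford_relation:
  assumes "i \<in> N" "j \<in> N"
  shows "cl_class N d (free_gen i) \<otimes>\<^bsub>clifford N d\<^esub> cl_class N d (free_gen j)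
      \<oplus>\<^bsub>clifford N d\<^esub> cl_class N d (free_gen j) \<otimes>\<^bsub>clifford N d\<^esub> cl_class N d (free_gen i)
    = (if i = j then 2 * d i else 0) \<odot>\<^bsub>clifford N d\<^esub> \<one>\<^bsub>clifford N d\<^esub>"
proof -
  have "free_gen i * free_gen j + free_gen j * free_gen i - free_const (if i = j then 2 * d i else 0) \<in> cliff_rels N d"
    using assms by (auto simp: cliff_rels_def)
  then have "free_gen i * free_gen j + free_gen j * free_gen i - free_const (if i = j then 2 * d i else 0) \<in> cliff_ideal N d"
    using F.genideal_self[OF cliff_rels_carrier, of d] unfolding cliff_ideal_def by blast
  then have "cl_class N d (free_gen i * free_gen j + free_gen j * free_gen i)
      = cl_class N d (free_const (if i = j then 2 * d i else 0))"
    using assms by (intro cl_class_eqI free_carrier_closed free_gen_carrier free_const_carrier)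
  then show ?thesis
    using assms by (simp add: cl_class_const cl_class_add cl_class_mult free_carrier_closed free_gen_carrier)
qed

lemma clifford_gen_induct [consumes 1, case_names const gen_mult add]:
  assumes "x \<in> carrier (clifford N d)"
    and "\<And>c. P (c \<odot>\<^bsub>clifford N d\<^esub> \<one>\<^bsub>clifford N d\<^esub>)"
    and "\<And>i x. i \<in> N \<Longrightarrow> x \<in> carrier (clifford N d) \<Longrightarrow> P x \<Longrightarrow> P (cl_class N d (free_gen i) \<otimes>\<^bsub>clifford N d\<^esub> x)"
    and "\<And>x y. x \<in> carrier (clifford N d) \<Longrightarrow> y \<in> carrier (clifford N d) \<Longrightarrow> P x \<Longrightarrow> P y \<Longrightarrow> P (x \<oplus>\<^bsub>clifford N d\<^esub> y)"
  shows "P x"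
proof -
  obtain f where f: "f \<in> carrier (free_algebra N)" "x = cl_class N d f"
    using cl_class_surj[OF assms(1)] by blast
  have "P (cl_class N d f)"
    using f(1)
  proof (induction f rule: free_elt_induct[where N = N])
    case (gen_mult i f)
    then show ?case
      using assms(3)[of i "cl_class N d f"] by (simp add: cl_class_mult free_gen_carrier cl_class_closed)
  qed (simp_all add: assms(2,4) cl_class_add cl_class_closed flip: cl_class_const)
  then show ?thesis
    using f(2) by simp
qed

end

section \<open>Embedding a module into a space of finitely supported functions\<close>

text \<open>A vector space on a carrier set. It isolates the data from which the embedding into a
  full type is built, independently of algebra and grading.\<close>

locale scalar_group = abelian_group M for M (structure) +
  fixes s :: "'k::field \<Rightarrow> 'a \<Rightarrow> 'a"
  assumes s_closed [simp]: "v \<in> carrier M \<Longrightarrow> s c v \<in> carrier M"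
    and s_add_left: "v \<in> carrier M \<Longrightarrow> s (c + c') v = s c v \<oplus> s c' v"
    and s_add_right: "v \<in> carrier M \<Longrightarrow> w \<in> carrier M \<Longrightarrow> s c (v \<oplus> w) = s c v \<oplus> s c w"
    and s_mult: "v \<in> carrier M \<Longrightarrow> s (c * c') v = s c (s c' v)"
    and s_one: "v \<in> carrier M \<Longrightarrow> s 1 v = v"
begin

lemma s_zero_left [simp]: "v \<in> carrier M \<Longrightarrow> s 0 v = \<zero>"
  using s_add_left[of v 0 0] add.l_cancel_one'[of "s 0 v" "s 0 v"] by simp

lemma s_zero_right [simp]: "s c \<zero> = \<zero>"
  using s_add_right[of \<zero> \<zero> c] add.l_cancel_one'[of "s c \<zero>" "s c \<zero>"] by simp

lemma s_minus_one: "v \<in> carrier M \<Longrightarrow> s (- 1) v = \<ominus> v"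
  using s_add_left[of v "- 1" 1] by (intro minus_equality[symmetric]) (simp_all add: s_one)

lemma s_finsum:
  assumes "finite F" "f \<in> F \<rightarrow> carrier M"
  shows "s c (finsum M f F) = (\<Oplus>x\<in>F. s c (f x))"
  using assms
proof (induction F rule: finite_induct)
  case (insert x F)
  then have "f x \<in> carrier M" "f \<in> F \<rightarrow> carrier M" "(\<lambda>x. s c (f x)) \<in> F \<rightarrow> carrier M"
    by (auto simp: Pi_iff)
  then show ?case
    using insert by (simp add: finsum_insert s_add_right finsum_closed)
qed simp

text \<open>Formal linear combinations of elements are evaluated; terms outside the carrier are
  discarded, which makes \<open>ev\<close> total and linear on the whole function space.\<close>

definition ev :: "('a \<Rightarrow>\<^sub>0 'k) \<Rightarrow> 'a" where
  "ev f = (\<Oplus>x\<in>Poly_Mapping.keys f \<inter> carrier M. s (Poly_Mapping.lookup f x) x)"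

lemma ev_eq:
  assumes "finite F" "F \<subseteq> carrier M" "Poly_Mapping.keys f \<inter> carrier M \<subseteq> F"
  shows "ev f = (\<Oplus>x\<in>F. s (Poly_Mapping.lookup f x) x)"
  unfolding ev_def
  by (rule add.finprod_mono_neutral_cong_left) (use assms in \<open>auto simp: in_keys_iff\<close>)

lemma ev_closed: "ev f \<in> carrier M"
  unfolding ev_def by (rule finsum_closed) auto

lemma ev_add: "ev (f + g) = ev f \<oplus> ev g"
proof -
  let ?F = "(Poly_Mapping.keys f \<union> Poly_Mapping.keys g) \<inter> carrier M"
  have F: "finite ?F" "?F \<subseteq> carrier M"
    by auto
  have "ev (f + g) = (\<Oplus>x\<in>?F. s (Poly_Mapping.lookup (f + g) x) x)"
    using keys_add[of f g] by (intro ev_eq) auto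
  also have "\<dots> = (\<Oplus>x\<in>?F. s (Poly_Mapping.lookup f x) x \<oplus> s (Poly_Mapping.lookup g x) x)"
    by (intro finsum_cong') (auto simp: lookup_add s_add_left)
  also have "\<dots> = ev f \<oplus> ev g"
  proof -
    have "ev f = (\<Oplus>x\<in>?F. s (Poly_Mapping.lookup f x) x)" "ev g = (\<Oplus>x\<in>?F. s (Poly_Mapping.lookup g x) x)"
      by (intro ev_eq; auto)+
    then show ?thesis
      by (simp only:) (rule finsum_addf, auto)
  qed
  finally show ?thesis .
qed

lemma ev_psc: "ev (psc c f) = s c (ev f)"
proof -
  have "ev (psc c f) = (\<Oplus>x\<in>Poly_Mapping.keys f \<inter> carrier M. s (Poly_Mapping.lookup (psc c f) x) x)"
    by (intro ev_eq) (auto simp: in_keys_iff)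
  also have "\<dots> = (\<Oplus>x\<in>Poly_Mapping.keys f \<inter> carrier M. s c (s (Poly_Mapping.lookup f x) x))"
    by (intro finsum_cong') (auto simp: s_mult)
  also have "\<dots> = s c (ev f)"
    unfolding ev_def by (subst s_finsum) auto
  finally show ?thesis .
qed

lemma ev_zero: "ev 0 = \<zero>"
  by (simp add: ev_def)

lemma ev_single: "x \<in> carrier M \<Longrightarrow> ev (Poly_Mapping.single x 1) = x"
  by (simp add: ev_def s_one)

text \<open>\<open>ev\<close> is linear and onto the carrier, so it has a linear section. The formal
  element \<open>single x 1\<close> is not linear in \<open>x\<close>; applying a projection
  \<open>g\<close> that kills the kernel of \<open>ev\<close> repairs this, since \<open>g\<close>
  depends only on the value of \<open>ev\<close>.\<close>

theorem embedding_exists: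
  "\<exists>\<iota> :: 'a \<Rightarrow> ('a \<Rightarrow>\<^sub>0 'k). (\<forall>x\<in>carrier M. \<forall>y\<in>carrier M. \<iota> (x \<oplus> y) = \<iota> x + \<iota> y) \<and>
     (\<forall>c. \<forall>x\<in>carrier M. \<iota> (s c x) = psc c (\<iota> x)) \<and> (\<forall>x\<in>carrier M. ev (\<iota> x) = x)"
proof -
  define K where "K = {f. ev f = \<zero>}"
  have K: "pm.subspace K"
    by (rule pm.subspaceI) (simp_all add: K_def ev_zero ev_add ev_psc)
  obtain B where B: "B \<subseteq> K" "pm.independent B" "K \<subseteq> pm.span B"
    using pm.maximal_independent_subset .
  obtain B' where B': "B \<subseteq> B'" "pm.independent B'" "UNIV \<subseteq> pm.span B'"
    using pm.maximal_independent_subset_extend[OF subset_UNIV B(2)] .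
  interpret pair: vector_space_pair psc psc ..
  \<comment> \<open>\<open>B\<close> is a basis of the kernel and \<open>B'\<close> extends it to
    the whole space: \<open>g\<close> is the projection along the kernel onto the complement spanned
    by the new basis vectors.\<close>
  obtain g where g: "Vector_Spaces.linear psc psc g" "\<And>b. b \<in> B' \<Longrightarrow> g b = (if b \<in> B then 0 else b)"
    using pair.linear_independent_extend[OF B'(2), of "\<lambda>b. if b \<in> B then 0 else b"] by blast
  interpret g: Vector_Spaces.linear psc psc g by (rule g(1))
  have g0: "g f = 0" if "ev f = \<zero>" for f
  proof -
    have "f \<in> pm.span B"
      using that B(3) by (auto simp: K_def)
    moreover have "g b = 0" if "b \<in> B" for b
      using g(2)[of b] B'(1) that by auto
    ultimately show ?thesis
      using g.eq_0_on_span by blast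
  qed
  have "g f - f \<in> K" for f
  proof -
    have "f \<in> pm.span B'"
      using B'(3) by auto
    then show ?thesis
    proof (induction f rule: pm.span_induct_alt)
      case base
      then show ?case using K by (simp add: pm.subspace_0)
    next
      case (step c x y)
      have "g x - x \<in> K"
        using g(2)[OF step(1)] B(1) K by (auto simp: pm.subspace_0 pm.subspace_neg)
      then have "psc c (g x - x) + (g y - y) \<in> K"
        using step(2) K by (simp add: pm.subspace_add pm.subspace_scale)
      then show ?case
        by (simp add: g.add g.scale pm.scale_right_diff_distrib algebra_simps)
    qed
  qed
  then have evg: "ev (g f) = ev f" for f
    using ev_add[of "g f - f" f] ev_closed[of f] by (simp add: K_def)
  let ?\<iota> = "\<lambda>x. g (Poly_Mapping.single x 1)"
  have "?\<iota> (x \<oplus> y) = ?\<iota> x + ?\<iota> y" if "x \<in> carrier M" "y \<in> carrier M" for x y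
  proof -
    have "ev (Poly_Mapping.single (x \<oplus> y) 1 + psc (- 1) (Poly_Mapping.single x 1 + Poly_Mapping.single y 1)) = \<zero>"
      using that by (simp only: ev_add ev_psc ev_single a_closed s_minus_one r_neg)
    from g0[OF this] show ?thesis
      by (simp add: g.add g.scale g.diff g.neg algebra_simps)
  qed
  moreover have "?\<iota> (s c x) = psc c (?\<iota> x)" if "x \<in> carrier M" for x c
  proof -
    have "ev (Poly_Mapping.single (s c x) 1 + psc (- 1) (psc c (Poly_Mapping.single x 1))) = \<zero>"
      using that by (simp only: ev_add ev_psc ev_single s_closed s_minus_one r_neg)
    from g0[OF this] show ?thesis
      by (simp add: g.add g.scale g.diff g.neg)
  qed
  moreover have "ev (?\<iota> x) = x" if "x \<in> carrier M" for x
    using that by (simp add: evg ev_single)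
  ultimately show ?thesis
    by (intro exI[of _ ?\<iota>]) simp
qed

end

section \<open>Graded submodules\<close>

lemma (in abelian_group) additive_subgroupI:
  assumes "W \<subseteq> carrier G" "\<zero> \<in> W" "\<And>x y. x \<in> W \<Longrightarrow> y \<in> W \<Longrightarrow> x \<oplus> y \<in> W" "\<And>x. x \<in> W \<Longrightarrow> \<ominus> x \<in> W"
  shows "additive_subgroup W G"
  using assms by (auto intro!: additive_subgroup.intro subgroup.intro simp: a_inv_def)

lemma (in abelian_group) additive_subgroupD:
  assumes "additive_subgroup W G"
  shows "W \<subseteq> carrier G" "\<zero> \<in> W" "x \<in> W \<Longrightarrow> y \<in> W \<Longrightarrow> x \<oplus> y \<in> W" "x \<in> W \<Longrightarrow> \<ominus> x \<in> W"
proof -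
  interpret W: additive_subgroup W G by (rule assms)
  show "W \<subseteq> carrier G" "\<zero> \<in> W" "x \<in> W \<Longrightarrow> y \<in> W \<Longrightarrow> x \<oplus> y \<in> W" "x \<in> W \<Longrightarrow> \<ominus> x \<in> W"
    using W.a_subset W.zero_closed W.a_closed additive_subgroup.a_inv_closed[OF assms] by auto
qed

definition base_scalar :: "('k::field, 'a) graded \<Rightarrow> ('a, 'm) graded \<Rightarrow> 'k \<Rightarrow> 'm \<Rightarrow> 'm" where
  "base_scalar A M c v = (c \<odot>\<^bsub>A\<^esub> \<one>\<^bsub>A\<^esub>) \<odot>\<^bsub>M\<^esub> v"

lemma set_add_iff: "x \<in> S <+>\<^bsub>M\<^esub> T \<longleftrightarrow> (\<exists>s\<in>S. \<exists>t\<in>T. x = s \<oplus>\<^bsub>M\<^esub> t)"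
  by (auto simp: set_add_defs)

lemma submodule_on_sel [simp]:
  "carrier (submodule_on M W) = W" "ring.zero (submodule_on M W) = \<zero>\<^bsub>M\<^esub>"
  "ring.add (submodule_on M W) = ring.add M" "Module.module.smult (submodule_on M W) = Module.module.smult M"
  "homog (submodule_on M W) p = homog M p \<inter> W"
  by (simp_all add: submodule_on_def)

lemma parity_change_sel [simp]:
  "carrier (parity_change M) = carrier M" "ring.zero (parity_change M) = \<zero>\<^bsub>M\<^esub>"
  "ring.add (parity_change M) = ring.add M" "Module.module.smult (parity_change M) = Module.module.smult M"
  "homog (parity_change M) p = homog M (p + 1)"
  by (simp_all add: parity_change_def)

lemma abelian_group_cong:
  assumes "abelian_group M" "carrier M' = carrier M" "ring.zero M' = \<zero>\<^bsub>M\<^esub>" "ring.add M' = ring.add M"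
  shows "abelian_group M'" "additive_subgroup W M' \<longleftrightarrow> additive_subgroup W M"
proof -
  interpret abelian_group M by (rule assms(1))
  show G': "abelian_group M'"
    by (rule abelian_groupI) (auto simp: assms a_ac intro!: bexI[of _ "\<ominus>\<^bsub>M\<^esub> _"] l_neg)
  interpret G': abelian_group M' by (rule G')
  have inv: "\<ominus>\<^bsub>M'\<^esub> x = \<ominus>\<^bsub>M\<^esub> x" if "x \<in> carrier M" for x
    using that by (intro G'.minus_equality) (auto simp: assms l_neg)
  show "additive_subgroup W M' \<longleftrightarrow> additive_subgroup W M"
  proof
    assume "additive_subgroup W M'"
    note * = G'.additive_subgroupD[OF this, unfolded assms]
    show "additive_subgroup W M"
      using * inv by (intro additive_subgroupI) (auto simp: subset_iff)
  next
    assume "additive_subgroup W M"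
    note * = additive_subgroupD[OF this]
    show "additive_subgroup W M'"
      using * inv by (intro G'.additive_subgroupI) (auto simp: subset_iff assms)
  qed
qed

context supermodule
begin

lemma const_closed: "c \<odot>\<^bsub>A\<^esub> \<one>\<^bsub>A\<^esub> \<in> carrier A"
  by (simp add: scale_closed)

lemma base_scalar_group: "scalar_group M (base_scalar A M)"
proof -
  have "base_scalar A M (c * c') v = base_scalar A M c (base_scalar A M c' v)" if "v \<in> carrier M" for c c' v
  proof -
    have "(c * c') \<odot>\<^bsub>A\<^esub> \<one>\<^bsub>A\<^esub> = (c \<odot>\<^bsub>A\<^esub> \<one>\<^bsub>A\<^esub>) \<otimes>\<^bsub>A\<^esub> (c' \<odot>\<^bsub>A\<^esub> \<one>\<^bsub>A\<^esub>)"
      using const_closed[of c'] by (simp add: scale_assoc scale_mult_left[symmetric])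
    then show ?thesis
      using that const_closed by (simp add: base_scalar_def smult_assoc)
  qed
  then show ?thesis
    using const_closed
    by unfold_locales (auto simp: base_scalar_def smult_closed smult_r_distr scale_l_distr smult_l_distr scale_one smult_one)
qed

lemma homog_carrier: "homog M p \<subseteq> carrier M"
  using M.additive_subgroupD(1)[OF mod_homog_subgroup] .

lemma homog_closed:
  "\<zero>\<^bsub>M\<^esub> \<in> homog M p" "v \<in> homog M p \<Longrightarrow> w \<in> homog M p \<Longrightarrow> v \<oplus>\<^bsub>M\<^esub> w \<in> homog M p"
  using M.additive_subgroupD(2,3)[OF mod_homog_subgroup] by auto

lemma base_scalar_homog: "v \<in> homog M p \<Longrightarrow> base_scalar A M c v \<in> homog M p"
  using homog_smult[OF homog_scale[OF homog_one, of c], of v p] by (simp add: base_scalar_def)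

lemma homog_decomp:
  assumes "v \<in> carrier M"
  obtains v0 v1 where "v0 \<in> homog M 0" "v1 \<in> homog M 1" "v = v0 \<oplus>\<^bsub>M\<^esub> v1"
  using assms mod_homog_sum by (auto simp: set_add_iff)

lemma homog_decomp_unique:
  assumes "v \<in> homog M 0" "w \<in> homog M 1" "v' \<in> homog M 0" "w' \<in> homog M 1" "v \<oplus>\<^bsub>M\<^esub> w = v' \<oplus>\<^bsub>M\<^esub> w'"
  shows "v = v'" "w = w'"
proof -
  have c: "v \<in> carrier M" "w \<in> carrier M" "v' \<in> carrier M" "w' \<in> carrier M"
    using assms homog_carrier by auto
  have "v \<ominus>\<^bsub>M\<^esub> v' = w' \<ominus>\<^bsub>M\<^esub> w"
  proof -
    have "v \<ominus>\<^bsub>M\<^esub> v' = (v \<ominus>\<^bsub>M\<^esub> v') \<oplus>\<^bsub>M\<^esub> (w \<ominus>\<^bsub>M\<^esub> w)"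
      using c by (simp add: a_minus_def M.r_neg)
    also have "\<dots> = (v \<oplus>\<^bsub>M\<^esub> w) \<oplus>\<^bsub>M\<^esub> (\<ominus>\<^bsub>M\<^esub> v' \<oplus>\<^bsub>M\<^esub> \<ominus>\<^bsub>M\<^esub> w)"
      using c by (simp add: a_minus_def M.a_ac)
    also have "\<dots> = (w' \<ominus>\<^bsub>M\<^esub> w) \<oplus>\<^bsub>M\<^esub> (v' \<ominus>\<^bsub>M\<^esub> v')"
      unfolding assms(5) using c by (simp add: a_minus_def M.a_ac)
    also have "\<dots> = w' \<ominus>\<^bsub>M\<^esub> w"
      using c by (simp add: a_minus_def M.r_neg)
    finally show ?thesis .
  qed
  moreover have "v \<ominus>\<^bsub>M\<^esub> v' \<in> homog M 0" "w' \<ominus>\<^bsub>M\<^esub> w \<in> homog M 1"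
    using assms M.additive_subgroupD(3,4)[OF mod_homog_subgroup] by (simp_all add: a_minus_def)
  ultimately have "v \<ominus>\<^bsub>M\<^esub> v' = \<zero>\<^bsub>M\<^esub>" "w' \<ominus>\<^bsub>M\<^esub> w = \<zero>\<^bsub>M\<^esub>"
    using mod_homog_inter by auto
  then show "v = v'" "w = w'"
    using c M.add.inv_solve_right'[of v v'] M.minus_equality[of v "\<ominus>\<^bsub>M\<^esub> v'"] M.minus_equality[of w' "\<ominus>\<^bsub>M\<^esub> w"]
    by (simp_all add: a_minus_def)
qed

lemma supermodule_submodule_on:
  assumes W: "graded_submodule A M W"
  shows "supermodule A (submodule_on M W)"
proof -
  have sg: "additive_subgroup W M" and sm: "\<And>a w. a \<in> carrier A \<Longrightarrow> w \<in> W \<Longrightarrow> a \<odot>\<^bsub>M\<^esub> w \<in> W"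
    and gr: "W = (W \<inter> homog M 0) <+>\<^bsub>M\<^esub> (W \<inter> homog M 1)"
    using W by (auto simp: graded_submodule_def)
  note cl = M.additive_subgroupD[OF sg]
  have c: "x \<in> carrier M" if "x \<in> W" for x
    using that cl(1) by auto
  have ab: "abelian_group (submodule_on M W)"
  proof (rule abelian_groupI)
    fix x assume "x \<in> carrier (submodule_on M W)"
    then show "\<exists>y\<in>carrier (submodule_on M W). y \<oplus>\<^bsub>submodule_on M W\<^esub> x = \<zero>\<^bsub>submodule_on M W\<^esub>"
      by (intro bexI[of _ "\<ominus>\<^bsub>M\<^esub> x"]) (simp_all add: cl c M.l_neg)
  qed (simp_all add: cl c M.a_ac)
  interpret S: abelian_group "submodule_on M W" by (rule ab)
  have inv: "\<ominus>\<^bsub>submodule_on M W\<^esub> x = \<ominus>\<^bsub>M\<^esub> x" if "x \<in> W" for x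
    using that cl(4) by (intro S.minus_equality) (auto simp: c M.l_neg)
  show ?thesis
  proof (intro supermodule.intro supermodule_axioms.intro A.superalgebra_axioms ab)
    fix p show "additive_subgroup (homog (submodule_on M W) p) (submodule_on M W)"
      using M.additive_subgroupD[OF mod_homog_subgroup[of p]] cl inv by (intro S.additive_subgroupI) auto
  next
    show "carrier (submodule_on M W) = homog (submodule_on M W) 0 <+>\<^bsub>submodule_on M W\<^esub> homog (submodule_on M W) 1"
      using gr by (simp add: set_add_defs Int_commute)
  next
    show "homog (submodule_on M W) 0 \<inter> homog (submodule_on M W) 1 = {\<zero>\<^bsub>submodule_on M W\<^esub>}"
      using mod_homog_inter cl(2) by auto
  next
    fix a v i j assume "a \<in> homog A i" "v \<in> homog (submodule_on M W) j"
    then show "a \<odot>\<^bsub>submodule_on M W\<^esub> v \<in> homog (submodule_on M W) (i + j)"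
      using homog_smult[of a i v j] sm A.additive_subgroupD(1)[OF homog_subgroup[of i]] by auto
  qed (auto simp: c sm smult_l_distr smult_r_distr smult_assoc smult_one)
qed

lemma graded_submodule_submodule_on:
  assumes W: "graded_submodule A M W"
  shows "graded_submodule A (submodule_on M W) W' \<longleftrightarrow> graded_submodule A M W' \<and> W' \<subseteq> W"
proof -
  interpret S: supermodule A "submodule_on M W" by (rule supermodule_submodule_on[OF W])
  have sg: "additive_subgroup W M"
    using W by (auto simp: graded_submodule_def)
  note cl = M.additive_subgroupD[OF sg]
  have inv: "\<ominus>\<^bsub>submodule_on M W\<^esub> x = \<ominus>\<^bsub>M\<^esub> x" if "x \<in> W" for x
    using that cl(1,4) by (intro S.M.minus_equality) (auto simp: M.l_neg subset_iff)
  have sub: "additive_subgroup W' (submodule_on M W) \<longleftrightarrow> additive_subgroup W' M \<and> W' \<subseteq> W"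
  proof (intro iffI conjI)
    assume *: "additive_subgroup W' (submodule_on M W)"
    show "W' \<subseteq> W"
      using S.M.additive_subgroupD(1)[OF *] by simp
    then show "additive_subgroup W' M"
      using S.M.additive_subgroupD(2-4)[OF *] cl(1) inv by (intro M.additive_subgroupI) (auto simp: subset_iff)
  next
    assume *: "additive_subgroup W' M \<and> W' \<subseteq> W"
    then show "additive_subgroup W' (submodule_on M W)"
      using M.additive_subgroupD(2-4)[of W'] inv by (intro S.M.additive_subgroupI) (auto simp: subset_iff)
  qed
  have "W' \<inter> homog (submodule_on M W) p = W' \<inter> homog M p" if "W' \<subseteq> W" for p
    using that by auto
  moreover have "S <+>\<^bsub>submodule_on M W\<^esub> T = S <+>\<^bsub>M\<^esub> T" for S T
    by (simp add: set_add_defs)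
  ultimately show ?thesis
    unfolding graded_submodule_def sub by auto
qed

lemma simple_submodule_on:
  assumes W: "graded_submodule A M W"
  shows "simple_supermodule A (submodule_on M W) \<longleftrightarrow>
     W \<noteq> {\<zero>\<^bsub>M\<^esub>} \<and> (\<forall>W'. graded_submodule A M W' \<and> W' \<subseteq> W \<longrightarrow> W' = {\<zero>\<^bsub>M\<^esub>} \<or> W' = W)"
  unfolding simple_supermodule_def graded_submodule_submodule_on[OF W]
  using supermodule_submodule_on[OF W] by simp

lemma supermodule_parity_change: "supermodule A (parity_change M)"
proof -
  note cong = abelian_group_cong[OF M.abelian_group_axioms, of "parity_change M", simplified]
  show ?thesis
  proof (intro supermodule.intro supermodule_axioms.intro A.superalgebra_axioms cong(1))
    fix p show "additive_subgroup (homog (parity_change M) p) (parity_change M)"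
      using mod_homog_subgroup by (simp add: cong(2))
  next
    have "x \<in> homog M p <+>\<^bsub>M\<^esub> homog M q" if "x \<in> homog M q <+>\<^bsub>M\<^esub> homog M p" for x p q
    proof -
      obtain s t where "s \<in> homog M q" "t \<in> homog M p" "x = s \<oplus>\<^bsub>M\<^esub> t"
        using \<open>x \<in> homog M q <+>\<^bsub>M\<^esub> homog M p\<close> by (auto simp: set_add_iff)
      moreover from this have "x = t \<oplus>\<^bsub>M\<^esub> s"
        using homog_carrier by (auto intro: M.a_comm)
      ultimately show ?thesis
        unfolding set_add_iff by blast
    qed
    then have "homog M 1 <+>\<^bsub>M\<^esub> homog M 0 = carrier M"
      unfolding mod_homog_sum by blast
    moreover have "S <+>\<^bsub>parity_change M\<^esub> T = S <+>\<^bsub>M\<^esub> T" for S T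
      by (simp add: set_add_defs)
    ultimately show "carrier (parity_change M) = homog (parity_change M) 0 <+>\<^bsub>parity_change M\<^esub> homog (parity_change M) 1"
      by simp
  next
    show "homog (parity_change M) 0 \<inter> homog (parity_change M) 1 = {\<zero>\<^bsub>parity_change M\<^esub>}"
      using mod_homog_inter by auto
  next
    fix a v i j assume "a \<in> homog A i" "v \<in> homog (parity_change M) j"
    then show "a \<odot>\<^bsub>parity_change M\<^esub> v \<in> homog (parity_change M) (i + j)"
      using homog_smult[of a i v "j + 1"] by (simp add: add.assoc)
  qed (auto simp: smult_closed smult_l_distr smult_r_distr smult_assoc smult_one)
qed

end

section \<open>Modules over Clifford superalgebras as families of operators\<close>

text \<open>\<open>ev\<close> is linear everywhere but in general injective only on the image of
  \<open>\<iota>\<close>, and \<open>\<iota>\<close> is controlled only on the carrier. An identity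
  that is moved back through \<open>ev\<close> must therefore be known to lie in the image.\<close>

locale cliff_embed = supermodule "clifford N d" M
  for N :: "nat set" and d :: "nat \<Rightarrow> 'k::field" and M :: "('k free_elt set, 'm) graded" (structure) +
  fixes \<iota> :: "'m \<Rightarrow> ('m \<Rightarrow>\<^sub>0 'k)" and ev :: "('m \<Rightarrow>\<^sub>0 'k) \<Rightarrow> 'm"
  assumes emb_add: "\<lbrakk>x \<in> carrier M; y \<in> carrier M\<rbrakk> \<Longrightarrow> \<iota> (x \<oplus>\<^bsub>M\<^esub> y) = \<iota> x + \<iota> y"
    and emb_scalar: "x \<in> carrier M \<Longrightarrow> \<iota> (base_scalar (clifford N d) M c x) = psc c (\<iota> x)"
    and ev_emb [simp]: "x \<in> carrier M \<Longrightarrow> ev (\<iota> x) = x"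
    and ev_closed [simp]: "ev f \<in> carrier M"
    and ev_add: "ev (f + g) = ev f \<oplus>\<^bsub>M\<^esub> ev g"
    and ev_psc: "ev (psc c f) = base_scalar (clifford N d) M c (ev f)"
    and two: "(2 :: 'k) \<noteq> 0"

lemma cliff_embed_exists:
  fixes M :: "('k::field free_elt set, 'm) graded"
  assumes "supermodule (clifford N d) M" "(2 :: 'k) \<noteq> 0"
  shows "\<exists>\<iota> ev. cliff_embed N d M \<iota> ev"
proof -
  interpret supermodule "clifford N d" M by (rule assms(1))
  interpret G: scalar_group M "base_scalar (clifford N d) M" by (rule base_scalar_group)
  obtain \<iota> :: "'m \<Rightarrow> ('m \<Rightarrow>\<^sub>0 'k)" where \<iota>: "\<forall>x\<in>carrier M. \<forall>y\<in>carrier M. \<iota> (x \<oplus>\<^bsub>M\<^esub> y) = \<iota> x + \<iota> y"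
    "\<forall>c. \<forall>x\<in>carrier M. \<iota> (base_scalar (clifford N d) M c x) = psc c (\<iota> x)" "\<forall>x\<in>carrier M. G.ev (\<iota> x) = x"
    using G.embedding_exists by blast
  have "cliff_embed N d M \<iota> G.ev"
    by unfold_locales (use \<iota> assms(2) G.ev_closed G.ev_add G.ev_psc in auto)
  then show ?thesis
    by blast
qed

context cliff_embed
begin

abbreviation "C \<equiv> clifford N d"

definition gen :: "nat \<Rightarrow> 'k free_elt set" where "gen i = cl_class N d (free_gen i)"

text \<open>Passing through \<open>ev\<close> makes the operator linear on the whole ambient space,
  and the value 0 for \<open>i \<notin> N\<close> extends this to all indices, as
  \<open>clmod\<close> asks.\<close>

definition op :: "nat \<Rightarrow> ('m \<Rightarrow>\<^sub>0 'k) \<Rightarrow> ('m \<Rightarrow>\<^sub>0 'k)" where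
  "op i f = (if i \<in> N then \<iota> (gen i \<odot> ev f) else 0)"

definition sp :: "bit \<Rightarrow> ('m \<Rightarrow>\<^sub>0 'k) set" where "sp p = \<iota> ` homog M p"

text \<open>\<open>sub_of\<close> and \<open>fam\<close> turn out to be inverse to each other,
  between the stable families below \<open>sp\<close> and the graded submodules of \<open>M\<close>.
  Simplicity and decompositions are transported along them.\<close>

definition sub_of :: "(bit \<Rightarrow> ('m \<Rightarrow>\<^sub>0 'k) set) \<Rightarrow> 'm set" where
  "sub_of U = ev ` U 0 <+> ev ` U 1"

definition fam :: "'m set \<Rightarrow> bit \<Rightarrow> ('m \<Rightarrow>\<^sub>0 'k) set" where "fam W p = \<iota> ` (W \<inter> homog M p)"

lemma gen_closed: "i \<in> N \<Longrightarrow> gen i \<in> carrier C"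
  by (simp add: gen_def cl_class_closed free_gen_carrier)

lemma gen_odd: "i \<in> N \<Longrightarrow> gen i \<in> homog C 1"
  unfolding gen_def by (rule cl_class_homog) (auto simp: free_homog_def free_gen_carrier, simp add: free_gen_def)

lemma gen_smult_closed: "i \<in> N \<Longrightarrow> v \<in> carrier M \<Longrightarrow> gen i \<odot> v \<in> carrier M"
  by (simp add: smult_closed gen_closed)

lemma gen_smult_homog: "i \<in> N \<Longrightarrow> v \<in> homog M p \<Longrightarrow> gen i \<odot> v \<in> homog M (p + 1)"
  using homog_smult[OF gen_odd, of i v p] by (simp add: add.commute)

lemma ev_op: "i \<in> N \<Longrightarrow> ev (op i f) = gen i \<odot> ev f"
  by (simp add: op_def gen_smult_closed)

lemma emb_gen: "i \<in> N \<Longrightarrow> x \<in> carrier M \<Longrightarrow> \<iota> (gen i \<odot> x) = op i (\<iota> x)"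
  by (simp add: op_def)

lemma emb_zero: "\<iota> \<zero> = 0"
  using emb_add[of "\<zero>" "\<zero>"] by simp

lemma ev_zero: "ev 0 = \<zero>"
  using ev_emb[of "\<zero>"] by (simp add: emb_zero)

lemma emb_inj: "x \<in> carrier M \<Longrightarrow> y \<in> carrier M \<Longrightarrow> \<iota> x = \<iota> y \<Longrightarrow> x = y"
  by (metis ev_emb)

lemma hc: "x \<in> homog M p \<Longrightarrow> x \<in> carrier M"
  using homog_carrier by auto

lemma emb_ev: "u \<in> sp p \<Longrightarrow> \<iota> (ev u) = u"
  by (auto simp: sp_def hc)

lemma ev_sp: "u \<in> sp p \<Longrightarrow> ev u \<in> homog M p"
  by (auto simp: sp_def hc)

lemma emb_base_scalar_smult:
  "gen i \<odot> base_scalar C M c v = base_scalar C M c (gen i \<odot> v)" if "i \<in> N" "v \<in> carrier M"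
proof -
  have "gen i \<otimes>\<^bsub>C\<^esub> (c \<odot>\<^bsub>C\<^esub> \<one>\<^bsub>C\<^esub>) = (c \<odot>\<^bsub>C\<^esub> \<one>\<^bsub>C\<^esub>) \<otimes>\<^bsub>C\<^esub> gen i"
    using scale_mult_right[OF gen_closed[OF that(1)] A.one_closed, of c]
      scale_mult_left[OF A.one_closed gen_closed[OF that(1)], of c] gen_closed[OF that(1)] by simp
  then show ?thesis
    using that const_closed gen_closed[OF that(1)] unfolding base_scalar_def by (metis smult_assoc)
qed

lemma clmod: "clmod N d op sp"
proof
  fix p
  show "pm.subspace (sp p)"
  proof (rule pm.subspaceI)
    show "0 \<in> sp p"
      using homog_closed(1) emb_zero unfolding sp_def by (metis imageI)
    fix x y c assume x: "x \<in> sp p"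
    then show "psc c x \<in> sp p"
      unfolding sp_def using base_scalar_homog by (auto simp: hc image_iff intro!: bexI[of _ "base_scalar C M c _"] emb_scalar[symmetric])
    assume "y \<in> sp p"
    then show "x + y \<in> sp p"
      using x unfolding sp_def by (auto simp: hc image_iff homog_closed intro!: bexI[of _ "_ \<oplus> _"] emb_add[symmetric])
  qed
next
  fix i x y
  show "op i (x + y) = op i x + op i y"
    by (simp add: op_def ev_add smult_r_distr gen_closed emb_add gen_smult_closed)
next
  fix i c x
  show "op i (psc c x) = psc c (op i x)"
    by (simp add: op_def ev_psc emb_base_scalar_smult emb_scalar gen_smult_closed)
next
  fix i x p assume "i \<in> N" "x \<in> sp p"
  then show "op i x \<in> sp (p + 1)"
    using gen_smult_homog ev_sp by (auto simp: op_def sp_def hc)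
next
  fix i j x p assume ij: "i \<in> N" "j \<in> N" and x: "x \<in> sp p"
  let ?v = "ev x"
  have v: "?v \<in> carrier M"
    by simp
  have ab: "gen i \<otimes>\<^bsub>C\<^esub> gen j \<in> carrier C" "gen j \<otimes>\<^bsub>C\<^esub> gen i \<in> carrier C"
    using ij gen_closed by auto
  have "gen i \<odot> (gen j \<odot> ?v) \<oplus> gen j \<odot> (gen i \<odot> ?v) =
      (gen i \<otimes>\<^bsub>C\<^esub> gen j \<oplus>\<^bsub>C\<^esub> gen j \<otimes>\<^bsub>C\<^esub> gen i) \<odot> ?v"
    using ij ab by (simp add: smult_l_distr smult_assoc gen_closed)
  also have "\<dots> = base_scalar C M (if i = j then 2 * d i else 0) ?v"
    unfolding base_scalar_def gen_def clifford_relation[OF ij] ..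
  finally have "\<iota> (gen i \<odot> (gen j \<odot> ?v)) + \<iota> (gen j \<odot> (gen i \<odot> ?v)) =
      psc (if i = j then 2 * d i else 0) (\<iota> ?v)"
    using ij by (simp add: emb_add[symmetric] gen_smult_closed emb_scalar)
  then show "op i (op j x) + op j (op i x) = psc (if i = j then 2 * d i else 0) x"
    using ij emb_ev[OF x] by (simp add: op_def gen_smult_closed)
qed (rule two)

lemma sp_inter: "sp 0 \<inter> sp 1 = {0}"
proof (intro equalityI subsetI)
  fix u assume "u \<in> sp 0 \<inter> sp 1"
  then have "ev u \<in> homog M 0 \<inter> homog M 1" "\<iota> (ev u) = u"
    using ev_sp emb_ev by auto
  then show "u \<in> {0}"
    using mod_homog_inter emb_zero by auto
qed (use homog_closed(1) emb_zero in \<open>auto simp: sp_def image_iff intro: bexI[of _ "\<zero>"]\<close>)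

text \<open>The algebra is generated by the \<open>gen i\<close> over the ground field, so closure
  under sums, scalars and generators suffices. The same reduction is used for homomorphisms in
  \<open>smult_hom_induct\<close>.\<close>

lemma smult_induct:
  assumes "a \<in> carrier C" and W: "W \<subseteq> carrier M"
    and add: "\<And>v w. v \<in> W \<Longrightarrow> w \<in> W \<Longrightarrow> v \<oplus> w \<in> W"
    and scal: "\<And>c v. v \<in> W \<Longrightarrow> base_scalar C M c v \<in> W"
    and gen: "\<And>i v. i \<in> N \<Longrightarrow> v \<in> W \<Longrightarrow> gen i \<odot> v \<in> W"
  shows "v \<in> W \<Longrightarrow> a \<odot> v \<in> W"
  using assms(1)
proof (induction a rule: clifford_gen_induct)
  case (const c)
  then show ?case
    using scal[of v c] by (simp add: base_scalar_def)
next
  case (gen_mult i x)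
  then show ?case
    using W gen[OF gen_mult(1), of "x \<odot> v"] smult_assoc[OF gen_closed[OF gen_mult(1)], of x v]
    by (auto simp: gen_def[symmetric])
next
  case (add x y)
  then show ?case
    using W assms(3) by (auto simp: smult_l_distr)
qed

lemma smult_hom_induct:
  assumes "a \<in> carrier C" and M': "supermodule C M'" and v: "v \<in> carrier M"
    and f: "\<And>v. v \<in> carrier M \<Longrightarrow> f v \<in> carrier M'"
    and add: "\<And>v w. v \<in> carrier M \<Longrightarrow> w \<in> carrier M \<Longrightarrow> f (v \<oplus> w) = f v \<oplus>\<^bsub>M'\<^esub> f w"
    and scal: "\<And>c v. v \<in> carrier M \<Longrightarrow> f (base_scalar C M c v) = base_scalar C M' c (f v)"
    and gen: "\<And>i v. i \<in> N \<Longrightarrow> v \<in> carrier M \<Longrightarrow> f (gen i \<odot> v) = gen i \<odot>\<^bsub>M'\<^esub> f v"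
  shows "f (a \<odot> v) = a \<odot>\<^bsub>M'\<^esub> f v"
  using assms(1)
proof (induction a rule: clifford_gen_induct)
  case (const c)
  then show ?case
    using scal[OF v, of c] by (simp add: base_scalar_def)
next
  case (gen_mult i x)
  then show ?case
    using smult_assoc[OF gen_closed[OF gen_mult(1)] gen_mult(2) v] v f
      supermodule.smult_assoc[OF M' gen_closed[OF gen_mult(1)] gen_mult(2) f[OF v]] gen[OF gen_mult(1) smult_closed[OF gen_mult(2) v]]
    by (simp add: gen_def[symmetric])
next
  case (add x y)
  then show ?case
    using v assms(5)[of "x \<odot> v" "y \<odot> v"] supermodule.smult_l_distr[OF M' add(1,2) f[OF v]]
    by (simp add: smult_l_distr smult_closed)
qed

lemma ev_image:
  assumes "graded_stable N op U" "U \<le> sp"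
  shows "ev ` U p \<subseteq> homog M p" "\<zero> \<in> ev ` U p"
    "v \<in> ev ` U p \<Longrightarrow> w \<in> ev ` U p \<Longrightarrow> v \<oplus> w \<in> ev ` U p"
    "v \<in> ev ` U p \<Longrightarrow> base_scalar C M c v \<in> ev ` U p"
    "i \<in> N \<Longrightarrow> v \<in> ev ` U p \<Longrightarrow> gen i \<odot> v \<in> ev ` U (p + 1)"
proof -
  have U: "U p \<subseteq> sp p" for p
    using assms(2) by (simp add: le_fun_def)
  have S: "pm.subspace (U p)" "\<And>i x. i \<in> N \<Longrightarrow> x \<in> U p \<Longrightarrow> op i x \<in> U (p + 1)" for p
    using assms(1) by (auto simp: graded_stable_def)
  show "ev ` U p \<subseteq> homog M p"
    using U ev_sp by blast
  show "\<zero> \<in> ev ` U p"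
    using pm.subspace_0[OF S(1)] ev_zero by (metis imageI)
  show "v \<in> ev ` U p \<Longrightarrow> w \<in> ev ` U p \<Longrightarrow> v \<oplus> w \<in> ev ` U p"
    using pm.subspace_add[OF S(1)] ev_add by (metis (no_types) imageE imageI)
  show "v \<in> ev ` U p \<Longrightarrow> base_scalar C M c v \<in> ev ` U p"
    using pm.subspace_scale[OF S(1)] ev_psc by (metis (no_types) imageE imageI)
  show "i \<in> N \<Longrightarrow> v \<in> ev ` U p \<Longrightarrow> gen i \<odot> v \<in> ev ` U (p + 1)"
    using S(2) ev_op by (metis (no_types) imageE imageI)
qed

lemma base_scalar_minus: "v \<in> carrier M \<Longrightarrow> \<ominus> v = base_scalar C M (- 1) v"
  using scalar_group.s_minus_one[OF base_scalar_group] by simp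

lemma base_scalar_add: "v \<in> carrier M \<Longrightarrow> w \<in> carrier M \<Longrightarrow>
    base_scalar C M c (v \<oplus> w) = base_scalar C M c v \<oplus> base_scalar C M c w"
  using scalar_group.s_add_right[OF base_scalar_group] by simp

text \<open>Decompositions into an even and an odd part are unique in \<open>M\<close>, so a
  homogeneous element of the sum is one of its two summands.\<close>

lemma sub_of_homog:
  assumes U: "graded_stable N op U" "U \<le> sp"
  shows "sub_of U \<inter> homog M p = ev ` U p"
proof -
  note ev = ev_image[OF U]
  have I: "a \<oplus> b \<in> sub_of U" if "a \<in> ev ` U 0" "b \<in> ev ` U 1" for a b
    using that unfolding sub_of_def set_add_iff by blast
  have c: "a \<in> carrier M" if "a \<in> ev ` U q" for a q
    using that ev(1) hc by blast
  have ev0: "ev ` U 0 \<subseteq> sub_of U"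
  proof
    fix a assume a: "a \<in> ev ` U 0"
    then show "a \<in> sub_of U"
      using I[OF a ev(2)[of 1]] c[OF a] by simp
  qed
  have ev1: "ev ` U 1 \<subseteq> sub_of U"
  proof
    fix a assume a: "a \<in> ev ` U 1"
    then show "a \<in> sub_of U"
      using I[OF ev(2)[of 0] a] c[OF a] by simp
  qed
  have "ev ` U p \<subseteq> sub_of U"
    using ev0 ev1 by (cases p) auto
  moreover have "w \<in> ev ` U p" if w: "w \<in> sub_of U" "w \<in> homog M p" for w
  proof -
    obtain a b where ab: "a \<in> ev ` U 0" "b \<in> ev ` U 1" "w = a \<oplus> b"
      using w(1) by (auto simp: sub_of_def set_add_iff)
    have h: "a \<in> homog M 0" "b \<in> homog M 1"
      using ab ev(1)[of 0] ev(1)[of 1] by auto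
    show ?thesis
    proof (cases p)
      case zero
      then have "w \<in> homog M 0"
        using w(2) by simp
      moreover have "w \<oplus> \<zero> = a \<oplus> b"
        unfolding ab(3)[symmetric] using w(2) hc by simp
      ultimately have "w = a"
        using homog_decomp_unique(1)[OF _ homog_closed(1) h] by blast
      then show ?thesis
        using zero ab by simp
    next
      case one
      then have "w \<in> homog M 1"
        using w(2) by simp
      moreover have "\<zero> \<oplus> w = a \<oplus> b"
        unfolding ab(3)[symmetric] using w(2) hc by simp
      ultimately have "w = b"
        using homog_decomp_unique(2)[OF homog_closed(1) _ h] by blast
      then show ?thesis
        using one ab by simp
    qed
  qed
  ultimately show ?thesis
    using ev(1) by blast
qed

lemma graded_submodule_sub_of:
  assumes U: "graded_stable N op U" "U \<le> sp"
  shows "graded_submodule C M (sub_of U)"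
proof -
  note ev = ev_image[OF U]
  have hU: "ev ` U p \<subseteq> carrier M" for p
    using ev(1) hc by blast
  have mem: "\<exists>a b. a \<in> ev ` U 0 \<and> b \<in> ev ` U 1 \<and> v = a \<oplus> b" if "v \<in> sub_of U" for v
    using that by (auto simp: sub_of_def set_add_iff)
  have I: "a \<oplus> b \<in> sub_of U" if "a \<in> ev ` U 0" "b \<in> ev ` U 1" for a b
    using that unfolding sub_of_def set_add_iff by blast
  have sub: "sub_of U \<subseteq> carrier M"
  proof
    fix v assume "v \<in> sub_of U"
    then obtain a b where ab: "a \<in> ev ` U 0" "b \<in> ev ` U 1" "v = a \<oplus> b"
      using mem by blast
    then show "v \<in> carrier M"
      using subsetD[OF hU ab(1)] subsetD[OF hU ab(2)] by simp
  qed
  have add: "v \<oplus> w \<in> sub_of U" if vw: "v \<in> sub_of U" "w \<in> sub_of U" for v w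
  proof -
    obtain a b a' b' where ab: "a \<in> ev ` U 0" "b \<in> ev ` U 1" "v = a \<oplus> b"
      "a' \<in> ev ` U 0" "b' \<in> ev ` U 1" "w = a' \<oplus> b'"
      using mem[OF vw(1)] mem[OF vw(2)] by blast
    have c: "a \<in> carrier M" "b \<in> carrier M" "a' \<in> carrier M" "b' \<in> carrier M"
      using ab hU by auto
    have "v \<oplus> w = (a \<oplus> a') \<oplus> (b \<oplus> b')"
      unfolding ab(3,6) using c by (simp add: M.a_ac)
    then show ?thesis
      using I[OF ev(3)[OF ab(1,4)] ev(3)[OF ab(2,5)]] by simp
  qed
  have scal: "base_scalar C M c v \<in> sub_of U" if v: "v \<in> sub_of U" for c v
  proof -
    obtain a b where ab: "a \<in> ev ` U 0" "b \<in> ev ` U 1" "v = a \<oplus> b"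
      using mem[OF v] by blast
    have c: "a \<in> carrier M" "b \<in> carrier M"
      using ab hU by auto
    show ?thesis
      unfolding ab(3) base_scalar_add[OF c] by (rule I[OF ev(4)[OF ab(1)] ev(4)[OF ab(2)]])
  qed
  have gen: "gen i \<odot> v \<in> sub_of U" if i: "i \<in> N" and v: "v \<in> sub_of U" for i v
  proof -
    obtain a b where ab: "a \<in> ev ` U 0" "b \<in> ev ` U 1" "v = a \<oplus> b"
      using mem[OF v] by blast
    have c: "a \<in> carrier M" "b \<in> carrier M"
      using ab hU by auto
    have "gen i \<odot> v = gen i \<odot> b \<oplus> gen i \<odot> a"
      unfolding ab(3) using c by (simp add: smult_r_distr gen_closed[OF i] gen_smult_closed[OF i] M.a_comm)
    then show ?thesis
      using I ev(5)[OF i ab(1)] ev(5)[OF i ab(2)] by simp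
  qed
  have "\<zero> \<in> sub_of U"
    using I[OF ev(2) ev(2)] by simp
  moreover have "\<ominus> v \<in> sub_of U" if "v \<in> sub_of U" for v
    using scal[OF that, of "- 1"] base_scalar_minus[of v] sub that by auto
  ultimately have "additive_subgroup (sub_of U) M"
    using sub add by (intro M.additive_subgroupI)
  moreover have "a \<odot> w \<in> sub_of U" if "a \<in> carrier C" "w \<in> sub_of U" for a w
    by (rule smult_induct[OF that(1) sub add scal gen that(2)])
  moreover have "sub_of U = (sub_of U \<inter> homog M 0) <+> (sub_of U \<inter> homog M 1)"
    unfolding sub_of_homog[OF U] by (simp add: sub_of_def)
  ultimately show ?thesis
    by (simp add: graded_submodule_def)
qed

lemma fam_stable:
  assumes W: "graded_submodule C M W"
  shows "graded_stable N op (fam W)" "fam W \<le> sp" "sub_of (fam W) = W"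
proof -
  have sg: "additive_subgroup W M" and sm: "\<And>a w. a \<in> carrier C \<Longrightarrow> w \<in> W \<Longrightarrow> a \<odot> w \<in> W"
    and gr: "W = (W \<inter> homog M 0) <+> (W \<inter> homog M 1)"
    using W by (auto simp: graded_submodule_def)
  note cl = M.additive_subgroupD[OF sg]
  show "fam W \<le> sp"
    by (auto simp: le_fun_def fam_def sp_def)
  have "pm.subspace (fam W p)" for p
  proof (rule pm.subspaceI)
    have "\<zero> \<in> W \<inter> homog M p"
      using cl(2) homog_closed(1) by simp
    then show "0 \<in> fam W p"
      unfolding fam_def using emb_zero by (metis imageI)
    fix x y c assume "x \<in> fam W p"
    then obtain x' where x': "x = \<iota> x'" "x' \<in> W" "x' \<in> homog M p"
      by (auto simp: fam_def)
    have "base_scalar C M c x' \<in> W \<inter> homog M p"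
      using x' sm[OF const_closed] base_scalar_homog by (auto simp: base_scalar_def)
    then show "psc c x \<in> fam W p"
      using x' emb_scalar[OF hc, of x' p c] unfolding fam_def by (metis imageI)
    assume "y \<in> fam W p"
    then obtain y' where y': "y = \<iota> y'" "y' \<in> W" "y' \<in> homog M p"
      by (auto simp: fam_def)
    have "x' \<oplus> y' \<in> W \<inter> homog M p"
      using x' y' cl(3) homog_closed(2) by auto
    then show "x + y \<in> fam W p"
      using x' y' emb_add[OF hc hc, of x' p y' p] unfolding fam_def by (metis imageI)
  qed
  moreover have "op i x \<in> fam W (p + 1)" if i: "i \<in> N" and x: "x \<in> fam W p" for i x p
  proof -
    obtain x' where x': "x = \<iota> x'" "x' \<in> W" "x' \<in> homog M p"
      using x by (auto simp: fam_def)
    then have "gen i \<odot> x' \<in> W \<inter> homog M (p + 1)"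
      using i sm[OF gen_closed] gen_smult_homog by auto
    then show ?thesis
      using i x' hc by (auto simp: fam_def op_def)
  qed
  ultimately show "graded_stable N op (fam W)"
    by (simp add: graded_stable_def)
  have "ev ` fam W p = W \<inter> homog M p" for p
    by (force simp: fam_def image_image hc)
  then show "sub_of (fam W) = W"
    unfolding sub_of_def using gr by simp
qed

lemma fam_sub_of:
  assumes U: "graded_stable N op U" "U \<le> sp"
  shows "fam (sub_of U) = U"
proof
  fix p
  have "\<iota> (ev u) = u" if "u \<in> U p" for u
    using that U(2) emb_ev by (auto simp: le_fun_def)
  then show "fam (sub_of U) p = U p"
    unfolding fam_def sub_of_homog[OF U] by (force simp: image_image)
qed

lemma fam_mono: "W \<subseteq> W' \<Longrightarrow> fam W \<le> fam W'"
  by (auto simp: le_fun_def fam_def)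

lemma sub_of_mono: "U \<le> U' \<Longrightarrow> sub_of U \<subseteq> sub_of U'"
  by (force simp: le_fun_def sub_of_def set_add_iff)

lemma sub_of_sp: "sub_of sp = carrier M"
proof -
  have "ev ` sp p = homog M p" for p
    by (force simp: sp_def image_image hc)
  then show ?thesis
    unfolding sub_of_def mod_homog_sum by simp
qed

lemma sub_of_zero:
  assumes U: "graded_stable N op U" "U \<le> sp"
  shows "sub_of U = {\<zero>} \<longleftrightarrow> (\<forall>p. U p = {0})"
proof
  assume "sub_of U = {\<zero>}"
  then have "U = fam {\<zero>}"
    using fam_sub_of[OF U] by simp
  then show "\<forall>p. U p = {0}"
    using homog_closed(1) by (auto simp: fam_def emb_zero)
qed (auto simp: sub_of_def set_add_iff ev_zero)

lemma simple_sub_of: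
  assumes U: "graded_stable N op U" "U \<le> sp"
  shows "simple_supermodule C (submodule_on M (sub_of U)) \<longleftrightarrow> graded_simple N op U"
  unfolding simple_submodule_on[OF graded_submodule_sub_of[OF U]]
proof
  assume *: "sub_of U \<noteq> {\<zero>} \<and>
    (\<forall>W'. graded_submodule C M W' \<and> W' \<subseteq> sub_of U \<longrightarrow> W' = {\<zero>} \<or> W' = sub_of U)"
  show "graded_simple N op U"
    unfolding graded_simple_def
  proof (intro conjI allI impI)
    show "\<exists>p. U p \<noteq> {0}"
      using * sub_of_zero[OF U] by blast
    fix W assume W: "graded_stable N op W \<and> W \<le> U"
    then have W': "graded_stable N op W" "W \<le> sp"
      using U(2) by auto
    have "sub_of W = {\<zero>} \<or> sub_of W = sub_of U"
      using * graded_submodule_sub_of[OF W'] sub_of_mono W by blast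
    then show "(\<forall>p. W p = {0}) \<or> W = U"
      using sub_of_zero[OF W'] fam_sub_of[OF W'] fam_sub_of[OF U] by metis
  qed (rule U(1))
next
  assume *: "graded_simple N op U"
  show "sub_of U \<noteq> {\<zero>} \<and>
    (\<forall>W'. graded_submodule C M W' \<and> W' \<subseteq> sub_of U \<longrightarrow> W' = {\<zero>} \<or> W' = sub_of U)"
  proof (intro conjI allI impI)
    show "sub_of U \<noteq> {\<zero>}"
      using * sub_of_zero[OF U] by (auto simp: graded_simple_def)
    fix W assume W: "graded_submodule C M W \<and> W \<subseteq> sub_of U"
    then have W': "graded_stable N op (fam W)" "fam W \<le> sp" "sub_of (fam W) = W"
      using fam_stable by auto
    have "fam W \<le> U"
      using fam_mono[of W "sub_of U"] W fam_sub_of[OF U] by simp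
    then have "(\<forall>p. fam W p = {0}) \<or> fam W = U"
      using * W'(1) by (simp add: graded_simple_def)
    then show "W = {\<zero>} \<or> W = sub_of U"
      using sub_of_zero[OF W'(1,2)] W'(3) by auto
  qed
qed

lemma simple_iff: "simple_supermodule C M \<longleftrightarrow> graded_simple N op sp"
proof -
  have "submodule_on M (carrier M) = M"
    by (auto simp: submodule_on_def fun_eq_iff hc intro!: graded.equality)
  then show ?thesis
    using simple_sub_of[OF clmod.stable[OF clmod] order.refl] by (simp add: sub_of_sp)
qed

end

lemma (in abelian_group) add_interchange:
  "\<lbrakk>a \<in> carrier G; b \<in> carrier G; c \<in> carrier G; e \<in> carrier G\<rbrakk> \<Longrightarrow>
   (a \<oplus> b) \<oplus> (c \<oplus> e) = (a \<oplus> c) \<oplus> (b \<oplus> e)"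
  by (simp add: a_ac)

context cliff_embed
begin

lemma embed_parity_change: "cliff_embed N d (parity_change M) \<iota> ev"
proof -
  interpret P: supermodule C "parity_change M" by (rule supermodule_parity_change)
  show ?thesis
    by unfold_locales
      (use emb_add emb_scalar ev_add ev_psc two in \<open>auto simp: base_scalar_def\<close>)
qed

text \<open>\<open>parity_change\<close> introduces no sign in the action, so the operators agree
  literally and only the grading is shifted.\<close>

lemma op_parity_change: "cliff_embed.op N d (parity_change M) \<iota> ev = op"
  by (intro ext) (simp add: op_def cliff_embed.op_def[OF embed_parity_change] gen_def
      cliff_embed.gen_def[OF embed_parity_change])

lemma sp_parity_change: "cliff_embed.sp (parity_change M) \<iota> = shift sp"
  by (intro ext) (simp add: sp_def cliff_embed.sp_def[OF embed_parity_change] shift_def)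

subsection \<open>Isomorphisms\<close>

lemma supermodule_iso_graded_iso:
  assumes M': "cliff_embed N d M' \<iota>' ev'" and iso: "supermodule_iso C M M'"
  shows "graded_iso N op sp (cliff_embed.op N d M' \<iota>' ev') (cliff_embed.sp M' \<iota>')"
proof -
  interpret M': cliff_embed N d M' \<iota>' ev' by (rule M')
  obtain f where F: "bij_betw f (carrier M) (carrier M') \<and>
      (\<forall>v\<in>carrier M. \<forall>w\<in>carrier M. f (v \<oplus> w) = f v \<oplus>\<^bsub>M'\<^esub> f w) \<and>
      (\<forall>a\<in>carrier C. \<forall>v\<in>carrier M. f (a \<odot> v) = a \<odot>\<^bsub>M'\<^esub> f v) \<and> (\<forall>i. f ` homog M i = homog M' i)"
    using iso unfolding supermodule_iso_def by (rule exE)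
  have f: "bij_betw f (carrier M) (carrier M')"
    "\<And>v w. v \<in> carrier M \<Longrightarrow> w \<in> carrier M \<Longrightarrow> f (v \<oplus> w) = f v \<oplus>\<^bsub>M'\<^esub> f w"
    "\<And>a v. a \<in> carrier C \<Longrightarrow> v \<in> carrier M \<Longrightarrow> f (a \<odot> v) = a \<odot>\<^bsub>M'\<^esub> f v"
    "\<And>i. f ` homog M i = homog M' i"
    using F by simp_all
  have fc: "f v \<in> carrier M'" if "v \<in> carrier M" for v
    using that f(1) by (auto simp: bij_betw_def)
  have fh: "f v \<in> homog M' p" if "v \<in> homog M p" for v p
    using that f(4) by blast
  show ?thesis
  proof (rule graded_isoI[where \<phi> = "\<lambda>p x. \<iota>' (f (ev x))"])
    fix p
    show "inj_on (\<lambda>x. \<iota>' (f (ev x))) (sp p)"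
    proof (rule inj_onI)
      fix x y assume xy: "x \<in> sp p" "y \<in> sp p" "\<iota>' (f (ev x)) = \<iota>' (f (ev y))"
      then have "f (ev x) = f (ev y)"
        using M'.emb_inj[OF fc fc] by simp
      then have "ev x = ev y"
        using f(1) ev_closed unfolding bij_betw_def inj_on_def by blast
      then show "x = y"
        using emb_ev xy(1,2) by metis
    qed
    have "(\<lambda>x. \<iota>' (f (ev x))) ` sp p = \<iota>' ` f ` ev ` sp p"
      by (simp add: image_image)
    also have "ev ` sp p = homog M p"
      by (force simp: sp_def image_image hc)
    finally show "(\<lambda>x. \<iota>' (f (ev x))) ` sp p = M'.sp p"
      by (simp add: f(4) M'.sp_def)
    fix x y assume "x \<in> sp p" "y \<in> sp p"
    show "\<iota>' (f (ev (x + y))) = \<iota>' (f (ev x)) + \<iota>' (f (ev y))"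
      by (simp add: ev_add f(2) M'.emb_add fc)
  next
    fix p c x assume "x \<in> sp p"
    have "f (base_scalar C M c (ev x)) = base_scalar C M' c (f (ev x))"
      by (simp add: base_scalar_def f(3) const_closed)
    then show "\<iota>' (f (ev (psc c x))) = psc c (\<iota>' (f (ev x)))"
      by (simp add: ev_psc M'.emb_scalar fc)
  next
    fix p i x assume i: "i \<in> N" and "x \<in> sp p"
    have "f (gen i \<odot> ev x) = M'.gen i \<odot>\<^bsub>M'\<^esub> f (ev x)"
      by (simp add: f(3) gen_closed[OF i])
    then show "\<iota>' (f (ev (op i x))) = M'.op i (\<iota>' (f (ev x)))"
      using i by (simp add: ev_op M'.emb_gen fc)
  qed
qed

text \<open>The maps on the two components are glued through chosen components \<open>c0\<close> and
  \<open>c1\<close> of a vector; uniqueness of the decomposition makes the glued map additive.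
  Equivariance is checked on generators and extended to the algebra by induction.\<close>

lemma graded_iso_supermodule_iso:
  assumes M': "cliff_embed N d M' \<iota>' ev'"
    and iso: "graded_iso N op sp (cliff_embed.op N d M' \<iota>' ev') (cliff_embed.sp M' \<iota>')"
  shows "supermodule_iso C M M'"
proof -
  interpret M': cliff_embed N d M' \<iota>' ev' by (rule M')
  obtain \<phi> where bij: "\<And>p. bij_betw (\<phi> p) (sp p) (M'.sp p)"
    and add: "\<And>p x y. x \<in> sp p \<Longrightarrow> y \<in> sp p \<Longrightarrow> \<phi> p (x + y) = \<phi> p x + \<phi> p y"
    and scale: "\<And>p c x. x \<in> sp p \<Longrightarrow> \<phi> p (psc c x) = psc c (\<phi> p x)"
    and T: "\<And>p i x. i \<in> N \<Longrightarrow> x \<in> sp p \<Longrightarrow> \<phi> (p + 1) (op i x) = M'.op i (\<phi> p x)"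
    using graded_isoE[OF iso] by blast
  define g where "g p v = ev' (\<phi> p (\<iota> v))" for p v
  have sp: "\<iota> v \<in> sp p" if "v \<in> homog M p" for v p
    using that by (simp add: sp_def)
  have \<phi>sp: "\<phi> p x \<in> M'.sp p" if "x \<in> sp p" for x p
    using that bij_betwE[OF bij] by blast
  have gh: "g p v \<in> homog M' p" if "v \<in> homog M p" for p v
    using \<phi>sp[OF sp[OF that]] by (simp add: g_def M'.ev_sp)
  have gadd: "g p (v \<oplus> w) = g p v \<oplus>\<^bsub>M'\<^esub> g p w" if "v \<in> homog M p" "w \<in> homog M p" for p v w
    using that by (simp add: g_def emb_add hc add sp M'.ev_add)
  have gscal: "g p (base_scalar C M c v) = base_scalar C M' c (g p v)" if "v \<in> homog M p" for p c v
    using that by (simp add: g_def emb_scalar hc scale sp M'.ev_psc)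
  have ggen: "g (p + 1) (gen i \<odot> v) = gen i \<odot>\<^bsub>M'\<^esub> g p v" if "v \<in> homog M p" "i \<in> N" for p i v
    using that by (simp add: g_def emb_gen hc T sp M'.ev_op)
  have ginj: "v = w" if "v \<in> homog M p" "w \<in> homog M p" "g p v = g p w" for p v w
  proof -
    have "\<phi> p (\<iota> u) = \<iota>' (g p u)" if "u \<in> homog M p" for u
      unfolding g_def by (rule M'.emb_ev[OF \<phi>sp[OF sp[OF that]], symmetric])
    then have "\<phi> p (\<iota> v) = \<phi> p (\<iota> w)"
      using that by simp
    then have "\<iota> v = \<iota> w"
      using bij_betw_imp_inj_on[OF bij] sp[OF that(1)] sp[OF that(2)] unfolding inj_on_def by blast
    then show ?thesis
      using emb_inj that(1,2) hc by blast
  qed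
  have gsurj: "\<exists>v\<in>homog M p. w = g p v" if "w \<in> homog M' p" for p w
  proof -
    have "\<iota>' w \<in> M'.sp p"
      using that by (simp add: M'.sp_def)
    then have "\<iota>' w \<in> \<phi> p ` sp p"
      unfolding bij_betw_imp_surj_on[OF bij] .
    then obtain x where "x \<in> sp p" "\<iota>' w = \<phi> p x"
      by blast
    moreover from this have "w = g p (ev x)"
      using M'.ev_emb[OF M'.hc[OF that]] by (simp add: g_def emb_ev)
    ultimately show ?thesis
      using ev_sp by blast
  qed
  have "\<forall>v\<in>carrier M. \<exists>v0 v1. v0 \<in> homog M 0 \<and> v1 \<in> homog M 1 \<and> v = v0 \<oplus> v1"
    using homog_decomp by metis
  then obtain c0 c1 where c: "\<And>v. v \<in> carrier M \<Longrightarrow> c0 v \<in> homog M 0 \<and> c1 v \<in> homog M 1 \<and> v = c0 v \<oplus> c1 v"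
    by metis
  define f where "f v = g 0 (c0 v) \<oplus>\<^bsub>M'\<^esub> g 1 (c1 v)" for v
  have f_eq: "f (v \<oplus> w) = g 0 v \<oplus>\<^bsub>M'\<^esub> g 1 w" if vw: "v \<in> homog M 0" "w \<in> homog M 1" for v w
  proof -
    have *: "v \<oplus> w \<in> carrier M"
      using vw hc by auto
    have "c0 (v \<oplus> w) = v" "c1 (v \<oplus> w) = w"
      using homog_decomp_unique[OF vw, of "c0 (v \<oplus> w)" "c1 (v \<oplus> w)"] c[OF *] by auto
    then show ?thesis
      by (simp add: f_def)
  qed
  have g0: "g p \<zero> = \<zero>\<^bsub>M'\<^esub>" for p
    using gadd[OF homog_closed(1) homog_closed(1), of p] M'.hc[OF gh[OF homog_closed(1), of p]] by simp
  have f_homog: "f v = g p v" if v: "v \<in> homog M p" for v p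
  proof (cases p)
    case zero
    then have "f (v \<oplus> \<zero>) = g 0 v \<oplus>\<^bsub>M'\<^esub> g 1 \<zero>"
      using v homog_closed(1) by (intro f_eq) auto
    then show ?thesis
      using zero v hc M'.hc[OF gh[OF v]] by (simp add: g0)
  next
    case one
    then have "f (\<zero> \<oplus> v) = g 0 \<zero> \<oplus>\<^bsub>M'\<^esub> g 1 v"
      using v homog_closed(1) by (intro f_eq) auto
    then show ?thesis
      using one v hc M'.hc[OF gh[OF v]] by (simp add: g0)
  qed
  have fc: "f v \<in> carrier M'" if "v \<in> carrier M" for v
    using c[OF that] M'.hc[OF gh] by (auto simp: f_def)
  have fadd: "f (v \<oplus> w) = f v \<oplus>\<^bsub>M'\<^esub> f w" if vw: "v \<in> carrier M" "w \<in> carrier M" for v w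
  proof -
    note cv = c[OF vw(1)] and cw = c[OF vw(2)]
    have "v \<oplus> w = (c0 v \<oplus> c1 v) \<oplus> (c0 w \<oplus> c1 w)"
      using cv cw by simp
    also have "\<dots> = (c0 v \<oplus> c0 w) \<oplus> (c1 v \<oplus> c1 w)"
      using hc cv cw by (intro M.add_interchange) blast+
    finally have "f (v \<oplus> w) = g 0 (c0 v \<oplus> c0 w) \<oplus>\<^bsub>M'\<^esub> g 1 (c1 v \<oplus> c1 w)"
      using cv cw homog_closed(2) by (simp only: f_eq)
    also have "\<dots> = (g 0 (c0 v) \<oplus>\<^bsub>M'\<^esub> g 0 (c0 w)) \<oplus>\<^bsub>M'\<^esub> (g 1 (c1 v) \<oplus>\<^bsub>M'\<^esub> g 1 (c1 w))"
      using cv cw by (simp only: gadd)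
    also have "\<dots> = f v \<oplus>\<^bsub>M'\<^esub> f w"
      unfolding f_def using M'.hc gh cv cw by (intro M'.M.add_interchange) blast+
    finally show ?thesis .
  qed
  have fscal: "f (base_scalar C M e v) = base_scalar C M' e (f v)" if v: "v \<in> carrier M" for e v
  proof -
    note cv = c[OF v]
    have "base_scalar C M e v = base_scalar C M e (c0 v) \<oplus> base_scalar C M e (c1 v)"
      using base_scalar_add[of "c0 v" "c1 v" e] cv hc by auto
    then have "f (base_scalar C M e v) = base_scalar C M' e (g 0 (c0 v)) \<oplus>\<^bsub>M'\<^esub> base_scalar C M' e (g 1 (c1 v))"
      using cv base_scalar_homog by (simp only: f_eq gscal)
    then show ?thesis
      using M'.base_scalar_add[of "g 0 (c0 v)" "g 1 (c1 v)" e] cv M'.hc[OF gh] by (simp only: f_def)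
  qed
  have fgen: "f (gen i \<odot> v) = gen i \<odot>\<^bsub>M'\<^esub> f v" if i: "i \<in> N" and v: "v \<in> carrier M" for i v
  proof -
    note cv = c[OF v]
    have c01: "c0 v \<in> carrier M" "c1 v \<in> carrier M"
      using cv hc by auto
    have h: "gen i \<odot> c0 v \<in> homog M (0 + 1)" "gen i \<odot> c1 v \<in> homog M (1 + 1)"
      using gen_smult_homog[OF i, of "c0 v" 0] gen_smult_homog[OF i, of "c1 v" 1] cv by blast+
    have "gen i \<odot> v = gen i \<odot> c0 v \<oplus> gen i \<odot> c1 v"
      using smult_r_distr[OF gen_closed[OF i] c01] cv by simp
    then have "f (gen i \<odot> v) = f (gen i \<odot> c0 v) \<oplus>\<^bsub>M'\<^esub> f (gen i \<odot> c1 v)"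
      using fadd gen_smult_closed[OF i] c01 by simp
    also have "f (gen i \<odot> c0 v) = gen i \<odot>\<^bsub>M'\<^esub> g 0 (c0 v)"
      using f_homog[OF h(1)] ggen[of "c0 v" 0 i] cv i by simp
    also have "f (gen i \<odot> c1 v) = gen i \<odot>\<^bsub>M'\<^esub> g 1 (c1 v)"
      using f_homog[OF h(2)] ggen[of "c1 v" 1 i] cv i by simp
    also have "gen i \<odot>\<^bsub>M'\<^esub> g 0 (c0 v) \<oplus>\<^bsub>M'\<^esub> gen i \<odot>\<^bsub>M'\<^esub> g 1 (c1 v) = gen i \<odot>\<^bsub>M'\<^esub> f v"
      using M'.smult_r_distr[OF gen_closed[OF i], of "g 0 (c0 v)" "g 1 (c1 v)"] M'.hc[OF gh] cv by (simp add: f_def)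
    finally show ?thesis .
  qed
  have "inj_on f (carrier M)"
  proof (rule inj_onI)
    fix v w assume vw: "v \<in> carrier M" "w \<in> carrier M" "f v = f w"
    note cv = c[OF vw(1)] and cw = c[OF vw(2)]
    have "g 0 (c0 v) \<oplus>\<^bsub>M'\<^esub> g 1 (c1 v) = g 0 (c0 w) \<oplus>\<^bsub>M'\<^esub> g 1 (c1 w)"
      using vw(3) by (simp add: f_def)
    from M'.homog_decomp_unique[OF _ _ _ _ this]
    have "g 0 (c0 v) = g 0 (c0 w)" "g 1 (c1 v) = g 1 (c1 w)"
      using cv cw gh by auto
    then have "c0 v = c0 w" "c1 v = c1 w"
      using ginj[of "c0 v" 0 "c0 w"] ginj[of "c1 v" 1 "c1 w"] cv cw by auto
    then show "v = w"
      using cv cw by metis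
  qed
  moreover have "f ` carrier M = carrier M'"
  proof (intro equalityI subsetI)
    fix w assume "w \<in> carrier M'"
    then obtain w0 w1 where w: "w0 \<in> homog M' 0" "w1 \<in> homog M' 1" "w = w0 \<oplus>\<^bsub>M'\<^esub> w1"
      by (rule M'.homog_decomp)
    then obtain v0 v1 where v: "v0 \<in> homog M 0" "w0 = g 0 v0" "v1 \<in> homog M 1" "w1 = g 1 v1"
      using gsurj by metis
    then have "w = f (v0 \<oplus> v1)"
      using w(3) f_eq by simp
    then show "w \<in> f ` carrier M"
      using v hc by auto
  qed (use fc in blast)
  ultimately have "bij_betw f (carrier M) (carrier M')"
    by (simp add: bij_betw_def)
  moreover have "f (a \<odot> v) = a \<odot>\<^bsub>M'\<^esub> f v" if "a \<in> carrier C" "v \<in> carrier M" for a v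
    by (rule smult_hom_induct[OF that(1) M'.supermodule_axioms that(2) fc fadd fscal fgen])
  moreover have "f ` homog M p = homog M' p" for p
  proof (intro equalityI subsetI)
    fix w assume "w \<in> homog M' p"
    then obtain v where "v \<in> homog M p" "w = g p v"
      using gsurj by blast
    then show "w \<in> f ` homog M p"
      using f_homog by auto
  qed (use f_homog gh in auto)
  ultimately show ?thesis
    unfolding supermodule_iso_def using fadd by blast
qed

subsection \<open>Dimensions\<close>

lemma ev_sum:
  assumes "finite F"
  shows "ev (\<Sum>x\<in>F. h x) = (\<Oplus>\<^bsub>M\<^esub>x\<in>F. ev (h x))"
  using assms by (induction F rule: finite_induct) (simp_all add: ev_zero ev_add M.finsum_insert)

text \<open>\<open>has_dim\<close> asks for unique coefficients with respect to an enumerated basis.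
  They are obtained from independence after reindexing sums along a bijection between
  \<open>{..<n}\<close> and \<open>B\<close>.\<close>

lemma has_dim_homog:
  assumes "dim_is (sp p) n"
  shows "has_dim C M (homog M p) n"
proof -
  obtain B where B: "finite B" "pm.independent B" "pm.span B = sp p" "card B = n"
    using assms by (auto simp: dim_is_def)
  obtain b where b: "bij_betw b {..<n} B"
    using ex_bij_betw_nat_finite[OF B(1)] B(4) by (auto simp: atLeast0LessThan)
  have bB: "b i \<in> B" if "i < n" for i
    using that b by (auto simp: bij_betw_def)
  have bsp: "b i \<in> sp p" if "i < n" for i
    using bB[OF that] B(3) pm.span_base by blast
  have sum_eq: "(\<Oplus>\<^bsub>M\<^esub>i\<in>{..<n}. (c i \<odot>\<^bsub>C\<^esub> \<one>\<^bsub>C\<^esub>) \<odot> ev (b i)) = ev (\<Sum>i<n. psc (c i) (b i))" for c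
    by (simp add: ev_sum ev_psc base_scalar_def)
  have sum_sp: "(\<Sum>i<n. psc (c i) (b i)) \<in> sp p" for c
    unfolding B(3)[symmetric] by (intro pm.span_sum pm.span_scale pm.span_base bB) simp
  have reidx: "(\<Sum>i<n. psc (c i) (b i)) = (\<Sum>v\<in>B. psc (c (the_inv_into {..<n} b v)) v)" for c
    using b the_inv_into_f_f[of b "{..<n}"] by (subst sum.reindex_bij_betw[OF b, symmetric]) (auto simp: bij_betw_def)
  have u: "\<exists>!c. c \<in> {..<n} \<rightarrow>\<^sub>E UNIV \<and> v = (\<Oplus>\<^bsub>M\<^esub>i\<in>{..<n}. (c i \<odot>\<^bsub>C\<^esub> \<one>\<^bsub>C\<^esub>) \<odot> ev (b i))"
    if v: "v \<in> homog M p" for v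
    unfolding sum_eq
  proof (rule ex_ex1I)
    have "\<iota> v \<in> pm.span B"
      unfolding B(3) using v by (simp add: sp_def)
    then obtain u where u: "\<iota> v = (\<Sum>x\<in>B. psc (u x) x)"
      unfolding pm.span_finite[OF B(1)] by blast
    have "\<iota> v = (\<Sum>i<n. psc (u (b i)) (b i))"
      unfolding u by (rule sum.reindex_bij_betw[OF b, symmetric])
    also have "\<dots> = (\<Sum>i<n. psc (restrict (\<lambda>i. u (b i)) {..<n} i) (b i))"
      by (intro sum.cong) auto
    finally have "v = ev (\<Sum>i<n. psc (restrict (\<lambda>i. u (b i)) {..<n} i) (b i))"
      using ev_emb[OF hc[OF v]] by simp
    then show "\<exists>c. c \<in> {..<n} \<rightarrow>\<^sub>E UNIV \<and> v = ev (\<Sum>i<n. psc (c i) (b i))"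
      by (intro exI[of _ "restrict (\<lambda>i. u (b i)) {..<n}"]) auto
  next
    fix c c' :: "nat \<Rightarrow> 'k"
    assume c: "c \<in> {..<n} \<rightarrow>\<^sub>E UNIV \<and> v = ev (\<Sum>i<n. psc (c i) (b i))"
      and c': "c' \<in> {..<n} \<rightarrow>\<^sub>E UNIV \<and> v = ev (\<Sum>i<n. psc (c' i) (b i))"
    then have "(\<Sum>i<n. psc (c i) (b i)) = (\<Sum>i<n. psc (c' i) (b i))"
      using emb_ev[OF sum_sp] by metis
    then have "(\<Sum>i<n. psc (c i - c' i) (b i)) = 0"
      by (simp add: pm.scale_left_diff_distrib sum_subtractf)
    then have 0: "(\<Sum>v\<in>B. psc (c (the_inv_into {..<n} b v) - c' (the_inv_into {..<n} b v)) v) = 0"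
      using reidx[of "\<lambda>i. c i - c' i"] by simp
    have "c i = c' i" if "i < n" for i
    proof -
      have "c (the_inv_into {..<n} b (b i)) - c' (the_inv_into {..<n} b (b i)) = 0"
        using pm.independentD[OF B(2,1) order.refl 0 bB[OF that]] .
      then show ?thesis
        using b that the_inv_into_f_f[of b "{..<n}" i] by (auto simp: bij_betw_def)
    qed
    then show "c = c'"
      using c c' by (intro PiE_ext[of c "{..<n}" "\<lambda>_. UNIV" c']) auto
  qed
  have m: "(\<lambda>i. ev (b i)) \<in> {..<n} \<rightarrow> homog M p"
    using bsp ev_sp by auto
  show ?thesis
    unfolding has_dim_def by (rule bexI[where x = "\<lambda>i. ev (b i)"], rule ballI, rule u, assumption, rule m)
qed

subsection \<open>Complete reducibility\<close>

text \<open>Choice functions \<open>f\<close> on the set of submodules correspond to choice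
  functions \<open>h\<close> on the independent family by \<open>f (sub_of U) = ev (h U)\<close>.
  Injectivity of \<open>sub_of\<close> on the family matches the index sets.\<close>

lemma completely_reducible_of_spanned:
  assumes "spanned_by_simples N op sp"
  shows "completely_reducible C M"
proof -
  interpret V: clmod N d op sp by (rule clmod)
  obtain \<G> where "(\<forall>U\<in>\<G>. graded_simple N op U \<and> U \<le> sp) \<and> independent_family \<G> \<and>
    (\<forall>p. sp p \<subseteq> pm.span (\<Union>U\<in>\<G>. U p))"
    using V.simple_decomposition[OF assms] by (rule exE)
  then have \<G>: "\<And>U. U \<in> \<G> \<Longrightarrow> graded_simple N op U \<and> U \<le> sp" "independent_family \<G>"
    "\<And>p. sp p \<subseteq> pm.span (\<Union>U\<in>\<G>. U p)"
    by simp_all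
  have st: "graded_stable N op U" "U \<le> sp" if "U \<in> \<G>" for U
    using \<G>(1)[OF that] by (auto simp: graded_simple_def)
  define \<S> where "\<S> = sub_of ` \<G>"
  have fam: "fam (sub_of U) = U" if "U \<in> \<G>" for U
    using fam_sub_of[OF st[OF that]] .
  have sub_inj: "inj_on sub_of \<G>"
    using fam by (metis inj_onI)
  have tot: "sub_of U = ev ` total_space U" for U
    by (force simp: sub_of_def total_space_def set_add_iff ev_add)
  have tot_sp: "x \<in> total_space sp" if "x \<in> total_space U" "U \<in> \<G>" for x U
    using that st(2)[OF that(2)] by (auto simp: total_space_def le_fun_def)
  have emb_ev_tot: "\<iota> (ev x) = x" if "x \<in> total_space sp" for x
    using that emb_ev ev_sp by (auto simp: total_space_def ev_add emb_add hc)
  have emb_tot: "\<iota> v \<in> total_space U" if "v \<in> sub_of U" "U \<in> \<G>" for v U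
    using that emb_ev_tot tot_sp unfolding tot by auto
  have finsum_eq: "(\<Oplus>\<^bsub>M\<^esub>S\<in>{S\<in>\<S>. f S \<noteq> \<zero>}. f S) =
      ev (\<Sum>U\<in>{U\<in>\<G>. h U \<noteq> 0}. h U)" and fin_eq: "finite {S\<in>\<S>. f S \<noteq> \<zero>} \<longleftrightarrow> finite {U\<in>\<G>. h U \<noteq> 0}"
    if "\<forall>U\<in>\<G>. h U \<in> total_space U \<and> f (sub_of U) = ev (h U)" for f h
  proof -
    note h = that[rule_format]
    have z: "f (sub_of U) = \<zero> \<longleftrightarrow> h U = 0" if "U \<in> \<G>" for U
      using h[OF that] emb_ev_tot[OF tot_sp[OF _ that], of "h U"] ev_zero emb_zero by metis
    have eq: "{S\<in>\<S>. f S \<noteq> \<zero>} = sub_of ` {U\<in>\<G>. h U \<noteq> 0}"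
      using z by (auto simp: \<S>_def)
    have inj: "inj_on sub_of {U\<in>\<G>. h U \<noteq> 0}"
      using sub_inj by (rule inj_on_subset) auto
    show fe: "finite {S\<in>\<S>. f S \<noteq> \<zero>} \<longleftrightarrow> finite {U\<in>\<G>. h U \<noteq> 0}"
      unfolding eq by (rule finite_image_iff[OF inj])
    show "(\<Oplus>\<^bsub>M\<^esub>S\<in>{S\<in>\<S>. f S \<noteq> \<zero>}. f S) = ev (\<Sum>U\<in>{U\<in>\<G>. h U \<noteq> 0}. h U)"
    \<comment> \<open>For an infinite index set both sums take their default value, zero.\<close>
    proof (cases "finite {U\<in>\<G>. h U \<noteq> 0}")
      case True
      have "(\<Oplus>\<^bsub>M\<^esub>S\<in>{S\<in>\<S>. f S \<noteq> \<zero>}. f S) = (\<Oplus>\<^bsub>M\<^esub>U\<in>{U\<in>\<G>. h U \<noteq> 0}. f (sub_of U))"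
        unfolding eq using h by (intro M.finsum_reindex inj) auto
      also have "\<dots> = (\<Oplus>\<^bsub>M\<^esub>U\<in>{U\<in>\<G>. h U \<noteq> 0}. ev (h U))"
        using h by (intro M.finsum_cong') auto
      finally show ?thesis
        using ev_sum[OF True] by simp
    qed (use fe in \<open>simp add: M.finsum_infinite ev_zero\<close>)
  qed
  have dec: "\<exists>!f. f \<in> (\<Pi>\<^sub>E S\<in>\<S>. S) \<and> finite {S\<in>\<S>. f S \<noteq> \<zero>} \<and> v = (\<Oplus>\<^bsub>M\<^esub>S\<in>{S\<in>\<S>. f S \<noteq> \<zero>}. f S)"
    if v: "v \<in> carrier M" for v
  proof -
    obtain v0 v1 where "v0 \<in> homog M 0" "v1 \<in> homog M 1" "v = v0 \<oplus> v1"
      using homog_decomp[OF v] .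
    then have tv: "\<iota> v \<in> total_space sp"
      by (auto simp: total_space_def sp_def emb_add hc)
    have "\<exists>!h. h \<in> (\<Pi>\<^sub>E U\<in>\<G>. total_space U) \<and> finite {U\<in>\<G>. h U \<noteq> 0} \<and> \<iota> v = (\<Sum>U\<in>{U\<in>\<G>. h U \<noteq> 0}. h U)"
      by (rule V.unique_decomposition[OF sp_inter _ \<G>(2) _ tv], rule \<G>(1), assumption, rule \<G>(3))
    then obtain h where h: "h \<in> (\<Pi>\<^sub>E U\<in>\<G>. total_space U) \<and> finite {U\<in>\<G>. h U \<noteq> 0} \<and> \<iota> v = (\<Sum>U\<in>{U\<in>\<G>. h U \<noteq> 0}. h U)"
      and uniq: "\<forall>h'. h' \<in> (\<Pi>\<^sub>E U\<in>\<G>. total_space U) \<and> finite {U\<in>\<G>. h' U \<noteq> 0} \<and>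
        \<iota> v = (\<Sum>U\<in>{U\<in>\<G>. h' U \<noteq> 0}. h' U) \<longrightarrow> h' = h"
      by (rule ex1E)
    note h = conjunct1[OF h] conjunct1[OF conjunct2[OF h]] conjunct2[OF conjunct2[OF h]]
    define f where "f = restrict (\<lambda>S. ev (h (fam S))) \<S>"
    have fh: "h U \<in> total_space U \<and> f (sub_of U) = ev (h U)" if "U \<in> \<G>" for U
      using that PiE_mem[OF h(1) that] by (simp add: f_def \<S>_def fam)
    then have fh_all: "\<forall>U\<in>\<G>. h U \<in> total_space U \<and> f (sub_of U) = ev (h U)"
      by (rule ballI)
    have fS: "f \<in> (\<Pi>\<^sub>E S\<in>\<S>. S)"
      using fh tot by (auto simp: \<S>_def f_def)
    have ffin: "finite {S\<in>\<S>. f S \<noteq> \<zero>}"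
      using fin_eq[OF fh_all] h(2) by simp
    have fv: "v = (\<Oplus>\<^bsub>M\<^esub>S\<in>{S\<in>\<S>. f S \<noteq> \<zero>}. f S)"
      unfolding finsum_eq[OF fh_all] h(3)[symmetric] using v by simp
    have "f' = f" if f': "f' \<in> (\<Pi>\<^sub>E S\<in>\<S>. S)" "finite {S\<in>\<S>. f' S \<noteq> \<zero>}"
      "v = (\<Oplus>\<^bsub>M\<^esub>S\<in>{S\<in>\<S>. f' S \<noteq> \<zero>}. f' S)" for f'
    proof -
      define h' where "h' = restrict (\<lambda>U. \<iota> (f' (sub_of U))) \<G>"
      have f'mem: "f' (sub_of U) \<in> sub_of U" if "U \<in> \<G>" for U
        using PiE_mem[OF f'(1), of "sub_of U"] that by (simp add: \<S>_def)
      have carr: "f' (sub_of U) \<in> carrier M" if "U \<in> \<G>" for U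
        using f'mem[OF that] unfolding tot by auto
      have fh': "h' U \<in> total_space U \<and> f' (sub_of U) = ev (h' U)" if "U \<in> \<G>" for U
        using that emb_tot[OF f'mem[OF that] that] carr[OF that] by (simp add: h'_def)
      then have fh'_all: "\<forall>U\<in>\<G>. h' U \<in> total_space U \<and> f' (sub_of U) = ev (h' U)"
        by (rule ballI)
      have fin': "finite {U\<in>\<G>. h' U \<noteq> 0}"
        using fin_eq[OF fh'_all] f'(2) by simp
      \<comment> \<open>Equality after \<open>ev\<close> does not determine the sum; first the sum
        must be seen to lie in \<open>total_space sp\<close>, where \<open>\<iota>\<close> inverts
        \<open>ev\<close>.\<close>
      have "(\<Sum>U\<in>{U\<in>\<G>. h' U \<noteq> 0}. h' U) = \<iota> (ev (\<Sum>U\<in>{U\<in>\<G>. h' U \<noteq> 0}. h' U))"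
      proof -
        have "\<exists>x y. x \<in> sp 0 \<and> y \<in> sp 1 \<and> h' U = x + y" if "U \<in> \<G>" for U
          using fh'[OF that] tot_sp[OF _ that] by (auto simp: total_space_def)
        then obtain x y where xy: "\<And>U. U \<in> \<G> \<Longrightarrow> x U \<in> sp 0 \<and> y U \<in> sp 1 \<and> h' U = x U + y U"
          by metis
        have "(\<Sum>U\<in>{U\<in>\<G>. h' U \<noteq> 0}. h' U) = (\<Sum>U\<in>{U\<in>\<G>. h' U \<noteq> 0}. x U) + (\<Sum>U\<in>{U\<in>\<G>. h' U \<noteq> 0}. y U)"
          unfolding sum.distrib[symmetric] using xy by (intro sum.cong) auto
        moreover have "(\<Sum>U\<in>{U\<in>\<G>. h' U \<noteq> 0}. x U) \<in> sp 0" "(\<Sum>U\<in>{U\<in>\<G>. h' U \<noteq> 0}. y U) \<in> sp 1"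
          using xy V.sub by (auto intro: pm.subspace_sum)
        ultimately have "(\<Sum>U\<in>{U\<in>\<G>. h' U \<noteq> 0}. h' U) \<in> total_space sp"
          unfolding total_space_def by blast
        then show ?thesis
          by (simp add: emb_ev_tot)
      qed
      then have "\<iota> v = (\<Sum>U\<in>{U\<in>\<G>. h' U \<noteq> 0}. h' U)"
        using f'(3) finsum_eq[OF fh'_all] by simp
      moreover have "h' \<in> (\<Pi>\<^sub>E U\<in>\<G>. total_space U)"
        using fh' by (auto simp: h'_def)
      ultimately have "h' = h"
        by (intro uniq[rule_format] conjI fin')
      then have "f' S = f S" if "S \<in> \<S>" for S
        using that fh fh' by (auto simp: \<S>_def)
      then show ?thesis
        by (rule PiE_ext[OF f'(1) fS])
    qed
    then show ?thesis
      using fS ffin fv by (intro ex1I[of _ f] conjI) blast+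
  qed
  have simple: "graded_submodule C M S \<and> simple_supermodule C (submodule_on M S)" if S: "S \<in> \<S>" for S
  proof -
    obtain U where U: "U \<in> \<G>" "S = sub_of U"
      using S by (auto simp: \<S>_def)
    show ?thesis
      unfolding U(2) using graded_submodule_sub_of[OF st[OF U(1)]] simple_sub_of[OF st[OF U(1)]] \<G>(1)[OF U(1)] by simp
  qed
  show ?thesis
    unfolding completely_reducible_def
    by (rule exI[where x = \<S>], intro conjI ballI) (rule simple[THEN conjunct1] simple[THEN conjunct2] dec; assumption)+
qed

end

section \<open>A nonzero module\<close>

text \<open>
  The Jordan-Wigner representation: the basis of the exterior algebra is indexed by the finite
  sets of natural numbers, which are encoded as natural numbers.
\<close>

definition flip :: "nat \<Rightarrow> nat \<Rightarrow> nat" where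
  "flip i x = set_encode (if i \<in> set_decode x then set_decode x - {i} else insert i (set_decode x))"

text \<open>The sign is the parity of the number of smaller elements, and the weights 1 and
  \<open>d i\<close> multiply to the square of the generator. For \<open>d i = 0\<close> the
  operator is made zero altogether instead of merely nilpotent, so that a subspace stable under the
  other generators is stable under all.\<close>

definition jw_coeff :: "(nat \<Rightarrow> 'k::field) \<Rightarrow> nat \<Rightarrow> nat \<Rightarrow> 'k" where
  "jw_coeff d i x = (if d i = 0 then 0 else
     (- 1) ^ card {j \<in> set_decode x. j < i} * (if i \<in> set_decode x then 1 else d i))"

definition jw :: "(nat \<Rightarrow> 'k::field) \<Rightarrow> nat \<Rightarrow> (nat \<Rightarrow> 'k) \<Rightarrow> nat \<Rightarrow> 'k" where
  "jw d i g x = jw_coeff d i x * g (flip i x)"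

definition jw_homog :: "bit \<Rightarrow> (nat \<Rightarrow> 'k::field) set" where
  "jw_homog p = {g. \<forall>x. g x \<noteq> 0 \<longrightarrow> of_nat (card (set_decode x)) = p}"

lemma decode_flip:
  "set_decode (flip i x) = (if i \<in> set_decode x then set_decode x - {i} else insert i (set_decode x))"
  by (simp add: flip_def)

lemma flip_flip [simp]: "flip i (flip i x) = x"
proof -
  have "set_decode (flip i (flip i x)) = set_decode x"
    by (auto simp: decode_flip)
  then show ?thesis
    using set_decode_inverse by metis
qed

lemma flip_commute: "flip i (flip j x) = flip j (flip i x)"
proof -
  have "set_decode (flip i (flip j x)) = set_decode (flip j (flip i x))"
    by (auto simp: decode_flip)
  then show ?thesis
    using set_decode_inverse by metis
qed

lemma parity_flip: "(of_nat (card (set_decode (flip i x))) :: bit) = of_nat (card (set_decode x)) + 1"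
proof (cases "i \<in> set_decode x")
  case True
  then have "card (set_decode x) = Suc (card (set_decode x - {i}))"
    by (intro card.remove) auto
  then show ?thesis
    using True by (simp add: decode_flip)
next
  case False
  then show ?thesis
    by (simp add: decode_flip)
qed

lemma jw_coeff_same: "jw_coeff d i x * jw_coeff d i (flip i x) = d i"
proof -
  have "{j \<in> set_decode (flip i x). j < i} = {j \<in> set_decode x. j < i}"
    by (auto simp: decode_flip)
  then show ?thesis
    by (simp add: jw_coeff_def decode_flip flip: power_add)
qed

text \<open>This asymmetry produces anticommutation: changing the larger index leaves the sign at
  the smaller one alone, while changing the smaller index reverses the sign at the larger
  one.\<close>

lemma jw_coeff_less:
  assumes "i < j"
  shows "jw_coeff d i (flip j x) = jw_coeff d i x" "jw_coeff d j (flip i x) = - jw_coeff d j x"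
proof -
  have "{k \<in> set_decode (flip j x). k < i} = {k \<in> set_decode x. k < i}"
    using assms by (auto simp: decode_flip)
  then show "jw_coeff d i (flip j x) = jw_coeff d i x"
    using assms by (simp add: jw_coeff_def decode_flip)
  let ?S = "{k \<in> set_decode x. k < j}"
  have S: "{k \<in> set_decode (flip i x). k < j} = (if i \<in> ?S then ?S - {i} else insert i ?S)"
    using assms by (auto simp: decode_flip)
  have "(- 1 :: 'a) ^ card (if i \<in> ?S then ?S - {i} else insert i ?S) = - ((- 1) ^ card ?S)"
  proof (cases "i \<in> ?S")
    case True
    have "card ?S = Suc (card (?S - {i}))"
      using True by (intro card.remove) auto
    then show ?thesis
      unfolding if_P[OF True] by (simp only: power_Suc) simp
  next
    case False
    have "card (insert i ?S) = Suc (card ?S)"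
      using False by (intro card_insert_disjoint) auto
    then show ?thesis
      unfolding if_not_P[OF False] by (simp only: power_Suc) simp
  qed
  then have "(- 1 :: 'a) ^ card {k \<in> set_decode (flip i x). k < j} = - ((- 1) ^ card ?S)"
    by (simp only: S)
  then show "jw_coeff d j (flip i x) = - jw_coeff d j x"
    using assms unfolding jw_coeff_def by (simp add: decode_flip)
qed

lemma jw_relation: "jw d i (jw d j g) x + jw d j (jw d i g) x = (if i = j then 2 * d i else 0) * g x"
proof (cases i j rule: linorder_cases)
  case equal
  then show ?thesis
    using jw_coeff_same[of d i x] by (simp add: jw_def mult.assoc[symmetric] distrib_right[symmetric])
next
  case less
  then show ?thesis
    using jw_coeff_less[OF less, of d x] by (simp add: jw_def flip_commute[of i j])
next
  case greater
  then show ?thesis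
    using jw_coeff_less[OF greater, of d x] by (simp add: jw_def flip_commute[of i j])
qed

lemma jw_add: "jw d i (\<lambda>x. g x + h x) = (\<lambda>x. jw d i g x + jw d i h x)"
  by (simp add: jw_def distrib_left fun_eq_iff)

lemma jw_homog_closed: "g \<in> jw_homog p \<Longrightarrow> jw d i g \<in> jw_homog (p + 1)"
proof -
  assume g: "g \<in> jw_homog p"
  have "of_nat (card (set_decode x)) = p + 1" if "jw d i g x \<noteq> 0" for x
  proof -
    have "of_nat (card (set_decode (flip i x))) = p"
      using that g by (auto simp: jw_def jw_homog_def)
    then have "of_nat (card (set_decode x)) + 1 = p"
      unfolding parity_flip .
    then show ?thesis
      using bit_add_one_one by metis
  qed
  then show ?thesis
    by (simp add: jw_homog_def)
qed

section \<open>Action of the free algebra and of the Clifford superalgebra\<close>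

definition jw_word :: "(nat \<Rightarrow> 'k::field) \<Rightarrow> nat free_mon \<Rightarrow> (nat \<Rightarrow> 'k) \<Rightarrow> nat \<Rightarrow> 'k" where
  "jw_word d w g = foldr (jw d) (letters w) g"

definition jw_act :: "(nat \<Rightarrow> 'k::field) \<Rightarrow> 'k free_elt \<Rightarrow> (nat \<Rightarrow> 'k) \<Rightarrow> nat \<Rightarrow> 'k" where
  "jw_act d f g x = (\<Sum>w\<in>Poly_Mapping.keys f. Poly_Mapping.lookup f w * jw_word d w g x)"

lemma jw_act_eq:
  assumes "finite F" "Poly_Mapping.keys f \<subseteq> F"
  shows "jw_act d f g x = (\<Sum>w\<in>F. Poly_Mapping.lookup f w * jw_word d w g x)"
  unfolding jw_act_def using assms by (intro sum.mono_neutral_left) (auto simp: in_keys_iff)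

lemma jw_act_add: "jw_act d (f + f') g x = jw_act d f g x + jw_act d f' g x"
proof -
  let ?F = "Poly_Mapping.keys f \<union> Poly_Mapping.keys f'"
  have "jw_act d (f + f') g x = (\<Sum>w\<in>?F. Poly_Mapping.lookup (f + f') w * jw_word d w g x)"
    using keys_add[of f f'] by (intro jw_act_eq) auto
  also have "\<dots> = jw_act d f g x + jw_act d f' g x"
    by (simp add: lookup_add distrib_right sum.distrib jw_act_eq[of ?F f] jw_act_eq[of ?F f'])
  finally show ?thesis .
qed

lemma jw_act_single: "jw_act d (Poly_Mapping.single w c) g x = c * jw_word d w g x"
  by (subst jw_act_eq[of "{w}"]) auto

lemma jw_act_const: "jw_act d (free_const c) g x = c * g x"
  by (simp add: free_const_def jw_act_single jw_word_def zero_free_mon_def)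

lemma jw_act_gen: "jw_act d (free_gen i) g = jw d i g"
  by (rule ext) (simp add: free_gen_def jw_act_single jw_word_def)

lemma poly_mapping_single_induct [case_names zero single add]:
  assumes "P 0" "\<And>w c. P (Poly_Mapping.single w c)" "\<And>f g. P f \<Longrightarrow> P g \<Longrightarrow> P (f + g)"
  shows "P (f :: 'a \<Rightarrow>\<^sub>0 'b::monoid_add)"
proof (induction f rule: update_induct)
  case (update g w c)
  have "Poly_Mapping.update w c g = Poly_Mapping.single w c + g"
    using update(1) by (intro poly_mapping_eqI)
       (auto simp: lookup_update lookup_add lookup_single in_keys_iff when_def)
  then show ?case
    using assms update by simp
qed (rule assms(1))

lemma jw_act_gen_mult: "jw_act d (free_gen i * f) g = jw d i (jw_act d f g)"
proof (induction f rule: poly_mapping_single_induct)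
  case zero
  then show ?case
    by (simp add: jw_act_def jw_def fun_eq_iff)
next
  case (single w c)
  have "free_gen i * Poly_Mapping.single w c = Poly_Mapping.single (Word (i # letters w)) c"
    by (simp add: free_gen_def Poly_Mapping.mult_single plus_free_mon_def)
  then show ?case
    by (simp add: jw_act_single jw_word_def jw_def fun_eq_iff mult.left_commute)
next
  case (add f f')
  then show ?case
    by (simp add: distrib_left jw_act_add fun_eq_iff) (simp add: jw_def jw_act_add distrib_left)
qed

lemma jw_act_const_mult: "jw_act d (free_const c * f) g x = c * jw_act d f g x"
proof (induction f rule: poly_mapping_single_induct)
  case (single w c')
  have "free_const c * Poly_Mapping.single w c' = Poly_Mapping.single w (c * c')"
    by (simp add: free_const_def Poly_Mapping.mult_single)
  then show ?case
    by (simp add: jw_act_single)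
qed (simp_all add: jw_act_def[of _ 0] distrib_left jw_act_add)

lemma jw_act_mult: "jw_act d (f * h) g = jw_act d f (jw_act d h g)"
proof -
  have "f \<in> carrier (free_algebra UNIV)"
    by (simp add: free_algebra_carrier)
  then show ?thesis
  proof (induction f rule: free_elt_induct)
    case (const c)
    then show ?case
      by (simp add: fun_eq_iff jw_act_const_mult jw_act_const)
  next
    case (gen_mult i f)
    then show ?case
      by (simp add: mult.assoc jw_act_gen_mult)
  next
    case (add f f')
    then show ?case
      by (simp add: fun_eq_iff distrib_right jw_act_add)
  qed
qed

lemma jw_act_right_add: "jw_act d f (\<lambda>x. g x + h x) = (\<lambda>x. jw_act d f g x + jw_act d f h x)"
proof -
  have "jw_word d w (\<lambda>x. g x + h x) = (\<lambda>x. jw_word d w g x + jw_word d w h x)" for w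
  proof -
    have "foldr (jw d) xs (\<lambda>x. g x + h x) = (\<lambda>x. foldr (jw d) xs g x + foldr (jw d) xs h x)" for xs
      by (induction xs) (simp_all add: jw_add)
    then show ?thesis
      by (simp add: jw_word_def)
  qed
  then show ?thesis
    by (simp add: jw_act_def fun_eq_iff distrib_left sum.distrib)
qed

lemma jw_act_minus: "jw_act d (- f) g x = - jw_act d f g x"
  using jw_act_add[of d f "- f" g x] by (simp add: jw_act_def[of _ 0] eq_neg_iff_add_eq_0 add.commute)

lemma jw_act_diff: "jw_act d (f - f') g x = jw_act d f g x - jw_act d f' g x"
  using jw_act_add[of d f "- f'" g x] by (simp add: jw_act_minus)

lemma jw_act_homog:
  assumes f: "f \<in> free_homog N i" and g: "g \<in> jw_homog j"
  shows "jw_act d f g \<in> jw_homog (i + j)"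
proof -
  have word: "foldr (jw d) xs g \<in> jw_homog (of_nat (length xs) + j)" for xs
  proof (induction xs)
    case (Cons i xs)
    then show ?case
      using jw_homog_closed[OF Cons, of d i] by (simp add: ac_simps)
  qed (simp add: g)
  have "of_nat (card (set_decode x)) = i + j" if nz: "jw_act d f g x \<noteq> 0" for x
  proof -
    obtain w where w: "w \<in> Poly_Mapping.keys f" "jw_word d w g x \<noteq> 0"
      using nz unfolding jw_act_def by (metis (no_types, lifting) mult_zero_right sum.neutral)
    then show ?thesis
      using word[of "letters w"] f by (auto simp: jw_word_def jw_homog_def free_homog_def)
  qed
  then show ?thesis
    by (simp add: jw_homog_def)
qed

text \<open>The elements acting by zero form a two-sided ideal: multiplication on the right only
  changes the argument, and multiplication on the left is applied to zero. The relations belong to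
  it.\<close>

lemma jw_act_ideal:
  fixes d :: "nat \<Rightarrow> 'k::field"
  assumes f: "f \<in> cliff_ideal N d"
  shows "jw_act d f g = (\<lambda>_. 0)"
proof -
  let ?F = "free_algebra N :: 'k free_elt ring"
  interpret F: ring ?F by (rule ring_free_algebra)
  define J where "J = {f \<in> carrier ?F. \<forall>g. jw_act d f g = (\<lambda>_. 0)}"
  have inv: "\<ominus>\<^bsub>?F\<^esub> f = - f" if "f \<in> carrier ?F" for f
    using that by (intro F.minus_equality) (auto simp: free_algebra_carrier)
  have zero: "jw_act d h (\<lambda>_. 0) = (\<lambda>_. 0)" for h
  proof
    fix x
    have "jw_act d h (\<lambda>_. 0) x = jw_act d h (\<lambda>_. 0) x + jw_act d h (\<lambda>_. 0) x"
      using fun_cong[OF jw_act_right_add[of d h "\<lambda>_. 0" "\<lambda>_. 0"], of x] by (simp only: add_0)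
    then show "jw_act d h (\<lambda>_. 0) x = 0"
      by (metis add_cancel_right_right)
  qed
  have "ideal J ?F"
  proof (rule idealI)
    show "subgroup J (add_monoid ?F)"
    proof
      fix f h assume "f \<in> J" "h \<in> J"
      then show "f \<otimes>\<^bsub>add_monoid ?F\<^esub> h \<in> J"
        by (auto simp: J_def free_carrier_closed fun_eq_iff jw_act_add)
      show "inv\<^bsub>add_monoid ?F\<^esub> f \<in> J"
        using \<open>f \<in> J\<close> inv[of f] by (auto simp: J_def a_inv_def free_carrier_closed fun_eq_iff jw_act_minus)
    qed (auto simp: J_def free_algebra_carrier jw_act_def)
  next
    fix a h assume "a \<in> J" "h \<in> carrier ?F"
    then show "h \<otimes>\<^bsub>?F\<^esub> a \<in> J" "a \<otimes>\<^bsub>?F\<^esub> h \<in> J"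
      by (auto simp: J_def free_carrier_closed jw_act_mult zero)
  qed (rule ring_free_algebra)
  moreover have "cliff_rels N d \<subseteq> J"
  proof
    fix r assume r: "r \<in> cliff_rels N d"
    then obtain i j where "r = free_gen i * free_gen j + free_gen j * free_gen i
        - free_const (if i = j then 2 * d i else 0)" by (auto simp: cliff_rels_def)
    then have "jw_act d r g x = 0" for g x
      using jw_relation[of d i j g x]
      by (simp add: jw_act_diff jw_act_add jw_act_const jw_act_gen_mult jw_act_gen del: if_split)
    then show "r \<in> J"
      using r cliff_rels_carrier[of N d] by (auto simp: J_def fun_eq_iff)
  qed
  ultimately have "cliff_ideal N d \<subseteq> J"
    unfolding cliff_ideal_def by (rule F.genideal_minimal)
  with f show ?thesis
    by (auto simp: J_def)
qed

definition jw_module :: "nat set \<Rightarrow> (nat \<Rightarrow> 'k::field) \<Rightarrow> ('k free_elt set, nat \<Rightarrow> 'k) graded" where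
  "jw_module N d =
     \<lparr>carrier = UNIV, monoid.mult = (\<lambda>_ _ _. 0), one = (\<lambda>_. 0), ring.zero = (\<lambda>_. 0),
      add = (\<lambda>g h x. g x + h x),
      Module.module.smult = (\<lambda>a. jw_act d (SOME f. f \<in> carrier (free_algebra N) \<and> a = cl_class N d f)),
      homog = jw_homog\<rparr>"

lemma jw_module_sel:
  "carrier (jw_module N d) = UNIV" "ring.zero (jw_module N d) = (\<lambda>_. 0)"
  "ring.add (jw_module N d) = (\<lambda>g h x. g x + h x)" "homog (jw_module N d) = jw_homog"
  by (simp_all add: jw_module_def)

lemma jw_module_smult:
  assumes f: "f \<in> carrier (free_algebra N)"
  shows "cl_class N d f \<odot>\<^bsub>jw_module N d\<^esub> g = jw_act d f g"
proof -
  define h where "h = (SOME h. h \<in> carrier (free_algebra N) \<and> cl_class N d f = cl_class N d h)"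
  have "h \<in> carrier (free_algebra N) \<and> cl_class N d f = cl_class N d h"
    unfolding h_def by (rule someI[of _ f]) (simp add: f)
  then have "f - h \<in> cliff_ideal N d"
    using cl_class_eqD f by blast
  then have "jw_act d f g = jw_act d h g"
    using jw_act_ideal[of "f - h" N d g] by (simp add: fun_eq_iff jw_act_diff)
  then show ?thesis
    by (simp add: jw_module_def h_def)
qed

theorem supermodule_jw: "supermodule (clifford N d) (jw_module N d)"
proof -
  let ?M = "jw_module N d"
  have ab: "abelian_group ?M"
  proof (rule abelian_groupI)
    fix g :: "nat \<Rightarrow> 'a"
    show "\<exists>h\<in>carrier ?M. h \<oplus>\<^bsub>?M\<^esub> g = \<zero>\<^bsub>?M\<^esub>"
      by (intro bexI[of _ "\<lambda>x. - g x"]) (simp_all add: jw_module_sel)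
  qed (simp_all add: jw_module_sel add_ac)
  interpret M: abelian_group ?M by (rule ab)
  have inv: "\<ominus>\<^bsub>?M\<^esub> g = (\<lambda>x. - g x)" for g
    by (rule M.minus_equality) (simp_all add: jw_module_sel)
  have split: "\<exists>s\<in>jw_homog 0. \<exists>t\<in>jw_homog 1. g = (\<lambda>x. s x + t x)" for g :: "nat \<Rightarrow> 'a"
  proof (intro bexI)
    let ?s = "\<lambda>p x. if of_nat (card (set_decode x)) = (p :: bit) then g x else 0"
    show "g = (\<lambda>x. ?s 0 x + ?s 1 x)"
      by (auto simp: fun_eq_iff)
    show "?s 0 \<in> jw_homog 0" "?s 1 \<in> jw_homog 1"
      by (auto simp: jw_homog_def split: if_splits)
  qed
  show ?thesis
  proof (intro supermodule.intro supermodule_axioms.intro superalgebra_clifford ab)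
    fix a v assume a: "a \<in> carrier (clifford N d)"
    show "a \<odot>\<^bsub>?M\<^esub> v \<in> carrier ?M"
      by (simp add: jw_module_sel)
    obtain f where f: "f \<in> carrier (free_algebra N)" "a = cl_class N d f"
      using cl_class_surj[OF a] by blast
    show "a \<odot>\<^bsub>?M\<^esub> (v \<oplus>\<^bsub>?M\<^esub> w) = a \<odot>\<^bsub>?M\<^esub> v \<oplus>\<^bsub>?M\<^esub> a \<odot>\<^bsub>?M\<^esub> w" for w
      by (simp add: f jw_module_smult jw_module_sel jw_act_right_add)
    fix b assume "b \<in> carrier (clifford N d)"
    then obtain h where h: "h \<in> carrier (free_algebra N)" "b = cl_class N d h"
      using cl_class_surj by blast
    show "(a \<oplus>\<^bsub>clifford N d\<^esub> b) \<odot>\<^bsub>?M\<^esub> v = a \<odot>\<^bsub>?M\<^esub> v \<oplus>\<^bsub>?M\<^esub> b \<odot>\<^bsub>?M\<^esub> v"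
      using f h jw_module_smult[OF free_carrier_closed(1)[OF f(1) h(1)], of d v]
      by (simp add: jw_module_smult jw_module_sel cl_class_add jw_act_add fun_eq_iff)
    show "(a \<otimes>\<^bsub>clifford N d\<^esub> b) \<odot>\<^bsub>?M\<^esub> v = a \<odot>\<^bsub>?M\<^esub> (b \<odot>\<^bsub>?M\<^esub> v)"
      using f h jw_module_smult[OF free_carrier_closed(2)[OF f(1) h(1)], of d v]
      by (simp add: jw_module_smult cl_class_mult jw_act_mult)
  next
    fix v :: "nat \<Rightarrow> 'a"
    have "(1 :: 'a free_elt) \<in> carrier (free_algebra N)"
      using free_const_carrier[of 1 N] by (simp add: free_const_simps)
    then have "cl_class N d 1 \<odot>\<^bsub>?M\<^esub> v = jw_act d 1 v"
      by (rule jw_module_smult)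
    also have "\<dots> = v"
      using jw_act_const[of d 1 v] by (simp add: free_const_simps fun_eq_iff)
    finally show "\<one>\<^bsub>clifford N d\<^esub> \<odot>\<^bsub>?M\<^esub> v = v"
      by (simp add: cl_class_one)
  next
    fix p
    show "additive_subgroup (homog ?M p) ?M"
    proof (rule additive_subgroup.intro, rule subgroup.intro)
      fix x y assume xy: "x \<in> homog ?M p" "y \<in> homog ?M p"
      then show "x \<otimes>\<^bsub>add_monoid ?M\<^esub> y \<in> homog ?M p"
        by (auto simp: jw_module_sel jw_homog_def) (metis add.right_neutral)
      show "inv\<^bsub>add_monoid ?M\<^esub> x \<in> homog ?M p"
        using xy(1) inv[of x] by (simp add: a_inv_def jw_module_sel jw_homog_def)
    qed (auto simp: jw_module_sel jw_homog_def)
  next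
    show "carrier ?M = homog ?M 0 <+>\<^bsub>?M\<^esub> homog ?M 1"
      using split by (auto simp: jw_module_sel set_add_defs)
  next
    have "g = (\<lambda>_. 0)" if "g \<in> jw_homog 0" "g \<in> jw_homog 1" for g :: "nat \<Rightarrow> 'a"
    proof
      fix x
      show "g x = 0"
        using that by (cases "g x = 0") (auto simp: jw_homog_def)
    qed
    moreover have "(\<lambda>_. 0) \<in> (jw_homog p :: (nat \<Rightarrow> 'a) set)" for p
      by (simp add: jw_homog_def)
    ultimately show "homog ?M 0 \<inter> homog ?M 1 = {\<zero>\<^bsub>?M\<^esub>}"
      by (auto simp: jw_module_sel)
  next
    fix a v i j assume "a \<in> homog (clifford N d) i" "v \<in> homog ?M j"
    then obtain f where f: "f \<in> free_homog N i" "a = cl_class N d f" "v \<in> jw_homog j"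
      by (auto simp: clifford_sel jw_module_sel)
    moreover have "f \<in> carrier (free_algebra N)"
      using f by (simp add: free_homog_def)
    ultimately show "a \<odot>\<^bsub>?M\<^esub> v \<in> homog ?M (i + j)"
      using jw_act_homog[OF f(1,3), of d] by (simp add: jw_module_smult jw_module_sel)
  qed
qed

lemma jw_zero_gen:
  assumes "i \<in> N" "d i = 0"
  shows "cl_class N d (free_gen i) \<odot>\<^bsub>jw_module N d\<^esub> g = (\<lambda>_. 0)"
  using assms by (simp add: jw_module_smult free_gen_carrier jw_act_gen jw_def jw_coeff_def fun_eq_iff)

section \<open>Binary forms over the rational function field\<close>

lemma prod_linear_dvd:
  fixes p :: "'a::field poly"
  assumes "finite S" "\<And>a. a \<in> S \<Longrightarrow> poly p a = 0"
  shows "(\<Prod>a\<in>S. [:- a, 1:]) dvd p"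
  using assms
proof (induction S rule: finite_induct)
  case (insert b S)
  then obtain r where r: "p = (\<Prod>a\<in>S. [:- a, 1:]) * r"
    by (auto simp: dvd_def)
  have "poly (\<Prod>a\<in>S. [:- a, 1:]) b \<noteq> 0"
    using insert.hyps by (auto simp: poly_prod)
  then have "poly r b = 0"
    using insert.prems[of b] unfolding r by simp
  then have "[:- b, 1:] dvd r"
    by (simp add: poly_eq_0_iff_dvd)
  then have "[:- b, 1:] * (\<Prod>a\<in>S. [:- a, 1:]) dvd r * (\<Prod>a\<in>S. [:- a, 1:])"
    by (rule mult_dvd_mono) simp
  then show ?case
    unfolding r prod.insert[OF insert.hyps] by (simp only: mult.commute[of r])
qed simp

text \<open>Newton interpolation: a multiple of the product over the old nodes corrects the value at
  the new one. The degree bound drives the descent that follows.\<close>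

lemma interpolation_exists:
  fixes f :: "'a::field \<Rightarrow> 'a"
  assumes "finite S" "S \<noteq> {}"
  shows "\<exists>r. degree r < card S \<and> (\<forall>a\<in>S. poly r a = f a)"
  using assms
proof (induction S rule: finite_ne_induct)
  case (singleton a)
  then show ?case
    by (intro exI[of _ "[:f a:]"]) simp
next
  case (insert b S)
  then obtain r where r: "degree r < card S" "\<forall>a\<in>S. poly r a = f a"
    by blast
  let ?P = "\<Prod>a\<in>S. [:- a, 1:]"
  have P: "poly ?P b \<noteq> 0" "\<And>a. a \<in> S \<Longrightarrow> poly ?P a = 0"
    using insert.hyps by (auto simp: poly_prod)
  have degP: "degree ?P = card S"
    by (subst degree_prod_eq_sum_degree) auto
  let ?c = "(f b - poly r b) / poly ?P b"
  have "degree (r + smult ?c ?P) \<le> card S"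
    using r(1) degP degree_smult_le[of ?c ?P] by (intro degree_add_le) auto
  then show ?case
    using insert.hyps r(2) P by (intro exI[of _ "r + smult ?c ?P"]) auto
qed

text \<open>
  Legendre's descent. Every polynomial is a square modulo a squarefree polynomial, since the
  residue fields are equal to the complex numbers.
\<close>

lemma ternary_form_isotropic:
  fixes a b :: "complex poly"
  assumes "a \<noteq> 0" "b \<noteq> 0"
  shows "\<exists>x y z. (x \<noteq> 0 \<or> y \<noteq> 0 \<or> z \<noteq> 0) \<and> a * x\<^sup>2 + b * y\<^sup>2 = z\<^sup>2"
  using assms
proof (induction "degree a + degree b" arbitrary: a b rule: less_induct)
  case less
  \<comment> \<open>By symmetry \<open>b\<close> may be taken as the coefficient of smaller or equal
    degree; it stays fixed while the degree of \<open>a\<close> is lowered.\<close>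
  have main: "\<exists>x y z. (x \<noteq> 0 \<or> y \<noteq> 0 \<or> z \<noteq> 0) \<and> a * x\<^sup>2 + b * y\<^sup>2 = z\<^sup>2"
    if ab: "a \<noteq> 0" "b \<noteq> 0" "degree b \<le> degree a"
      and IH: "\<And>a'. degree a' < degree a \<Longrightarrow> a' \<noteq> 0 \<Longrightarrow>
        \<exists>x y z. (x \<noteq> 0 \<or> y \<noteq> 0 \<or> z \<noteq> 0) \<and> a' * x\<^sup>2 + b * y\<^sup>2 = z\<^sup>2" for a b :: "complex poly"
  proof -
    consider "degree a = 0" | "degree a > 0" "\<not> rsquarefree a" | "degree a > 0" "rsquarefree a"
      by blast
    then show ?thesis
    proof cases
      case 1
      then obtain c where c: "a = [:c:]"
        by (rule degree_eq_zeroE)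
      have "csqrt c * csqrt c = c"
        by (metis power2_csqrt power2_eq_square)
      then have "a * 1\<^sup>2 + b * 0\<^sup>2 = [:csqrt c:]\<^sup>2"
        by (simp add: c power2_eq_square)
      then show ?thesis
        by (intro exI[of _ 1] exI[of _ 0] exI[of _ "[:csqrt c:]"]) simp
    next
      case 2
      then obtain t where t: "order t a \<noteq> 0" "order t a \<noteq> 1"
        using ab(1) by (auto simp: rsquarefree_def)
      let ?s = "[:- t, 1:]"
      have "?s ^ 2 dvd a"
        using t by (auto simp: order_divides)
      then obtain a' where a': "a = ?s\<^sup>2 * a'"
        by (auto simp: dvd_def)
      have "a' \<noteq> 0"
        using ab(1) a' by auto
      have "degree (?s\<^sup>2) = 2"
        by (simp add: degree_power_eq)
      then have "degree a = 2 + degree a'"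
        using a' \<open>a' \<noteq> 0\<close> degree_mult_eq[of "?s\<^sup>2" a'] by simp
      then obtain x y z where xyz: "x \<noteq> 0 \<or> y \<noteq> 0 \<or> z \<noteq> 0" "a' * x\<^sup>2 + b * y\<^sup>2 = z\<^sup>2"
        using IH[of a'] \<open>a' \<noteq> 0\<close> by auto
      have "a * x\<^sup>2 + b * (?s * y)\<^sup>2 = ?s\<^sup>2 * (a' * x\<^sup>2 + b * y\<^sup>2)"
        unfolding a' by (simp only: power_mult_distrib distrib_left mult_ac)
      then have "a * x\<^sup>2 + b * (?s * y)\<^sup>2 = (?s * z)\<^sup>2"
        unfolding xyz(2) by (simp only: power_mult_distrib)
      then show ?thesis
        using xyz(1) by (intro exI[of _ x] exI[of _ "?s * y"] exI[of _ "?s * z"]) (simp del: mult_pCons_left)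
    next
      case 3
      let ?S = "{t. poly a t = 0}"
      have S: "finite ?S"
        using ab(1) by (rule poly_roots_finite)
      have dec: "smult (lead_coeff a) (\<Prod>t\<in>?S. [:- t, 1:]) = a"
        using complex_poly_decompose_rsquarefree[OF 3(2)] .
      have deg: "degree a = card ?S"
      proof -
        have "degree (smult (lead_coeff a) (\<Prod>t\<in>?S. [:- t, 1:])) = card ?S"
          using ab(1) by (simp add: degree_prod_eq_sum_degree)
        then show ?thesis
          unfolding dec .
      qed
      then have "?S \<noteq> {}"
        using 3(1) by (metis card.empty less_irrefl)
      \<comment> \<open>\<open>r\<close> is a square root of \<open>b\<close> modulo
        \<open>a\<close>, prescribed at each of the \<open>degree a\<close> roots; hence its degree
        is less than that of \<open>a\<close>.\<close>
      then obtain r where r: "degree r < card ?S" "\<forall>t\<in>?S. poly r t = csqrt (poly b t)"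
        using interpolation_exists[OF S, of "\<lambda>t. csqrt (poly b t)"] by blast
      have "(\<Prod>t\<in>?S. [:- t, 1:]) dvd r\<^sup>2 - b"
        using S r(2) by (intro prod_linear_dvd) (auto simp: power2_csqrt)
      then have "a dvd r\<^sup>2 - b"
        using ab(1) by (subst dec[symmetric]) (simp add: smult_dvd_iff)
      then obtain a' where a': "r\<^sup>2 - b = a * a'"
        by (auto simp: dvd_def)
      show ?thesis
      proof (cases "a' = 0")
        case True
        then have "a * 0\<^sup>2 + b * 1\<^sup>2 = r\<^sup>2"
          using a' by simp
        then show ?thesis
          by (intro exI[of _ 0] exI[of _ 1] exI[of _ r]) simp
      next
        case False
        \<comment> \<open>As \<open>a * a' = r^2 - b\<close>, the bounds
          \<open>degree r < degree a\<close> and \<open>degree b \<le> degree a\<close> force the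
          cofactor \<open>a'\<close> to have smaller degree than the positive degree of
          \<open>a\<close>.\<close>
        have "degree (r\<^sup>2 - b) \<le> max (2 * degree r) (degree b)"
          by (intro degree_diff_le) (auto simp: degree_power_le le_max_iff_disj intro: order.trans[OF degree_power_le])
        then have "degree a + degree a' \<le> max (2 * degree r) (degree b)"
          unfolding a' using degree_mult_eq[OF ab(1) False] by simp
        then have "degree a' < degree a"
          using r(1) deg ab(3) 3(1) by (auto simp: max_def split: if_splits)
        then obtain x y z where xyz: "x \<noteq> 0 \<or> y \<noteq> 0 \<or> z \<noteq> 0" "a' * x\<^sup>2 + b * y\<^sup>2 = z\<^sup>2"
          using IH[of a'] False by blast
        \<comment> \<open>\<open>r^2 - b\<close> and \<open>z^2 - b * y^2\<close> are norms from the
          extension by a square root of \<open>b\<close>. The new \<open>?z\<close> and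
          \<open>?y\<close> are the coordinates of the product of \<open>r + sqrt b\<close> and
          \<open>z + y * sqrt b\<close>, whose norm is the product of the two.\<close>
        let ?x = "a' * x" and ?y = "z + y * r" and ?z = "z * r + b * y"
        have "a * ?x\<^sup>2 = (a * a') * (a' * x\<^sup>2)"
          by (simp add: power2_eq_square mult_ac)
        also have "\<dots> = (r\<^sup>2 - b) * (z\<^sup>2 - b * y\<^sup>2)"
        proof -
          have "a' * x\<^sup>2 = z\<^sup>2 - b * y\<^sup>2"
            using xyz(2) by (simp add: eq_diff_eq)
          then show ?thesis
            by (simp only: a')
        qed
        finally have "a * ?x\<^sup>2 + b * ?y\<^sup>2 = ?z\<^sup>2"
          by (simp add: power2_eq_square algebra_simps)
        moreover have "?x \<noteq> 0 \<or> ?y \<noteq> 0 \<or> ?z \<noteq> 0"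
        \<comment> \<open>The pair \<open>(?y, ?z)\<close> depends linearly on
          \<open>(y, z)\<close>, with determinant \<open>r^2 - b = a * a'\<close> up to sign, which
          is nonzero.\<close>
        proof (rule ccontr)
          assume "\<not> ?thesis"
          then have 0: "x = 0" "z + y * r = 0" "z * r + b * y = 0"
            using False by auto
          have "(r\<^sup>2 - b) * y = r * (z + y * r) - (z * r + b * y)"
            by (simp add: power2_eq_square algebra_simps)
          then have "(r\<^sup>2 - b) * y = 0"
            using 0 by simp
          then have "y = 0"
            using a' False ab(1) by simp
          then show False
            using 0 xyz(1) by simp
        qed
        ultimately show ?thesis
          by blast
      qed
    qed
  qed
  show ?case
  proof (cases "degree b \<le> degree a")
    case True
    show ?thesis
    proof (rule main[OF less.prems True])
      fix a' :: "complex poly" assume "degree a' < degree a" "a' \<noteq> 0"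
      then show "\<exists>x y z. (x \<noteq> 0 \<or> y \<noteq> 0 \<or> z \<noteq> 0) \<and> a' * x\<^sup>2 + b * y\<^sup>2 = z\<^sup>2"
        using less.prems(2) by (intro less.hyps) simp_all
    qed
  next
    case False
    have "\<exists>x y z. (x \<noteq> 0 \<or> y \<noteq> 0 \<or> z \<noteq> 0) \<and> b * x\<^sup>2 + a * y\<^sup>2 = z\<^sup>2"
    proof (rule main[OF less.prems(2,1)])
      fix b' :: "complex poly" assume "degree b' < degree b" "b' \<noteq> 0"
      then show "\<exists>x y z. (x \<noteq> 0 \<or> y \<noteq> 0 \<or> z \<noteq> 0) \<and> b' * x\<^sup>2 + a * y\<^sup>2 = z\<^sup>2"
        using less.prems(1) by (intro less.hyps) simp_all
    qed (use False in simp)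
    then obtain x y z where "x \<noteq> 0 \<or> y \<noteq> 0 \<or> z \<noteq> 0" "b * x\<^sup>2 + a * y\<^sup>2 = z\<^sup>2"
      by blast
    then show ?thesis
      by (intro exI[of _ y] exI[of _ x] exI[of _ z]) (auto simp: add.commute)
  qed
qed

section \<open>Polynomials inside the rational functions, and universality of binary forms\<close>

definition to_q :: "complex poly \<Rightarrow> qfield" where "to_q p = Fract p 1"

lemma to_q_simps [simp]:
  "to_q (p + r) = to_q p + to_q r" "to_q (p * r) = to_q p * to_q r" "to_q (p - r) = to_q p - to_q r"
  "to_q (- p) = - to_q p" "to_q 0 = 0" "to_q 1 = 1" "to_q p = 0 \<longleftrightarrow> p = 0" "to_q p = to_q r \<longleftrightarrow> p = r"
  by (simp_all add: to_q_def eq_fract Zero_fract_def One_fract_def)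

lemma to_q_power [simp]: "to_q (p ^ n) = to_q p ^ n"
  by (induction n) simp_all

lemma to_q_prod [simp]: "to_q (\<Prod>i\<in>A. f i) = (\<Prod>i\<in>A. to_q (f i))"
  by (induction A rule: infinite_finite_induct) simp_all

lemma qfield_two: "(2 :: qfield) \<noteq> 0"
proof -
  have "(2 :: qfield) = to_q 2"
    using to_q_simps(1)[of 1 1] by simp
  then show ?thesis
    using to_q_simps(7)[of 2] by (metis zero_neq_numeral)
qed

lemma qfield_quotient:
  obtains p r where "(a :: qfield) = to_q p / to_q r" "r \<noteq> 0"
proof (cases a rule: Fract_cases)
  case (Fract p r)
  then show ?thesis
    using that[of p r] by (simp add: to_q_def)
qed

lemma qfield_imaginary: "to_q [:\<i>:] * to_q [:\<i>:] = - 1"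
proof -
  have "[:\<i>:] * [:\<i>:] = (- 1 :: complex poly)"
    by (simp add: one_pCons)
  then show ?thesis
    by (metis to_q_simps(2,4,6))
qed

lemma qfield_binary:
  fixes a b :: qfield
  assumes ab: "a \<noteq> 0" "b \<noteq> 0"
  shows "\<exists>x y. x\<^sup>2 * a + y\<^sup>2 * b = 1"
proof -
  obtain p r where a: "a = to_q p / to_q r" "r \<noteq> 0"
    by (rule qfield_quotient)
  obtain p' r' where b: "b = to_q p' / to_q r'" "r' \<noteq> 0"
    by (rule qfield_quotient)
  have p: "p \<noteq> 0" "p' \<noteq> 0"
    using ab a b by auto
  obtain x y z where xyz: "x \<noteq> 0 \<or> y \<noteq> 0 \<or> z \<noteq> 0" "(p * r) * x\<^sup>2 + (p' * r') * y\<^sup>2 = z\<^sup>2"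
    using ternary_form_isotropic[of "p * r" "p' * r'"] p a(2) b(2) by auto
  \<comment> \<open>From \<open>a = p / r\<close> one gets \<open>a * r^2 = p * r\<close>, so
    multiplying the unknowns by the denominators clears them.\<close>
  let ?u = "to_q (r * x)" and ?v = "to_q (r' * y)" and ?w = "to_q z"
  have "to_q ((p * r) * x\<^sup>2 + (p' * r') * y\<^sup>2) = ?w\<^sup>2"
    unfolding xyz(2) by simp
  moreover have "a * ?u\<^sup>2 = to_q (p * r * x\<^sup>2)" "b * ?v\<^sup>2 = to_q (p' * r' * y\<^sup>2)"
    using a b by (simp_all add: power2_eq_square)
  ultimately have eq: "a * ?u\<^sup>2 + b * ?v\<^sup>2 = ?w\<^sup>2"
    by simp
  have nz: "?u \<noteq> 0 \<or> ?v \<noteq> 0 \<or> ?w \<noteq> 0"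
    using xyz(1) a(2) b(2) by auto
  show ?thesis
  proof (cases "?w = 0")
    case False
    have "(?u / ?w)\<^sup>2 * a + (?v / ?w)\<^sup>2 * b = (a * ?u\<^sup>2 + b * ?v\<^sup>2) / ?w\<^sup>2"
      by (simp add: power_divide add_divide_distrib mult.commute)
    then show ?thesis
      using False unfolding eq by (intro exI[of _ "?u / ?w"] exI[of _ "?v / ?w"]) simp
  next
    case True
    then have iso: "a * ?u\<^sup>2 + b * ?v\<^sup>2 = 0"
      using eq by simp
    then have u: "?u \<noteq> 0"
      using nz True ab by (metis add_0 mult_eq_0_iff power_eq_0_iff power_zero_numeral mult_zero_right)
    \<comment> \<open>The binary form is isotropic at \<open>(?u, ?v)\<close>. On the line through
      \<open>(1, 0)\<close> in this direction its value is linear in the parameter,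
      \<open>a + s * (2 * a * ?u)\<close>, and \<open>?s\<close> solves for the value 1.\<close>
    let ?s = "(1 - a) / (2 * a * ?u)"
    have "(s * u + 1)\<^sup>2 * a + (s * v)\<^sup>2 * b = s\<^sup>2 * (a * u\<^sup>2 + b * v\<^sup>2) + s * (2 * a * u) + a"
      for s u v :: qfield
      by (simp add: power2_eq_square algebra_simps)
    then have "(?s * ?u + 1)\<^sup>2 * a + (?s * ?v)\<^sup>2 * b = ?s\<^sup>2 * (a * ?u\<^sup>2 + b * ?v\<^sup>2) + ?s * (2 * a * ?u) + a" .
    also have "\<dots> = 1"
      unfolding iso using u ab(1) qfield_two by (simp del: to_q_simps)
    finally show ?thesis
      by blast
  qed
qed

section \<open>The quantum integers\<close>

lemma q_indet_to_q: "q_indet = to_q [:0, 1:]"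
  by (simp add: q_indet_def to_q_def)

lemma q_indet_nonzero: "q_indet \<noteq> 0"
  by (simp add: q_indet_to_q)

lemma q_power: "q_indet ^ n = to_q (monom 1 n)"
  by (simp add: q_indet_to_q monom_altdef)

lemma Lam_zero: "Lam 0 = 0"
  by (simp add: Lam_def)

lemma Lam_uminus: "Lam (- m) = - Lam m"
  by (simp add: Lam_def diff_divide_distrib)

text \<open>Apart from the denominator common to all quantum integers, the factor
  \<open>q^(4 n) - 1\<close> carries the square class, since the monomial factor is the square of
  \<open>q / q^n\<close>.\<close>

lemma Lam_of_nat:
  "Lam (int n) = q_indet\<^sup>2 / q_indet ^ (2 * n) * to_q (monom 1 (4 * n) - 1) / to_q (monom 1 4 - 1)"
proof -
  note q = q_indet_nonzero
  have 1: "q_indet powi (2 * int n) = q_indet ^ (2 * n)" "q_indet powi (- 2 * int n) = inverse (q_indet ^ (2 * n))"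
    using power_int_of_nat[of q_indet "2 * n"] power_int_minus[of q_indet "2 * int n"] by simp_all
  have 2: "q_indet powi - 2 = inverse (q_indet\<^sup>2)"
    using power_int_minus[of q_indet 2] by simp
  have 3: "to_q (monom 1 (4 * n) - 1) = q_indet ^ (2 * n) * q_indet ^ (2 * n) - 1"
    "to_q (monom 1 4 - 1) = q_indet\<^sup>2 * q_indet\<^sup>2 - 1"
    by (simp_all add: q_power[symmetric] flip: power_add)
  have 4: "Q - inverse Q = (Q * Q - 1) / Q" if "Q \<noteq> 0" for Q :: qfield
    using that by (simp add: field_simps)
  have "Lam (int n) = ((q_indet ^ (2 * n) * q_indet ^ (2 * n) - 1) / q_indet ^ (2 * n)) /
      ((q_indet\<^sup>2 * q_indet\<^sup>2 - 1) / q_indet\<^sup>2)"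
    unfolding Lam_def 1 2 4[OF power_not_zero[OF q]] ..
  then show ?thesis
    unfolding 3 by simp
qed

lemma monom_minus_one_nonzero: "n > 0 \<Longrightarrow> monom 1 n - 1 \<noteq> (0 :: complex poly)"
  using degree_monom_eq[of "1 :: complex" n] by (metis degree_1 eq_iff_diff_eq_0 less_irrefl one_neq_zero)

lemma Lam_nonzero: "Lam m \<noteq> 0 \<longleftrightarrow> m \<noteq> 0"
proof -
  have pos: "Lam (int n) \<noteq> 0" if "n > 0" for n
    using that q_indet_nonzero monom_minus_one_nonzero[of "4 * n"] monom_minus_one_nonzero[of 4]
    unfolding Lam_of_nat by (simp del: to_q_simps(3))
  show ?thesis
  proof (cases m rule: int_cases3)
    case zero
    then show ?thesis by (simp add: Lam_zero)
  next
    case (pos n)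
    then show ?thesis using \<open>n > 0 \<Longrightarrow> Lam (int n) \<noteq> 0\<close> by simp
  next
    case (neg n)
    then show ?thesis using \<open>n > 0 \<Longrightarrow> Lam (int n) \<noteq> 0\<close> by (simp add: Lam_uminus)
  qed
qed

text \<open>The derivative vanishes at most at 0, which is not a root, so all roots are
  simple.\<close>

lemma order_monom_minus_one:
  fixes t :: complex
  assumes n: "n > 0"
  shows "order t (monom 1 n - 1) = (if t ^ n = 1 then 1 else 0)"
proof -
  have p: "poly (monom 1 n - 1) t = t ^ n - 1" "poly (pderiv (monom 1 n - 1)) t = of_nat n * t ^ (n - 1)" for t :: complex
    by (simp_all add: poly_monom pderiv_diff pderiv_monom)
  have "rsquarefree (monom 1 n - 1 :: complex poly)"
    unfolding rsquarefree_roots p using n by (auto simp: power_eq_0_iff zero_power)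
  then have "order t (monom 1 n - 1) = 0 \<or> order t (monom 1 n - 1) = 1"
    by (simp add: rsquarefree_def)
  moreover have "order t (monom 1 n - 1) \<noteq> 0 \<longleftrightarrow> t ^ n = 1"
    using order_root[of "monom 1 n - 1" t] monom_minus_one_nonzero[OF n] p(1)[of t] by auto
  ultimately show ?thesis
    by auto
qed

lemma order_prod:
  assumes "finite A" "\<And>i. i \<in> A \<Longrightarrow> f i \<noteq> (0 :: complex poly)"
  shows "order t (\<Prod>i\<in>A. f i) = (\<Sum>i\<in>A. order t (f i))"
  using assms
proof (induction A rule: finite_induct)
  case (insert i A)
  then have "f i * prod f A \<noteq> 0"
    by simp
  then show ?case
    using insert by (simp add: order_mult)
qed simp

lemma square_class_eq_one: "square_class x = square_class 1 \<longleftrightarrow> (\<exists>c. c \<noteq> 0 \<and> x = c\<^sup>2)" for x :: "'k::field"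
proof
  assume "square_class x = square_class 1"
  moreover have "x \<in> square_class x"
    unfolding square_class_def by (auto intro!: exI[of _ 1])
  ultimately show "\<exists>c. c \<noteq> 0 \<and> x = c\<^sup>2"
    by (auto simp: square_class_def)
next
  assume "\<exists>c. c \<noteq> 0 \<and> x = c\<^sup>2"
  then obtain c where c: "c \<noteq> 0" "x = c\<^sup>2"
    by blast
  show "square_class x = square_class 1"
    unfolding square_class_def c(2)
  proof (intro equalityI subsetI)
    fix y :: 'k assume "y \<in> {c\<^sup>2 * e\<^sup>2 |e. e \<noteq> 0}"
    then obtain e where "e \<noteq> 0" "y = c\<^sup>2 * e\<^sup>2"
      by blast
    then show "y \<in> {1 * e\<^sup>2 |e. e \<noteq> 0}"
      using c(1) by (auto simp: power_mult_distrib intro!: exI[of _ "c * e"])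
  next
    fix y :: 'k assume "y \<in> {1 * e\<^sup>2 |e. e \<noteq> 0}"
    then obtain e where "e \<noteq> 0" "y = 1 * e\<^sup>2"
      by blast
    then show "y \<in> {c\<^sup>2 * e\<^sup>2 |e. e \<noteq> 0}"
      using c(1) by (auto simp: power_divide intro!: exI[of _ "e / c"])
  qed
qed

text \<open>
  A primitive root of unity of order \<open>4 m\<close>, where \<open>m\<close> is the largest part, is a simple zero of
  exactly one of the factors.
\<close>

lemma prod_Lam_not_square:
  fixes f :: "'i \<Rightarrow> nat"
  assumes A: "finite A" "even (card A)" and pos: "\<And>i. i \<in> A \<Longrightarrow> f i > 0"
    and j: "j \<in> A" and max: "\<And>i. i \<in> A \<Longrightarrow> i \<noteq> j \<Longrightarrow> f i < f j"
  shows "(\<Prod>i\<in>A. Lam (int (f i))) \<noteq> c\<^sup>2"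
proof
  assume sq: "(\<Prod>i\<in>A. Lam (int (f i))) = c\<^sup>2"
  define F where "F = (\<Prod>i\<in>A. monom 1 (4 * f i) - 1 :: complex poly)"
  let ?m = "card A div 2"
  \<comment> \<open>\<open>h\<close> collects what already occurs squared: the monomial factors and,
    because \<open>card A\<close> is even, the denominators.\<close>
  define h where "h = (\<Prod>i\<in>A. q_indet / q_indet ^ f i) / to_q (monom 1 4 - 1) ^ ?m"
  have h0: "h \<noteq> 0"
    using q_indet_nonzero monom_minus_one_nonzero[of 4] A(1) by (simp add: h_def del: to_q_simps(3))
  have "card A = ?m + ?m"
    using A(2) by presburger
  then have m: "K ^ card A = (K ^ ?m)\<^sup>2" for K :: qfield
    by (metis power_add power2_eq_square)
  have *: "(\<Prod>i\<in>A. (g i)\<^sup>2 * G i / K) = (\<Prod>i\<in>A. g i)\<^sup>2 * (\<Prod>i\<in>A. G i) / K ^ card A" for g G and K :: qfield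
    by (simp add: prod_dividef prod.distrib prod_power_distrib)
  have "(\<Prod>i\<in>A. Lam (int (f i))) = (\<Prod>i\<in>A. (q_indet / q_indet ^ f i)\<^sup>2 * to_q (monom 1 (4 * f i) - 1) / to_q (monom 1 4 - 1))"
    unfolding Lam_of_nat by (simp add: power_divide mult.commute flip: power_mult)
  also have "\<dots> = (\<Prod>i\<in>A. q_indet / q_indet ^ f i)\<^sup>2 * to_q F / to_q (monom 1 4 - 1) ^ card A"
    unfolding * F_def to_q_prod ..
  also have "\<dots> = h\<^sup>2 * to_q F"
    unfolding h_def m power_divide by (simp only: times_divide_eq_left)
  finally have "to_q F = (c / h)\<^sup>2"
    using sq h0 by (simp add: power_divide field_simps)
  \<comment> \<open>Multiplicities at a root are going to be compared in
    \<open>F * v^2 = u^2\<close>. The fraction need not be reduced, for \<open>v\<close> contributes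
    an even amount.\<close>
  moreover obtain u v where "c / h = to_q u / to_q v" "v \<noteq> 0"
    by (rule qfield_quotient)
  ultimately have "to_q (F * v\<^sup>2) = to_q (u\<^sup>2)" and v: "v \<noteq> 0"
    by (simp_all add: power_divide)
  then have Fv: "F * v\<^sup>2 = u\<^sup>2"
    by (simp del: to_q_simps(2) to_q_power)
  have F0: "F \<noteq> 0"
    unfolding F_def using A(1) pos monom_minus_one_nonzero by auto
  then have u: "u \<noteq> 0"
    using Fv v by auto
  define t where "t = cis (2 * pi / (4 * f j))"
  have t: "t ^ (4 * i) = cis (2 * pi * (i / f j))" for i
    unfolding t_def DeMoivre by (simp add: field_simps)
  have tj: "t ^ (4 * f j) = 1"
    using pos[OF j] by (simp add: t)
  have ti: "t ^ (4 * i) \<noteq> 1" if "0 < i" "i < f j" for i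
  proof
    assume "t ^ (4 * i) = 1"
    then have "cos (2 * pi * (i / f j)) = 1"
      unfolding t by (metis cis.sel(1) one_complex.sel(1))
    then obtain k :: int where "2 * pi * (i / f j) = of_int k * 2 * pi"
      unfolding cos_one_2pi_int by blast
    then have "2 * pi * (real i / f j - of_int k) = 0"
      by (simp add: right_diff_distrib mult_ac)
    then have "real i / f j = of_int k"
      by simp
    moreover have "0 < real i / f j" "real i / f j < 1"
      using that by auto
    ultimately show False
      by simp
  qed
  have "order t F = (\<Sum>i\<in>A. order t (monom 1 (4 * f i) - 1))"
    unfolding F_def using A(1) pos monom_minus_one_nonzero by (intro order_prod) auto
  also have "\<dots> = (\<Sum>i\<in>A. if i = j then 1 else 0)"
    using pos ti max tj by (intro sum.cong) (auto simp: order_monom_minus_one)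
  also have "\<dots> = 1"
    using A(1) j by simp
  finally have "order t F = 1" .
  moreover have "order t (F * v\<^sup>2) = order t F + 2 * order t v"
    using F0 v by (simp add: order_mult power2_eq_square)
  moreover have "order t (u\<^sup>2) = 2 * order t u"
    using u by (simp add: order_mult power2_eq_square)
  ultimately have "1 + 2 * order t v = 2 * order t u"
    using Fv by simp
  then show False
    by presburger
qed

section \<open>Simple modules over Clifford superalgebras\<close>

context
  fixes I :: "nat set" and d :: "nat \<Rightarrow> 'k::field" and e :: 'k and N :: "nat set"
  assumes I: "finite I" and N: "N = {i \<in> I. d i \<noteq> 0}" and two: "(2 :: 'k) \<noteq> 0" and e: "e * e = - 1"
    and binary: "\<forall>a b :: 'k. a \<noteq> 0 \<longrightarrow> b \<noteq> 0 \<longrightarrow> (\<exists>x y. x\<^sup>2 * a + y\<^sup>2 * b = 1)"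
begin

lemma finite_nonzero: "finite N" and nonzero_coeff: "\<forall>i\<in>N. d i \<noteq> 0" and nonzero_subset: "N \<subseteq> I"
  using I by (auto simp: N)

lemma simple_embedding:
  fixes M :: "('k free_elt set, 'm) graded"
  assumes M: "simple_supermodule (clifford I d) M"
  shows "\<exists>\<iota> ev. cliff_embed I d M \<iota> ev \<and>
    clmod N d (cliff_embed.op I d M \<iota> ev) (cliff_embed.sp M \<iota>) \<and>
    graded_simple N (cliff_embed.op I d M \<iota> ev) (cliff_embed.sp M \<iota>) \<and>
    (\<forall>i\<in>I - N. \<forall>p. \<forall>x\<in>cliff_embed.sp M \<iota> p. cliff_embed.op I d M \<iota> ev i x = 0)"
proof -
  have "supermodule (clifford I d) M"
    using M by (simp add: simple_supermodule_def)
  then obtain \<iota> ev where emb: "cliff_embed I d M \<iota> ev"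
    using cliff_embed_exists two by blast
  interpret cliff_embed I d M \<iota> ev by (rule emb)
  interpret V: clmod I d op sp by (rule clmod)
  have simple: "graded_simple I op sp"
    using M simple_iff by simp
  have 0: "op i x = 0" if "i \<in> I - N" "x \<in> sp p" for i x p
    using V.graded_simple_zero_gen[OF simple _ _ that(2)] that(1) by (auto simp: N)
  have "graded_simple N op sp"
    using simple graded_simple_zero_gens[OF nonzero_subset 0] by simp
  then show ?thesis
    using emb V.clmod_subset[OF nonzero_subset] 0 by (intro exI[of _ \<iota>] exI[of _ ev]) simp
qed

text \<open>The two modules may have elements of different types: each is embedded in its own
  function space, and only the graded families are compared.\<close>

lemma simple_modules_iso:
  fixes M :: "('k free_elt set, 'm) graded" and M' :: "('k free_elt set, 'n) graded"
  assumes M: "simple_supermodule (clifford I d) M" and M': "simple_supermodule (clifford I d) M'"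
  shows "supermodule_iso (clifford I d) M M' \<or>
    split_form N d \<and> supermodule_iso (clifford I d) M (parity_change M')"
proof -
  obtain \<iota> ev where emb: "cliff_embed I d M \<iota> ev"
    and cl: "clmod N d (cliff_embed.op I d M \<iota> ev) (cliff_embed.sp M \<iota>)"
    and simple: "graded_simple N (cliff_embed.op I d M \<iota> ev) (cliff_embed.sp M \<iota>)"
    and 0: "\<forall>i\<in>I - N. \<forall>p. \<forall>x\<in>cliff_embed.sp M \<iota> p. cliff_embed.op I d M \<iota> ev i x = 0"
    using simple_embedding[OF M] by blast
  obtain \<iota>' ev' where emb': "cliff_embed I d M' \<iota>' ev'"
    and cl': "clmod N d (cliff_embed.op I d M' \<iota>' ev') (cliff_embed.sp M' \<iota>')"
    and simple': "graded_simple N (cliff_embed.op I d M' \<iota>' ev') (cliff_embed.sp M' \<iota>')"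
    and zero': "\<forall>i\<in>I - N. \<forall>p. \<forall>x\<in>cliff_embed.sp M' \<iota>' p. cliff_embed.op I d M' \<iota>' ev' i x = 0"
    using simple_embedding[OF M'] by blast
  interpret E: cliff_embed I d M \<iota> ev by (rule emb)
  interpret E': cliff_embed I d M' \<iota>' ev' by (rule emb')
  interpret V: clmod N d E.op E.sp by (rule cl)
  \<comment> \<open>An isomorphism for the generators in \<open>N\<close> is one for all of
    \<open>I\<close>, because the remaining generators act by zero on both sides.\<close>
  have ext: "graded_iso I E.op E.sp E'.op W"
    if iso: "graded_iso N E.op E.sp E'.op W" and W: "\<And>i x p. i \<in> I - N \<Longrightarrow> x \<in> W p \<Longrightarrow> E'.op i x = 0" for W
  proof (rule graded_iso_zero_gens[OF nonzero_subset _ _ V.sub iso])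
    show "E.op i x = 0" if "i \<in> I - N" "x \<in> E.sp p" for i x p
      using 0 that by blast
    show "E'.op i x = 0" if "i \<in> I - N" "x \<in> W p" for i x p
      using that by (rule W)
  qed
  have 1: "E'.op i x = 0" if "i \<in> I - N" "x \<in> E'.sp p" for i x p
    using zero' that by blast
  have 2: "E'.op i x = 0" if "i \<in> I - N" "x \<in> shift E'.sp p" for i x p
    using zero' that by (auto simp: shift_def)
  have "graded_iso N E.op E.sp E'.op E'.sp \<or> split_form N d \<and> graded_iso N E.op E.sp E'.op (shift E'.sp)"
    by (rule clmod_simple_iso[OF e binary finite_nonzero nonzero_coeff cl cl' simple simple'])
  then have "graded_iso I E.op E.sp E'.op E'.sp \<or> split_form N d \<and> graded_iso I E.op E.sp E'.op (shift E'.sp)"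
    using ext[of E'.sp] ext[of "shift E'.sp"] 1 2 by blast
  then show ?thesis
    using E.graded_iso_supermodule_iso[OF emb']
      E.graded_iso_supermodule_iso[OF E'.embed_parity_change, unfolded E'.op_parity_change E'.sp_parity_change]
    by blast
qed

lemma simple_parity_change:
  fixes M :: "('k free_elt set, 'm) graded"
  assumes M: "simple_supermodule (clifford I d) M"
  shows "simple_supermodule (clifford I d) (parity_change M)"
proof -
  obtain \<iota> ev where emb: "cliff_embed I d M \<iota> ev"
    using simple_embedding[OF M] by blast
  interpret E: cliff_embed I d M \<iota> ev by (rule emb)
  have "graded_simple I E.op (shift E.sp)"
    using graded_simple_shift M E.simple_iff by blast
  then show ?thesis
    using cliff_embed.simple_iff[OF E.embed_parity_change]
    unfolding E.op_parity_change E.sp_parity_change by simp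
qed

lemma simple_iso_parity_change:
  fixes M :: "('k free_elt set, 'm) graded"
  assumes M: "simple_supermodule (clifford I d) M"
  shows "supermodule_iso (clifford I d) M (parity_change M) \<longleftrightarrow> \<not> split_form N d"
proof
  assume "\<not> split_form N d"
  then show "supermodule_iso (clifford I d) M (parity_change M)"
    using simple_modules_iso[OF M simple_parity_change[OF M]] by blast
next
  assume iso: "supermodule_iso (clifford I d) M (parity_change M)"
  obtain \<iota> ev where emb: "cliff_embed I d M \<iota> ev"
    and cl: "clmod N d (cliff_embed.op I d M \<iota> ev) (cliff_embed.sp M \<iota>)"
    and simple: "graded_simple N (cliff_embed.op I d M \<iota> ev) (cliff_embed.sp M \<iota>)"
    using simple_embedding[OF M] by blast
  interpret E: cliff_embed I d M \<iota> ev by (rule emb)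
  have "graded_iso I E.op E.sp E.op (shift E.sp)"
    using E.supermodule_iso_graded_iso[OF E.embed_parity_change iso]
    unfolding E.op_parity_change E.sp_parity_change .
  then have "graded_iso N E.op E.sp E.op (shift E.sp)"
    using nonzero_subset unfolding graded_iso_def by blast
  then show "\<not> split_form N d"
    using clmod_simple_not_iso_shift[OF e binary finite_nonzero nonzero_coeff cl simple] by blast
qed

lemma simple_dim:
  fixes M :: "('k free_elt set, 'm) graded"
  assumes M: "simple_supermodule (clifford I d) M"
  shows "\<not> split_form N d \<Longrightarrow> has_superdim (clifford I d) M (2 ^ (card N div 2)) (2 ^ (card N div 2))"
    "split_form N d \<Longrightarrow> N \<noteq> {} \<Longrightarrow> has_superdim (clifford I d) M (2 ^ (card N div 2 - 1)) (2 ^ (card N div 2 - 1))"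
proof -
  obtain \<iota> ev where emb: "cliff_embed I d M \<iota> ev"
    and cl: "clmod N d (cliff_embed.op I d M \<iota> ev) (cliff_embed.sp M \<iota>)"
    and simple: "graded_simple N (cliff_embed.op I d M \<iota> ev) (cliff_embed.sp M \<iota>)"
    using simple_embedding[OF M] by blast
  interpret E: cliff_embed I d M \<iota> ev by (rule emb)
  obtain m where dim: "\<And>p. dim_is (E.sp p) (m p)" and eq: "N \<noteq> {} \<Longrightarrow> m 0 = m 1"
    and tot: "m 0 + m 1 = 2 ^ (card N div 2 + (if split_form N d then 0 else 1))"
    using clmod_simple_dim[OF e binary finite_nonzero nonzero_coeff cl simple] by blast
  have sd: "has_superdim (clifford I d) M (m 0) (m 1)"
    unfolding has_superdim_def using E.has_dim_homog[OF dim] by blast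
  show "has_superdim (clifford I d) M (2 ^ (card N div 2)) (2 ^ (card N div 2))" if ns: "\<not> split_form N d"
  proof -
    have "N \<noteq> {}"
      using ns split_empty by auto
    then have "m 0 = 2 ^ (card N div 2)" "m 1 = 2 ^ (card N div 2)"
      using eq tot ns by auto
    then show ?thesis
      using sd by simp
  qed
  show "has_superdim (clifford I d) M (2 ^ (card N div 2 - 1)) (2 ^ (card N div 2 - 1))"
    if s: "split_form N d" and ne: "N \<noteq> {}"
  proof -
    have "card N \<noteq> 0" "even (card N)"
      using s ne finite_nonzero by (auto simp: split_form_def)
    then obtain k where k: "card N div 2 = Suc k"
      by (metis dvd_mult_div_cancel mult_zero_right not0_implies_Suc)
    then have "m 0 = 2 ^ k" "m 1 = 2 ^ k"
      using eq[OF ne] tot s by auto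
    then show ?thesis
      using sd k by simp
  qed
qed

text \<open>The exterior algebra model is nonzero and, over the generators in \<open>N\<close>,
  spanned by simple subfamilies, so there is one. The generators outside \<open>N\<close> act by
  zero on the whole model, hence it stays simple over \<open>I\<close>.\<close>

lemma simple_module_exists:
  "\<exists>E :: ('k free_elt set, nat \<Rightarrow> 'k) graded. simple_supermodule (clifford I d) E"
proof -
  let ?J = "jw_module I d"
  obtain \<iota> ev where emb: "cliff_embed I d ?J \<iota> ev"
    using cliff_embed_exists[OF supermodule_jw two] by blast
  interpret E: cliff_embed I d ?J \<iota> ev by (rule emb)
  interpret V: clmod I d E.op E.sp by (rule E.clmod)
  have zero: "E.op i x = 0" if "i \<in> I - N" for i x
    using that jw_zero_gen[of i I d "ev x"] E.emb_zero by (simp add: E.op_def E.gen_def N jw_module_sel)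
  have span: "spanned_by_simples N E.op E.sp"
    by (rule clmod_spanned_by_simples[OF e binary finite_nonzero nonzero_coeff V.clmod_subset[OF nonzero_subset]])
  have "carrier ?J \<noteq> {\<zero>\<^bsub>?J\<^esub>}"
  proof
    assume "carrier ?J = {\<zero>\<^bsub>?J\<^esub>}"
    then have "(\<lambda>_ :: nat. 1) \<in> {\<lambda>_. 0 :: 'k}"
      unfolding jw_module_sel by blast
    then show False
      by (simp add: fun_eq_iff)
  qed
  then obtain p where "E.sp p \<noteq> {0}"
    using E.sub_of_zero[OF V.stable order.refl] E.sub_of_sp by auto
  moreover have "0 \<in> E.sp p"
    by (rule V.V_closed(1))
  ultimately obtain x where x: "x \<in> E.sp p" "x \<noteq> 0"
    by blast
  have "\<exists>U. graded_simple N E.op U \<and> U \<le> E.sp"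
  proof (rule ccontr)
    assume "\<not> ?thesis"
    then have empty: "\<Union>{U p |U. graded_simple N E.op U \<and> U \<le> E.sp} = {}"
      by blast
    have "E.sp p \<subseteq> pm.span (\<Union>{U p |U. graded_simple N E.op U \<and> U \<le> E.sp})"
      using span unfolding spanned_by_simples_def by (rule spec)
    then show False
      unfolding empty using x by auto
  qed
  then obtain U where U: "graded_simple N E.op U" "U \<le> E.sp"
    by blast
  have "graded_simple I E.op U \<longleftrightarrow> graded_simple N E.op U"
    by (rule graded_simple_zero_gens[OF nonzero_subset]) (rule zero)
  then have "graded_simple I E.op U"
    using U(1) by simp
  then have "simple_supermodule (clifford I d) (submodule_on ?J (E.sub_of U))"
    using E.simple_sub_of[OF _ U(2)] by (simp add: graded_simple_def)
  then show ?thesis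
    by blast
qed

end

lemma completely_reducible_clifford:
  fixes M :: "('k::field free_elt set, 'm) graded" and e :: 'k
  assumes M: "supermodule (clifford N d) M" and N: "finite N" "\<forall>i\<in>N. d i \<noteq> 0" and two: "(2 :: 'k) \<noteq> 0"
    and e: "e * e = - 1" and binary: "\<forall>a b :: 'k. a \<noteq> 0 \<longrightarrow> b \<noteq> 0 \<longrightarrow> (\<exists>x y. x\<^sup>2 * a + y\<^sup>2 * b = 1)"
  shows "completely_reducible (clifford N d) M"
proof -
  obtain \<iota> ev where emb: "cliff_embed N d M \<iota> ev"
    using cliff_embed_exists[OF M two] by blast
  interpret cliff_embed N d M \<iota> ev by (rule emb)
  show ?thesis
    by (rule completely_reducible_of_spanned[OF clmod_spanned_by_simples[OF e binary N clmod]])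
qed

text \<open>The weights at \<open>1, ..., 2 k\<close> are positive, so by the count of nonzero
  weights the index set is exactly \<open>{1..2 * k}\<close>. Its largest weight sits at index 1
  only, as the criterion for nonsquares demands.\<close>

lemma Delta_strictly_decreasing:
  assumes card: "card (nonzero_indices n l) = 2 * k" and k: "k \<ge> 1"
    and dec: "\<forall>i\<in>{1..<2 * k}. l i > l (i + 1)" and last: "l (2 * k) > 0"
  shows "square_class (Delta n l) \<noteq> square_class 1"
proof
  have mono: "l j < l i" if "1 \<le> i" "i < j" "j \<le> 2 * k" for i j
    using that(2,3)
  proof (induction j rule: less_induct)
    case (less j)
    then obtain j' where j: "j = Suc j'"
      by (cases j) auto
    have step: "l j < l j'"
      using bspec[OF dec, of j'] less.prems that(1) j by simp
    then show ?case
      using less.IH[of j'] less.prems j by (cases "i = j'") auto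
  qed
  have pos: "l i > 0" if "i \<in> {1..2 * k}" for i
    using mono[of i "2 * k"] last that by (cases "i = 2 * k") auto
  have "card (nonzero_indices n l) \<le> card {1..n}"
    by (intro card_mono) (auto simp: nonzero_indices_def)
  then have "2 * k \<le> n"
    using card by simp
  then have "{1..2 * k} \<subseteq> nonzero_indices n l"
    using pos by (force simp: nonzero_indices_def)
  then have eq: "nonzero_indices n l = {1..2 * k}"
    using card by (intro card_subset_eq[symmetric]) (auto simp: nonzero_indices_def)
  assume "square_class (Delta n l) = square_class 1"
  then obtain c where c: "Delta n l = c\<^sup>2"
    by (auto simp: square_class_eq_one)
  have "Delta n l = (\<Prod>i\<in>{1..2 * k}. Lam (int (nat (l i))))"
    unfolding Delta_def eq using pos by (intro prod.cong) (auto simp: less_imp_le)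
  moreover have "(\<Prod>i\<in>{1..2 * k}. Lam (int (nat (l i)))) \<noteq> c\<^sup>2"
  proof (rule prod_Lam_not_square[where j = 1])
    fix i assume "i \<in> {1..2 * k}" "i \<noteq> 1"
    then show "nat (l i) < nat (l 1)"
      using mono[of 1 i] pos[of 1] k by auto
  qed (use pos k in auto)
  ultimately show False
    using c by simp
qed

text \<open>Types cannot be quantified inside the statement, so \<open>E\<close> is placed on the
  type of the exterior algebra model and compared with modules \<open>M\<close> over an arbitrary
  type. The split dimensions are given for \<open>k \<ge> 1\<close>: for \<open>k = 0\<close> the
  simple module is a line in a single parity.\<close>

theorem corollary3p9:
  fixes n :: nat and l :: "nat \<Rightarrow> int"
  shows
    "(\<forall>M :: (qcliff_elt, 'm) graded.
        supermodule (Cliff_q (nonzero_indices n l) l) M \<longrightarrow>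
        completely_reducible (Cliff_q (nonzero_indices n l) l) M) \<and>
     (\<forall>k. card (nonzero_indices n l) = 2 * k \<and> square_class (Delta n l) = square_class 1 \<longrightarrow>
        (\<exists>E :: (qcliff_elt, nat \<Rightarrow> qfield) graded.
           simple_supermodule (Cliff_q {1..n} l) E \<and>
           simple_supermodule (Cliff_q {1..n} l) (parity_change E) \<and>
           \<not> supermodule_iso (Cliff_q {1..n} l) E (parity_change E) \<and>
           (\<forall>M :: (qcliff_elt, 'm) graded. simple_supermodule (Cliff_q {1..n} l) M \<longrightarrow>
              supermodule_iso (Cliff_q {1..n} l) M E \<or>
              supermodule_iso (Cliff_q {1..n} l) M (parity_change E)) \<and>
           (k \<ge> 1 \<longrightarrow>
              has_superdim (Cliff_q {1..n} l) E (2 ^ (k - 1)) (2 ^ (k - 1)) \<and>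
              has_superdim (Cliff_q {1..n} l) (parity_change E) (2 ^ (k - 1)) (2 ^ (k - 1))))) \<and>
     (\<forall>k. card (nonzero_indices n l) = 2 * k \<and> square_class (Delta n l) \<noteq> square_class 1 \<longrightarrow>
        (\<exists>E :: (qcliff_elt, nat \<Rightarrow> qfield) graded.
           simple_supermodule (Cliff_q {1..n} l) E \<and>
           supermodule_iso (Cliff_q {1..n} l) E (parity_change E) \<and>
           (\<forall>M :: (qcliff_elt, 'm) graded. simple_supermodule (Cliff_q {1..n} l) M \<longrightarrow>
              supermodule_iso (Cliff_q {1..n} l) M E) \<and>
           has_superdim (Cliff_q {1..n} l) E (2 ^ k) (2 ^ k))) \<and>
     (\<forall>k. card (nonzero_indices n l) = 2 * k \<and> k \<ge> 1 \<and>
          (\<forall>i\<in>{1..<2 * k}. l i > l (i + 1)) \<and> l (2 * k) > 0 \<longrightarrow>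
        square_class (Delta n l) \<noteq> square_class 1) \<and>
     (\<forall>k. card (nonzero_indices n l) = 2 * k + 1 \<longrightarrow>
        (\<exists>E :: (qcliff_elt, nat \<Rightarrow> qfield) graded.
           simple_supermodule (Cliff_q {1..n} l) E \<and>
           supermodule_iso (Cliff_q {1..n} l) E (parity_change E) \<and>
           (\<forall>M :: (qcliff_elt, 'm) graded. simple_supermodule (Cliff_q {1..n} l) M \<longrightarrow>
              supermodule_iso (Cliff_q {1..n} l) M E) \<and>
           has_superdim (Cliff_q {1..n} l) E (2 ^ k) (2 ^ k)))"
proof -
  let ?N = "nonzero_indices n l" and ?d = "\<lambda>i. Lam (l i)"
  have N: "?N = {i \<in> {1..n}. ?d i \<noteq> 0}"
    by (simp add: nonzero_indices_def Lam_nonzero)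
  have fin: "finite ?N" and nz: "\<forall>i\<in>?N. ?d i \<noteq> 0"
    unfolding N by auto
  have binary: "\<forall>a b :: qfield. a \<noteq> 0 \<longrightarrow> b \<noteq> 0 \<longrightarrow> (\<exists>x y. x\<^sup>2 * a + y\<^sup>2 * b = 1)"
    using qfield_binary by blast
  note field = finite_atLeastAtMost[of 1 n] N qfield_two qfield_imaginary binary
  note iso = simple_modules_iso[OF field] and par = simple_parity_change[OF field]
    and iso_par = simple_iso_parity_change[OF field] and dim = simple_dim[OF field]
  have Delta_nz: "Delta n l \<noteq> 0"
    unfolding Delta_def using fin nz by simp
  \<comment> \<open>\<open>split_form\<close> admits the square root 0 and
    \<open>square_class\<close> does not; \<open>Delta n l \<noteq> 0\<close> reconciles the
    two.\<close>
  have split: "split_form ?N ?d \<longleftrightarrow> even (card ?N) \<and> square_class (Delta n l) = square_class 1"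
    using Delta_nz unfolding split_form_def square_class_eq_one Delta_def by (metis power_zero_numeral)
  obtain E :: "(qcliff_elt, nat \<Rightarrow> qfield) graded" where E: "simple_supermodule (clifford {1..n} ?d) E"
    using simple_module_exists[OF field] by blast
  have nonsplit: "\<exists>E :: (qcliff_elt, nat \<Rightarrow> qfield) graded.
           simple_supermodule (Cliff_q {1..n} l) E \<and>
           supermodule_iso (Cliff_q {1..n} l) E (parity_change E) \<and>
           (\<forall>M :: (qcliff_elt, 'm) graded. simple_supermodule (Cliff_q {1..n} l) M \<longrightarrow>
              supermodule_iso (Cliff_q {1..n} l) M E) \<and>
           has_superdim (Cliff_q {1..n} l) E (2 ^ k) (2 ^ k)"
    if "\<not> split_form ?N ?d" "card ?N div 2 = k" for k
    unfolding Cliff_q_def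
    using E that(1) iso_par[OF E] iso[OF _ E] dim(1)[OF E that(1)] that(2) by (intro exI[of _ E]) blast
  show ?thesis
  proof (intro conjI allI impI)
    fix M :: "(qcliff_elt, 'm) graded" assume "supermodule (Cliff_q ?N l) M"
    then show "completely_reducible (Cliff_q ?N l) M"
      unfolding Cliff_q_def
      by (rule completely_reducible_clifford[OF _ fin nz qfield_two qfield_imaginary binary])
  next
    fix k assume k: "card ?N = 2 * k \<and> square_class (Delta n l) = square_class 1"
    then have s: "split_form ?N ?d"
      using split by simp
    have sd: "has_superdim (clifford {1..n} ?d) M (2 ^ (k - 1)) (2 ^ (k - 1))"
      if "k \<ge> 1" "simple_supermodule (clifford {1..n} ?d) M" for M :: "(qcliff_elt, nat \<Rightarrow> qfield) graded"
    proof -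
      have "?N \<noteq> {}"
        using that(1) k by auto
      then show ?thesis
        using dim(2)[OF that(2) s] k by simp
    qed
    show "\<exists>E :: (qcliff_elt, nat \<Rightarrow> qfield) graded.
           simple_supermodule (Cliff_q {1..n} l) E \<and>
           simple_supermodule (Cliff_q {1..n} l) (parity_change E) \<and>
           \<not> supermodule_iso (Cliff_q {1..n} l) E (parity_change E) \<and>
           (\<forall>M :: (qcliff_elt, 'm) graded. simple_supermodule (Cliff_q {1..n} l) M \<longrightarrow>
              supermodule_iso (Cliff_q {1..n} l) M E \<or>
              supermodule_iso (Cliff_q {1..n} l) M (parity_change E)) \<and>
           (k \<ge> 1 \<longrightarrow>
              has_superdim (Cliff_q {1..n} l) E (2 ^ (k - 1)) (2 ^ (k - 1)) \<and>
              has_superdim (Cliff_q {1..n} l) (parity_change E) (2 ^ (k - 1)) (2 ^ (k - 1)))"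
      unfolding Cliff_q_def
      using E par[OF E] s iso_par[OF E] iso[OF _ E] sd[OF _ E] sd[OF _ par[OF E]]
      by (intro exI[of _ E]) blast
  next
    fix k assume "card ?N = 2 * k \<and> k \<ge> 1 \<and> (\<forall>i\<in>{1..<2 * k}. l i > l (i + 1)) \<and> l (2 * k) > 0"
    then show "square_class (Delta n l) \<noteq> square_class 1"
      using Delta_strictly_decreasing by blast
  qed (rule nonsplit; simp add: split)+
qed

end
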